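(* Let $n\ge 1$. Consider the reduced random walk on the alcoves of the affine Weyl group $\tilde C_n$, with weights given by the dual Kac labels $\check a_0=\check a_1=\dots=\check a_n=1$. Its limiting direction is parallel to (a positive multiple of) $$\sum_{i=1}^n (2i+1)\,e_i .$$
   Context: Let $e_1,\dots,e_n$ be the standard basis of $\mathbb R^n$. The root system $C_n$ is $\Phi=\{\pm e_i\pm e_j: i<j\}\cup\{\pm 2e_i\}$, with simple roots $\alpha_0=2e_1$, $\alpha_i=e_{i+1}-e_i$ ($1\le i\le n-1$), and highest root $\theta=2e_n$. Consider the hyperplanes $H_{\alpha,k}=\{x:\langle x,\alpha\rangle=k\}$, $\alpha\in\Phi$, $k\in\mathbb Z$. The affine Weyl group is generated by the reflections in these hyperplanes. Alcoves are the connected components of the complement of the union of all $H_{\alpha,k}$; the affine group acts simply transitively on them. The fundamental alcove is $A_0=\{x:\langle x,\alpha_i\rangle>0\ (0\le i\le n-1),\ \langle x,\theta\rangle<1\}$. A facet of an alcove $wA_0$ has type $i$ ($0\le i\le n-1$) if it is the image under $w$ of the facet of $A_0$ contained in $H_{\alpha_i,0}$, and type $n$ if it is the image of the facet contained in $H_{\theta,1}$. Reduced random walk with weights $(a_0,\dots,a_n)$ (positive reals): $X_0=A_0$; given $X_t$, the next alcove $X_{t+1}$ is chosen among the alcoves adjacent to $X_t$ through a facet whose hyperplane does not separate $X_t$ from $A_0$ (i.e. has not been crossed before), the facet of type $i$ being chosen with probability proportional to $a_i$. Almost surely the walk is eventually confined to one chamber of the finite Weyl group $W$ (a component of the complement of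 $\bigcup_{\alpha}H_{\alpha,0}$). The limiting direction is the almost sure limit of $x_t/\|x_t\|$, where $x_t\in X_t$, for the walk confined to (i.e. on the event that it eventually stays in) the identity chamber $\{x:\langle x,\alpha_i\rangle>0,\ 0\le i\le n-1\}$. *)

theory Defs
  imports "HOL-Probability.Probability"
begin

text \<open>
  Throughout, the ambient space is \<^typ>\<open>real ^ 'n\<close>, the rank \<open>n\<close> is \<open>CARD('n)\<close>, and
  \<open>e 1, \<dots>, e n\<close> is the standard basis, enumerated as
  \<open>bij_betw e {1..CARD('n)} Basis\<close>. The enumeration is a parameter because an arbitrary
  finite index type \<open>'n\<close> carries no order.
\<close>

subsection \<open>The root system and its affine hyperplanes\<close>

definition roots :: "(nat \<Rightarrow> real ^ 'n) \<Rightarrow> (real ^ 'n) set" where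
  "roots e =
     {\<sigma> *\<^sub>R e i + \<tau> *\<^sub>R e j | \<sigma> \<tau> i j.
        \<sigma> \<in> {-1, 1} \<and> \<tau> \<in> {-1, 1} \<and> 1 \<le> i \<and> i < j \<and> j \<le> CARD('n)} \<union>
     {(2 * \<sigma>) *\<^sub>R e i | \<sigma> i. \<sigma> \<in> {-1, 1} \<and> 1 \<le> i \<and> i \<le> CARD('n)}"

definition simple_root :: "(nat \<Rightarrow> real ^ 'n) \<Rightarrow> nat \<Rightarrow> real ^ 'n" where
  "simple_root e i = (if i = 0 then 2 *\<^sub>R e 1 else e (i + 1) - e i)"

definition highest_root :: "(nat \<Rightarrow> real ^ 'n) \<Rightarrow> real ^ 'n" where
  "highest_root e = 2 *\<^sub>R e CARD('n)"

definition hyperplane :: "real ^ 'n \<Rightarrow> int \<Rightarrow> (real ^ 'n) set" where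
  "hyperplane \<alpha> k = {x. x \<bullet> \<alpha> = of_int k}"

definition refl_map :: "real ^ 'n \<Rightarrow> int \<Rightarrow> real ^ 'n \<Rightarrow> real ^ 'n" where
  "refl_map \<alpha> k x = x - (2 * (x \<bullet> \<alpha> - of_int k) / (\<alpha> \<bullet> \<alpha>)) *\<^sub>R \<alpha>"

text \<open>Reflections are involutions, so closing under composition with them yields a group.\<close>

inductive_set affine_weyl_group :: "(nat \<Rightarrow> real ^ 'n) \<Rightarrow> (real ^ 'n \<Rightarrow> real ^ 'n) set"
  for e :: "nat \<Rightarrow> real ^ 'n" where
  id: "id \<in> affine_weyl_group e"
| refl: "w \<in> affine_weyl_group e \<Longrightarrow> \<alpha> \<in> roots e \<Longrightarrow> refl_map \<alpha> k \<circ> w \<in> affine_weyl_group e"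


subsection \<open>Alcoves and facet types\<close>

definition alcoves :: "(nat \<Rightarrow> real ^ 'n) \<Rightarrow> (real ^ 'n) set set" where
  "alcoves e = components (UNIV - (\<Union>\<alpha>\<in>roots e. \<Union>k. hyperplane \<alpha> k))"

definition fundamental_alcove :: "(nat \<Rightarrow> real ^ 'n) \<Rightarrow> (real ^ 'n) set" where
  "fundamental_alcove e =
     {x. (\<forall>i<CARD('n). 0 < x \<bullet> simple_root e i) \<and> x \<bullet> highest_root e < 1}"

definition identity_chamber :: "(nat \<Rightarrow> real ^ 'n) \<Rightarrow> (real ^ 'n) set" where
  "identity_chamber e = {x. \<forall>i<CARD('n). 0 < x \<bullet> simple_root e i}"

definition wall :: "(nat \<Rightarrow> real ^ 'n) \<Rightarrow> nat \<Rightarrow> (real ^ 'n) set" where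
  "wall e i = (if i < CARD('n) then hyperplane (simple_root e i) 0
               else hyperplane (highest_root e) 1)"

text \<open>
  \<open>typed_facet e i A F\<close>: \<open>F\<close> is a facet of type \<open>i\<close> of the alcove \<open>A\<close>, for \<open>0 \<le> i \<le> n\<close>.
  Alcoves are open, so their facets are the library's facets of the closures.
\<close>

definition typed_facet ::
  "(nat \<Rightarrow> real ^ 'n) \<Rightarrow> nat \<Rightarrow> (real ^ 'n) set \<Rightarrow> (real ^ 'n) set \<Rightarrow> bool" where
  "typed_facet e i A F \<longleftrightarrow>
     (\<exists>w\<in>affine_weyl_group e. \<exists>F\<^sub>0.
        F\<^sub>0 facet_of closure (fundamental_alcove e) \<and> F\<^sub>0 \<subseteq> wall e i \<and>
        A = w ` fundamental_alcove e \<and> F = w ` F\<^sub>0)"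

definition separates :: "real ^ 'n \<Rightarrow> int \<Rightarrow> (real ^ 'n) set \<Rightarrow> (real ^ 'n) set \<Rightarrow> bool" where
  "separates \<alpha> k A B \<longleftrightarrow> (\<forall>x\<in>A. \<forall>y\<in>B. (x \<bullet> \<alpha> - of_int k) * (y \<bullet> \<alpha> - of_int k) < 0)"


subsection \<open>The reduced random walk\<close>

text \<open>
  \<open>allowed_step e i A B\<close>: the alcoves \<open>A\<close> and \<open>B\<close> are adjacent through a facet of type \<open>i\<close>
  whose hyperplane does not separate \<open>A\<close> from the fundamental alcove.
\<close>

definition allowed_step ::
  "(nat \<Rightarrow> real ^ 'n) \<Rightarrow> nat \<Rightarrow> (real ^ 'n) set \<Rightarrow> (real ^ 'n) set \<Rightarrow> bool" where
  "allowed_step e i A B \<longleftrightarrow>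
     A \<in> alcoves e \<and> B \<in> alcoves e \<and> A \<noteq> B \<and>
     (\<exists>F. typed_facet e i A F \<and> F facet_of closure B \<and>
          (\<exists>\<alpha>\<in>roots e. \<exists>k. F \<subseteq> hyperplane \<alpha> k \<and>
             \<not> separates \<alpha> k A (fundamental_alcove e)))"

text \<open>The sum in the numerator has at most one term, as adjacent alcoves share one facet.\<close>

definition transition_prob ::
  "(nat \<Rightarrow> real ^ 'n) \<Rightarrow> (nat \<Rightarrow> real) \<Rightarrow> (real ^ 'n) set \<Rightarrow> (real ^ 'n) set \<Rightarrow> real" where
  "transition_prob e a A B =
     (\<Sum>i | i \<le> CARD('n) \<and> allowed_step e i A B. a i) /
     (\<Sum>i | i \<le> CARD('n) \<and> (\<exists>C. allowed_step e i A C). a i)"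

text \<open>
  The process \<open>X\<close> on \<open>M\<close> is the Markov chain started at the fundamental alcove with the above
  transition probabilities. The last clause is the Markov property, multiplied out so that no
  conditioning on null events occurs.
\<close>

definition reduced_random_walk ::
  "(nat \<Rightarrow> real ^ 'n) \<Rightarrow> (nat \<Rightarrow> real) \<Rightarrow> 'w measure \<Rightarrow> (nat \<Rightarrow> 'w \<Rightarrow> (real ^ 'n) set) \<Rightarrow> bool" where
  "reduced_random_walk e a M X \<longleftrightarrow>
     prob_space M \<and>
     (\<forall>t. X t \<in> measurable M (count_space (alcoves e))) \<and>
     (AE \<omega> in M. X 0 \<omega> = fundamental_alcove e) \<and>
     (\<forall>t A B.
        measure M {\<omega>\<in>space M. (\<forall>s\<le>t. X s \<omega> = A s) \<and> X (Suc t) \<omega> = B} =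
        measure M {\<omega>\<in>space M. \<forall>s\<le>t. X s \<omega> = A s} * transition_prob e a (A t) B)"

definition eventually_confined ::
  "(nat \<Rightarrow> (real ^ 'n) set) \<Rightarrow> (real ^ 'n) set \<Rightarrow> bool" where
  "eventually_confined A C \<longleftrightarrow> (\<forall>\<^sub>F t in sequentially. A t \<subseteq> C)"

text \<open>
  The first conjunct makes the limiting direction unique: on a null event every vector
  would qualify.
\<close>

definition limiting_direction ::
  "(nat \<Rightarrow> real ^ 'n) \<Rightarrow> 'w measure \<Rightarrow> (nat \<Rightarrow> 'w \<Rightarrow> (real ^ 'n) set) \<Rightarrow> real ^ 'n \<Rightarrow> bool" where
  "limiting_direction e M X u \<longleftrightarrow>
     measure M {\<omega>\<in>space M. eventually_confined (\<lambda>t. X t \<omega>) (identity_chamber e)} > 0 \<and>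
     (AE \<omega> in M. eventually_confined (\<lambda>t. X t \<omega>) (identity_chamber e) \<longrightarrow>
        (\<forall>x. (\<forall>t. x t \<in> X t \<omega>) \<longrightarrow> (\<lambda>t. x t /\<^sub>R norm (x t)) \<longlonglongrightarrow> u))"


subsection \<open>Dual Kac labels\<close>

definition coroot :: "real ^ 'n \<Rightarrow> real ^ 'n" where
  "coroot \<alpha> = (2 / (\<alpha> \<bullet> \<alpha>)) *\<^sub>R \<alpha>"

definition dual_kac_label :: "nat \<Rightarrow> real" where
  "dual_kac_label i = 1"

text \<open>
  The dual Kac labels are the coefficients of the highest root's coroot in the simple
  coroots, together with the label \<open>1\<close> of the affine node.
\<close>

lemma coroot_highest_root:
  fixes e :: "nat \<Rightarrow> real ^ 'n"
  assumes e: "bij_betw e {1..CARD('n)} Basis"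
  shows "coroot (highest_root e) = (\<Sum>i<CARD('n). dual_kac_label i *\<^sub>R coroot (simple_root e i))"
proof -
  have B: "e i \<in> Basis" if "1 \<le> i" "i \<le> CARD('n)" for i
    using bij_betwE[OF e] that by simp
  have nn: "e i \<bullet> e i = 1" if "1 \<le> i" "i \<le> CARD('n)" for i
    using B[OF that] by (rule inner_same_Basis)
  have orth: "e i \<bullet> e j = 0" if "1 \<le> i" "i < j" "j \<le> CARD('n)" for i j
  proof (rule inner_not_same_Basis)
    show "e i \<in> Basis" "e j \<in> Basis"
      using B that by auto
    show "e i \<noteq> e j"
      using inj_onD[OF bij_betw_imp_inj_on[OF e], of i j] that by auto
  qed
  have long: "coroot (2 *\<^sub>R e i) = e i" if "1 \<le> i" "i \<le> CARD('n)" for i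
    using nn[OF that] by (simp add: coroot_def)
  have short: "coroot (e (Suc i) - e i) = e (Suc i) - e i" if "1 \<le> i" "Suc i \<le> CARD('n)" for i
  proof -
    have "(e (Suc i) - e i) \<bullet> (e (Suc i) - e i) = 2"
      using nn[of i] nn[of "Suc i"] orth[of i "Suc i"] that
      by (simp add: inner_diff_left inner_diff_right inner_commute[of "e (Suc i)" "e i"])
    then show ?thesis by (simp add: coroot_def)
  qed
  have sum: "(\<Sum>i<Suc m. dual_kac_label i *\<^sub>R coroot (simple_root e i)) = e (Suc m)"
    if "Suc m \<le> CARD('n)" for m
    using that
  proof (induction m)
    case 0
    then show ?case using long[of 1] by (simp add: dual_kac_label_def simple_root_def)
  next
    case (Suc m)
    have "coroot (simple_root e (Suc m)) = e (Suc (Suc m)) - e (Suc m)"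
      using short[of "Suc m"] Suc.prems by (simp add: simple_root_def)
    then show ?case
      using Suc by (simp only: sum.lessThan_Suc[of _ "Suc m"] dual_kac_label_def) simp
  qed
  obtain m where m: "CARD('n) = Suc m"
    using zero_less_card_finite[where 'a = 'n] gr0_implies_Suc by blast
  show ?thesis
    using sum[of m] long[of "CARD('n)"] by (simp only: m highest_root_def)
qed

end

theory Submission
  imports Defs
begin

text \<open>
  An alcove is determined by an element of the affine Weyl group, that is by a signed permutation
  word \<open>u\<close> (the linear part) and an integer vector \<open>c\<close> (the translation part). In these terms
  crossing the wall of type \<open>i\<close> swaps two neighbouring letters of \<open>u\<close> for \<open>0 < i < n\<close>, negates the
  first letter for \<open>i = 0\<close>, and negates the last letter for \<open>i = n\<close>; only in the last case does the
  translation part change, namely by \<open>axis (last u)\<close>. Inside the identity chamber the crossing of a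
  wall that is off the walls of the chamber is admissible exactly when the outward normal is a
  positive root, and this means that the larger letter moves to the right: \<open>u\<close> with its two mirror
  letters has a descent at \<open>i\<close> (\<open>place_step\<close>, \<open>move_allowed\<close>, \<open>allowed_in_chamber_move\<close>). So
  the walk in the chamber is the jump chain of a multispecies exclusion process on a segment, all
  rates being \<open>1\<close> because all weights are equal, and the displacement of the alcove is the current
  through the right end.

  To find the current of the labels of modulus at least \<open>k\<close>, forget everything else about the labels
  (\<open>charge\<close>). The result is the exclusion process with letters \<open>1, 0, - 1\<close>, \<open>k - 1\<close> of them zeros.
  Its stationary measure has a matrix product form, given here by weighted lattice paths
  (\<open>weight\<close>, \<open>weight_stationary\<close>); the normalising constants are ballot numbers, and the
  current is a quotient of two of them (\<open>current\<close>). It is proportional to \<open>(n + 1)\<^sup>2 - k\<^sup>2\<close>, so the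
  label \<open>k\<close> alone has a current proportional to \<open>(k + 1)\<^sup>2 - k\<^sup>2 = 2 k + 1\<close>.

  The passage from stationary currents to the walk is elementary. Along any history the occupation
  frequencies are asymptotically stationary as soon as finitely many martingales are negligible, and
  asymptotically stationary vectors converge to the stationary measure by a Dirichlet form argument
  (\<open>tendsto_stationary\<close>, \<open>exit_rate_tendsto\<close>). Fourth moments bound the probability that the
  martingales are not negligible (\<open>mart_tail\<close>).

  These bounds are for the law in which the next move is uniform among the descents. The reduced walk
  differs from it near the walls of the chamber, where it may also leave the chamber for good.
  Histories inside the chamber are therefore at most as likely for the walk (\<open>measure_follows_le\<close>),
  which gives the limiting direction almost surely on the event of confinement (\<open>AE_direction\<close>). On
  the other hand typical histories stay away from the walls after a bounded time, and up to that
  time the walk loses only a bounded factor (\<open>measure_follows_ge\<close>); so confinement to the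
  identity chamber has positive probability (\<open>confined_positive\<close>).
\<close>

section \<open>Words and moves\<close>

text \<open>
  A word is a configuration on a segment of sites, and the two ends act as mirrors: a label is
  negated when it is reflected there. Reading the mirror images of the two end letters as extra
  letters turns the two boundary moves into ordinary descents, so that every statement about
  moves can be made uniformly.
\<close>

definition padded :: "int list \<Rightarrow> nat \<Rightarrow> int" where
  "padded u i = (if i = 0 then - u ! 0 else if i \<le> length u then u ! (i - 1) else - u ! (length u - 1))"

definition moves :: "int list \<Rightarrow> nat set" where
  "moves u = {i. i \<le> length u \<and> padded u (Suc i) < padded u i}"

definition step :: "nat \<Rightarrow> int list \<Rightarrow> int list" where
  "step i u = (if i = 0 then u[0 := - u ! 0]
     else if i < length u then u[i - 1 := u ! i, i := u ! (i - 1)]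
     else u[length u - 1 := - u ! (length u - 1)])"

lemma length_step [simp]: "length (step i u) = length u"
  by (simp add: step_def)

lemma finite_moves [simp]: "finite (moves u)"
  unfolding moves_def by simp

text \<open>
  A move exchanges the two neighbouring padded letters. This is the form in which moves are
  compared with reflections in the walls of an alcove.
\<close>

lemma step_nth:
  assumes "u \<noteq> []" "i \<le> length u" "j < length u"
  shows "step i u ! j = (if Suc j = i then padded u (Suc i) else if j = i then padded u i else u ! j)"
  using assms by (auto simp: step_def padded_def nth_list_update Suc_le_eq)

lemma padded_step:
  assumes "u \<noteq> []" "i \<le> length u"
  shows "padded (step i u) i = padded u (Suc i)" "padded (step i u) (Suc i) = padded u i"
  using assms by (auto simp: step_def padded_def nth_list_update Suc_le_eq)

lemma step_step [simp]:
  assumes "u \<noteq> []" "i \<le> length u"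
  shows "step i (step i u) = u"
proof (rule nth_equalityI)
  fix j assume "j < length (step i (step i u))"
  moreover have "step i u \<noteq> []" using assms by (metis length_0_conv length_step)
  ultimately show "step i (step i u) ! j = u ! j"
    using assms padded_step[OF assms]
    by (auto simp: step_nth) (auto simp: padded_def split: if_splits)
qed simp

lemma mem_moves_step:
  assumes "u \<noteq> []" "i \<le> length u"
  shows "i \<in> moves (step i u) \<longleftrightarrow> padded u i < padded u (Suc i)"
  using assms by (simp add: moves_def padded_step)

lemma step_eq_self:
  assumes "u \<noteq> []" "i \<le> length u" "padded u i = padded u (Suc i)"
  shows "step i u = u"
  using assms by (intro nth_equalityI) (auto simp: step_nth, auto simp: padded_def split: if_splits)

lemma padded_map:
  assumes "u \<noteq> []" "\<And>v. f (- v) = - f v"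
  shows "padded (map f u) i = f (padded u i)"
  using assms by (auto simp: padded_def)

lemma step_map:
  assumes "u \<noteq> []" "\<And>v. f (- v) = - f v"
  shows "step i (map f u) = map f (step i u)"
  using assms by (auto simp: step_def map_update)

text \<open>
  A word without descents is weakly increasing from its left mirror letter \<open>- u ! 0\<close> to its right
  one; the two boundary inequalities then contradict each other unless a letter is \<open>0\<close>.
\<close>

lemma moves_nonempty:
  assumes "u \<noteq> []" and "0 \<notin> set u"
  shows "moves u \<noteq> {}"
proof
  assume e: "moves u = {}"
  have le: "padded u i \<le> padded u (Suc i)" if "i \<le> length u" for i
    using e that unfolding moves_def by force
  have mono: "padded u 0 \<le> padded u i" if "i \<le> Suc (length u)" for i
    using that by (induction i) (auto intro: order_trans le)
  have mono': "padded u 1 \<le> padded u i" if "1 \<le> i" "i \<le> Suc (length u)" for i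
    using that
  proof (induction i rule: dec_induct)
    case (step m)
    then show ?case using le[of m] by simp
  qed simp
  have "u ! 0 \<noteq> 0" using assms by (metis length_greater_0_conv nth_mem)
  have l: "1 \<le> length u" using assms(1) by (cases u) auto
  have "padded u 1 \<le> padded u (Suc (length u))" using mono'[of "Suc (length u)"] by simp
  moreover have "padded u 1 \<le> padded u (length u)" using mono'[of "length u"] l by simp
  moreover have "padded u 0 \<le> padded u 1" using le[of 0] by simp
  ultimately have "u ! 0 \<le> - u ! (length u - 1)" "u ! 0 \<le> u ! (length u - 1)" "- u ! 0 \<le> u ! 0"
    using l assms(1) by (auto simp: padded_def)
  with \<open>u ! 0 \<noteq> 0\<close> show False by linarith
qed

section \<open>Stationary weights and the current\<close>

text \<open>
  The matrix product weight of a word with letters \<open>1, 0, - 1\<close>, written as a count of lattice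
  paths. The path starts at height \<open>h\<close> and must end at height \<open>0\<close>; a letter \<open>1\<close> keeps or raises
  the height, \<open>- 1\<close> keeps or lowers it, and \<open>0\<close> requires height \<open>0\<close>. In matrix terms
  \<open>D = 1 + S\<close>, \<open>E = 1 + S\<^sup>T\<close> for the one-sided shift \<open>S\<close>, and \<open>A\<close> is the projection to height
  \<open>0\<close>; the four relations below are \<open>D E = D + E\<close>, \<open>D A = A\<close>, \<open>A E = A\<close> and \<open>D v = v\<close>
  at the boundary vector \<open>v\<close> of height \<open>0\<close>.
\<close>

fun weight :: "nat \<Rightarrow> int list \<Rightarrow> real" where
  "weight h [] = (if h = 0 then 1 else 0)"
| "weight h (v # u) =
     (if 0 < v then weight h u + weight (Suc h) u
      else if v < 0 then weight h u + (if h = 0 then 0 else weight (h - 1) u)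
      else if h = 0 then weight 0 u else 0)"

lemma weight_nonneg [simp]: "0 \<le> weight h u"
  by (induction h u rule: weight.induct) auto

lemma weight_pos: "0 < weight 0 u"
  by (induction u) (auto intro: add_pos_nonneg)

lemma weight_plus_minus: "weight h (p @ 1 # - 1 # s) = weight h (p @ 1 # s) + weight h (p @ - 1 # s)"
  by (induction p arbitrary: h) auto

lemma weight_plus_zero: "weight h (p @ 1 # 0 # s) = weight h (p @ 0 # s)"
  by (induction p arbitrary: h) auto

lemma weight_zero_minus: "weight h (p @ 0 # - 1 # s) = weight h (p @ 0 # s)"
  by (induction p arbitrary: h) auto

lemma weight_snoc_plus: "weight h (p @ [1]) = weight h p"
  by (induction p arbitrary: h) auto

text \<open>
  The number \<open>r\<close> of zeros is conserved by all moves: only the letters \<open>1\<close> and \<open>- 1\<close> are turned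
  into each other, at the ends.
\<close>

definition words :: "nat \<Rightarrow> nat \<Rightarrow> int list set" where
  "words n r = {u. length u = n \<and> set u \<subseteq> {- 1, 0, 1} \<and> count_list u 0 = r}"

text \<open>
  The summands of a telescoping sum: deleting one letter from a word, weighted by that letter.
\<close>

definition deleted :: "int list \<Rightarrow> nat \<Rightarrow> real" where
  "deleted u i = real_of_int (u ! i) * weight 0 (take i u @ drop (Suc i) u)"

text \<open>
  Gain minus loss through one bond. The quadratic relations reduce the weight of a word of length
  \<open>n\<close> to weights of words of length \<open>n - 1\<close>, and the result is a difference of two deletions.
\<close>

lemma bond_balance:
  assumes "set u \<subseteq> {- 1, 0, 1}" "Suc i < length u"
  shows "(if Suc i \<in> moves (step (Suc i) u) then weight 0 (step (Suc i) u) else 0)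
           - (if Suc i \<in> moves u then weight 0 u else 0) = deleted u (Suc i) - deleted u i"
proof -
  define p s a b where "p = take i u" and "s = drop (Suc (Suc i)) u" and "a = u ! i" and "b = u ! Suc i"
  have u: "u = p @ a # b # s"
    unfolding p_def s_def a_def b_def using assms(2)
    by (metis Cons_nth_drop_Suc Suc_lessD append_take_drop_id)
  have len: "length p = i" using assms(2) by (simp add: p_def)
  have st: "step (Suc i) u = p @ b # a # s"
    using len by (simp add: u step_def list_update_append nth_append)
  have ne: "u \<noteq> []" by (simp add: u)
  have "padded u (Suc i) = a" "padded u (Suc (Suc i)) = b" using assms(2) by (auto simp: padded_def a_def b_def)
  moreover have "Suc i \<le> length u" using assms by simp
  ultimately have m: "Suc i \<in> moves (step (Suc i) u) \<longleftrightarrow> a < b" "Suc i \<in> moves u \<longleftrightarrow> b < a"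
    using mem_moves_step[OF ne, of "Suc i"] by (simp_all add: moves_def)
  have d: "deleted u i = real_of_int a * weight 0 (p @ b # s)"
          "deleted u (Suc i) = real_of_int b * weight 0 (p @ a # s)"
    using len by (simp_all add: deleted_def u nth_append)
  have "a \<in> {-1,0,1}" "b \<in> {-1,0,1}" using assms(1) u by auto
  then show ?thesis
    unfolding m unfolding st d by (auto simp: u weight_plus_minus weight_plus_zero weight_zero_minus)
qed

lemma left_balance:
  assumes "set u \<subseteq> {- 1, 0, 1}" "u \<noteq> []"
  shows "(if 0 \<in> moves (step 0 u) then weight 0 (step 0 u) else 0)
           - (if 0 \<in> moves u then weight 0 u else 0) = deleted u 0"
proof -
  obtain a s where u: "u = a # s" using assms(2) by (cases u) auto
  have "a \<in> {-1,0,1}" using assms(1) u by auto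
  then show ?thesis
    using mem_moves_step[OF assms(2), of 0]
    by (auto simp: u moves_def padded_def step_def deleted_def)
qed

lemma right_balance:
  assumes "set u \<subseteq> {- 1, 0, 1}" "u \<noteq> []"
  shows "(if length u \<in> moves (step (length u) u) then weight 0 (step (length u) u) else 0)
           - (if length u \<in> moves u then weight 0 u else 0) = - deleted u (length u - 1)"
proof -
  obtain a p where u: "u = p @ [a]" using assms(2) by (metis rev_exhaust)
  have "a \<in> {-1,0,1}" using assms(1) u by auto
  moreover have "step (length u) u = p @ [- a]" by (simp add: u step_def)
  moreover have "length u \<in> moves (step (length u) u) \<longleftrightarrow> a < 0" "length u \<in> moves u \<longleftrightarrow> 0 < a"
    using mem_moves_step[OF assms(2), of "length u"] by (auto simp: u moves_def padded_def)
  ultimately show ?thesis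
    by (auto simp: u deleted_def weight_snoc_plus)
qed

text \<open>
  The differences over all bonds telescope, and the two boundary terms cancel what is left. This
  is stationarity of the weights, word by word.
\<close>

lemma total_balance:
  assumes "set u \<subseteq> {- 1, 0, 1}" "u \<noteq> []"
  shows "(\<Sum>i\<le>length u. (if i \<in> moves (step i u) then weight 0 (step i u) else 0)
           - (if i \<in> moves u then weight 0 u else 0)) = 0"
proof -
  obtain m where m: "length u = Suc m" using assms(2) by (cases u) auto
  let ?b = "\<lambda>i. (if i \<in> moves (step i u) then weight 0 (step i u) else 0)
           - (if i \<in> moves u then weight 0 u else 0)"
  have tel: "(\<Sum>i\<le>k. ?b i) = deleted u k" if "k \<le> m" for k
    using that
  proof (induction k)
    case 0
    show ?case using left_balance[OF assms] by (simp only: atMost_0 sum.insert finite.emptyI sum.empty empty_iff not_False_eq_True add_0_right)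
  next
    case (Suc k)
    then show ?case using bond_balance[OF assms(1), of k] m by simp
  qed
  show ?thesis using tel[of m] right_balance[OF assms] unfolding m sum.atMost_Suc by simp
qed

lemma count_list_step:
  assumes "u \<noteq> []" "i \<le> length u"
  shows "count_list (step i u) 0 = count_list u 0"
proof -
  consider "i = 0" | "0 < i" "i < length u" | "i = length u" "0 < i" using assms(2) by linarith
  then show ?thesis
  proof cases
    case 1
    then show ?thesis using assms(1) by (cases u) (auto simp: step_def)
  next
    case 2
    then have "mset (step i u) = mset u"
      using mset_swap[of i u "i - 1"] by (simp add: step_def)
    then show ?thesis by (metis count_mset)
  next
    case 3
    obtain a p where "u = p @ [a]" using assms(1) by (metis rev_exhaust)
    then show ?thesis using 3 by (simp add: step_def)
  qed
qed

lemma step_in_words: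
  assumes "u \<in> words n r" "i \<le> n" "0 < n"
  shows "step i u \<in> words n r"
proof -
  have u: "u \<noteq> []" "length u = n" "set u \<subseteq> {-1,0,1}" "count_list u 0 = r"
    using assms by (auto simp: words_def)
  have "step i u ! j \<in> {-1,0,1}" if "j < n" for j
  proof -
    have "u ! k \<in> {-1,0,1}" if "k < n" for k using u(2,3) that nth_mem by blast
    moreover have "padded u k \<in> {-1,0,1}" if "k \<le> Suc n" for k
    proof -
      have "u ! 0 \<in> {-1,0,1}" "u ! (n - 1) \<in> {-1,0,1}" "k \<noteq> 0 \<Longrightarrow> k \<le> n \<Longrightarrow> u ! (k-1) \<in> {-1,0,1}"
        using calculation assms(3) by auto
      then show ?thesis using u(2) by (auto simp: padded_def)
    qed
    ultimately show ?thesis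
      using step_nth[OF u(1), of i j] assms(2) that u(2) by simp
  qed
  then have "set (step i u) \<subseteq> {-1,0,1}"
    using u(2) by (auto simp: set_conv_nth) 
  then show ?thesis
    using count_list_step[OF u(1), of i] u assms(2) by (simp add: words_def)
qed

lemma finite_words [simp]: "finite (words n r)"
  by (rule finite_subset[OF _ finite_lists_length_eq[of "{-1,0,1::int}" n]]) (auto simp: words_def)

text \<open>
  The generator of the exclusion process in which every move available happens at rate \<open>1\<close>.
\<close>

definition generator :: "(int list \<Rightarrow> real) \<Rightarrow> int list \<Rightarrow> real" where
  "generator \<phi> u = (\<Sum>i\<in>moves u. \<phi> (step i u) - \<phi> u)"

lemma weight_stationary:
  assumes "0 < n"
  shows "(\<Sum>u\<in>words n r. weight 0 u * generator \<phi> u) = 0"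
proof -
  let ?in = "\<lambda>i u. if i \<in> moves (step i u) then weight 0 (step i u) else 0"
  let ?outward = "\<lambda>i u. if i \<in> moves u then weight 0 u else 0"
  have ne: "u \<noteq> []" "length u = n" "set u \<subseteq> {- 1, 0, 1}" if "u \<in> words n r" for u
    using that assms by (auto simp: words_def)
  have generator: "weight 0 u * generator \<phi> u = (\<Sum>i\<le>n. ?outward i u * \<phi> (step i u) - ?outward i u * \<phi> u)"
    if "u \<in> words n r" for u
  proof -
    have "generator \<phi> u = (\<Sum>i\<in>{..n} \<inter> moves u. \<phi> (step i u) - \<phi> u)"
      unfolding generator_def using ne(2)[OF that] by (intro sum.cong) (auto simp: moves_def)
    also have "\<dots> = (\<Sum>i\<le>n. if i \<in> moves u then \<phi> (step i u) - \<phi> u else 0)"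
      by (simp add: sum.inter_restrict)
    finally show ?thesis
      by (auto simp: sum_distrib_left algebra_simps intro!: sum.cong)
  qed
  have swap: "(\<Sum>u\<in>words n r. ?outward i u * \<phi> (step i u)) = (\<Sum>u\<in>words n r. ?in i u * \<phi> u)"
    if "i \<le> n" for i
    by (rule sum.reindex_bij_witness[of _ "step i" "step i"])
      (use that assms ne in \<open>simp_all add: step_in_words\<close>)
  have "(\<Sum>u\<in>words n r. weight 0 u * generator \<phi> u)
      = (\<Sum>u\<in>words n r. \<Sum>i\<le>n. ?outward i u * \<phi> (step i u) - ?outward i u * \<phi> u)"
    by (intro sum.cong HOL.refl generator)
  also have "\<dots> = (\<Sum>i\<le>n. (\<Sum>u\<in>words n r. ?outward i u * \<phi> (step i u)) - (\<Sum>u\<in>words n r. ?outward i u * \<phi> u))"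
    by (subst sum.swap) (simp add: sum_subtractf)
  also have "\<dots> = (\<Sum>i\<le>n. \<Sum>u\<in>words n r. (?in i u - ?outward i u) * \<phi> u)"
    by (intro sum.cong HOL.refl, subst swap) (auto simp: sum_subtractf algebra_simps)
  also have "\<dots> = (\<Sum>u\<in>words n r. (\<Sum>i\<le>n. ?in i u - ?outward i u) * \<phi> u)"
    by (subst sum.swap) (simp add: sum_distrib_right)
  also have "\<dots> = 0"
  proof (intro sum.neutral ballI)
    fix u assume "u \<in> words n r"
    from total_balance[OF ne(3,1)[OF this]] ne(2)[OF this]
    show "(\<Sum>i\<le>n. ?in i u - ?outward i u) * \<phi> u = 0" by simp
  qed
  finally show ?thesis .
qed

text \<open>
  The total weight of \<open>words n k\<close>; a ballot number, and the Catalan number of index \<open>n + 1\<close> for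
  \<open>k = 0\<close>.
\<close>

definition ballot :: "nat \<Rightarrow> nat \<Rightarrow> real" where
  "ballot n k = (if k \<le> n then (2 * real k + 2) * fact (2 * n + 1) / (fact (n - k) * fact (n + k + 2)) else 0)"

lemma ballot_rec:
  "ballot (Suc n) k = 2 * ballot n k + ballot n (Suc k) + (if k = 0 then 0 else ballot n (k - 1))"
proof -
  consider "k > Suc n" | "k = Suc n" | "k = n" | j where "n = Suc (k + j)"
    by (metis add_Suc_right less_imp_Suc_add linorder_neqE_nat not_less_eq)
  then show ?thesis
  proof cases
    case 1 then show ?thesis by (auto simp: ballot_def)
  next
    case 2 then show ?thesis by (simp add: ballot_def divide_simps)
  next
    case 3
    show ?thesis
    proof (cases n)
      case 0
      with 3 show ?thesis by (simp add: ballot_def fact_numeral)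
    next
      case (Suc m)
      with 3 show ?thesis by (simp add: ballot_def divide_simps) (simp add: algebra_simps)
    qed
  next
    case (4 j)
    define F G H A B P Q :: real
      where "F = fact (2 * n + 1)" and "G = fact (n + k + 1)" and "H = fact j"
        and "A = real j + 2" and "B = real j + 1" and "P = real (n + k + 3)" and "Q = real (n + k + 2)"
    have "n + k + 3 = Suc (n + k + 2)" "n + k + 2 = Suc (n + k + 1)"
      "2 * n + 3 = Suc (2 * n + 2)" "2 * n + 2 = Suc (2 * n + 1)" by simp_all
    then have G2: "fact (n + k + 2) = Q * G" and G3: "fact (n + k + 3) = P * (Q * G)"
      and F3: "fact (2 * n + 3) = real (2 * n + 3) * (real (2 * n + 2) * F)"
      unfolding G_def F_def P_def Q_def by (metis fact_Suc)+
    have j2: "fact (j + 2) = A * (B * H)" and j1: "fact (j + 1) = B * H"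
      by (simp_all add: A_def B_def H_def algebra_simps)
    have pos: "A \<noteq> 0" "B \<noteq> 0" "P \<noteq> 0" "Q \<noteq> 0" "G \<noteq> 0" "H \<noteq> 0"
      by (simp_all add: A_def B_def P_def Q_def G_def H_def)
    define c where "c = F / (H * G * A * B * P * Q)"
    have F: "F = c * (H * G * A * B * P * Q)" using pos by (simp add: c_def)
    have s: "Suc n - k = j + 2" "n - k = j + 1" "n - Suc k = j" "2 * Suc n + 1 = 2 * n + 3"
      "Suc n + k + 2 = n + k + 3" "n + Suc k + 2 = n + k + 3" "k \<le> Suc n" "k \<le> n" "Suc k \<le> n"
      using 4 by auto
    have 0: "ballot (Suc n) k = c * ((2 * real k + 2) * (real (2 * n + 3) * real (2 * n + 2)))"
      unfolding ballot_def if_P[OF s(7)] s(1-6) F3 j2 G3 by (subst nonzero_divide_eq_eq) (use pos in \<open>simp_all add: F del: of_nat_add of_nat_mult\<close>)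
    have 1: "ballot n k = c * ((2 * real k + 2) * A * P)"
      unfolding ballot_def if_P[OF s(8)] s(1-6) j1 G2 F_def[symmetric] by (subst nonzero_divide_eq_eq) (use pos in \<open>simp_all add: F\<close>)
    have 2: "ballot n (Suc k) = c * ((2 * real k + 4) * (A * B))"
      unfolding ballot_def if_P[OF s(9)] s(1-6) G3 F_def[symmetric] H_def[symmetric] by (subst nonzero_divide_eq_eq) (use pos in \<open>simp_all add: F\<close>)
    have 3: "(if k = 0 then 0 else ballot n (k - 1)) = c * (2 * real k * (P * Q))"
    proof (cases k)
      case (Suc l)
      have s': "n - l = j + 2" "n + l + 2 = n + k + 1" "l \<le> n" using Suc 4 by auto
      have "ballot n l = c * (2 * real k * (P * Q))"
        unfolding ballot_def if_P[OF s'(3)] s'(1,2) j2 F_def[symmetric] G_def[symmetric]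
        by (subst nonzero_divide_eq_eq) (use pos Suc in \<open>simp_all add: F algebra_simps\<close>)
      then show ?thesis by (simp add: Suc)
    qed simp
    have n: "real n = real k + real j + 1" using 4 by simp
    show ?thesis
      unfolding 0 1 2 3 by (simp add: n A_def B_def P_def Q_def) (simp add: algebra_simps)
  qed
qed

lemma words_Suc:
  "words (Suc n) r = (#) 1 ` words n r \<union> (#) (- 1) ` words n r \<union> (if r = 0 then {} else (#) 0 ` words n (r - 1))"
proof (rule set_eqI)
  fix u show "u \<in> words (Suc n) r \<longleftrightarrow> u \<in> (#) 1 ` words n r \<union> (#) (- 1) ` words n r \<union> (if r = 0 then {} else (#) 0 ` words n (r - 1))"
    by (cases u) (auto simp: words_def)
qed

lemma sum_words_Suc:
  "(\<Sum>u\<in>words (Suc n) r. f u) = (\<Sum>u\<in>words n r. f (1 # u)) + (\<Sum>u\<in>words n r. f (- 1 # u))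
     + (if r = 0 then 0 else (\<Sum>u\<in>words n (r - 1). f (0 # u)))"
  for f :: "int list \<Rightarrow> real"
proof -
  have "(\<Sum>u\<in>words (Suc n) r. f u) = (\<Sum>u\<in>(#) 1 ` words n r. f u) + (\<Sum>u\<in>(#) (- 1) ` words n r. f u)
     + (\<Sum>u\<in>(if r = 0 then {} else (#) 0 ` words n (r - 1)). f u)"
    unfolding words_Suc by (subst sum.union_disjoint; (subst sum.union_disjoint)?) auto
  then show ?thesis by (auto simp: sum.reindex)
qed

text \<open>
  A starting height \<open>h\<close> has the same effect on the total as \<open>h\<close> further zeros: both recursions
  on the first letter are the recursion of the ballot numbers in \<open>h + r\<close>.
\<close>

lemma weight_sum: "(\<Sum>u\<in>words n r. weight h u) = ballot n (h + r)"
proof (induction n arbitrary: h r)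
  case 0
  have "words 0 r = (if r = 0 then {[]} else {})" by (auto simp: words_def)
  then show ?case by (auto simp: ballot_def)
next
  case (Suc n)
  show ?case
    unfolding sum_words_Suc ballot_rec
    by (cases h; cases r) (auto simp: Suc sum.distrib)
qed

lemma ballot_ratio:
  assumes "0 < n" "r \<le> n"
  shows "ballot (n - 1) r * (2 * real n * (2 * real n + 1)) = (real n - real r) * (real n + real r + 2) * ballot n r"
proof -
  obtain m where m: "n = Suc m" using assms by (cases n) auto
  show ?thesis
  proof (cases "r = n")
    case True then show ?thesis using m by (simp add: ballot_def)
  next
    case False
    then obtain j where j: "m = r + j" using assms m by (metis le_Suc_eq nat_le_iff_add)
    show ?thesis by (simp add: m j ballot_def divide_simps, (simp add: algebra_simps)?)
  qed
qed

lemma ballot_pos: "r \<le> n \<Longrightarrow> 0 < ballot n r"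
  by (simp add: ballot_def)

text \<open>
  A final letter \<open>1\<close> can be deleted without changing the weight, so the stationary probability of
  a final \<open>1\<close> is a quotient of two consecutive normalising constants.
\<close>

lemma current:
  assumes "0 < n" "r \<le> n"
  shows "(\<Sum>u\<in>words n r. weight 0 u * of_bool (0 < last u)) / ballot n r
       = (real n - real r) * (real n + real r + 2) / (2 * real n * (2 * real n + 1))"
proof -
  have "(\<Sum>u\<in>words n r. weight 0 u * of_bool (0 < last u)) = (\<Sum>u\<in>{u\<in>words n r. last u = 1}. weight 0 u)"
  proof -
    have "last u \<in> {-1,0,1}" if "u \<in> words n r" for u
      using that assms last_in_set[of u] by (auto simp: words_def simp del: last_in_set)
    then have "0 < last u \<longleftrightarrow> last u = 1" if "u \<in> words n r" for u using that by force
    then show ?thesis by (auto simp: sum.inter_filter of_bool_def intro!: sum.cong)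
  qed
  also have "{u\<in>words n r. last u = 1} = (\<lambda>p. p @ [1]) ` words (n - 1) r"
  proof (intro equalityI subsetI)
    fix u assume "u \<in> {u\<in>words n r. last u = 1}"
    then show "u \<in> (\<lambda>p. p @ [1]) ` words (n - 1) r"
      using assms(1) by (cases u rule: rev_cases) (auto simp: words_def)
  qed (use assms(1) in \<open>auto simp: words_def\<close>)
  also have "sum (weight 0) ((\<lambda>p. p @ [1]) ` words (n - 1) r) = (\<Sum>p\<in>words (n - 1) r. weight 0 p)"
    by (simp add: sum.reindex inj_on_def weight_snoc_plus)
  also have "\<dots> = ballot (n - 1) r" by (simp add: weight_sum)
  finally have "(\<Sum>u\<in>words n r. weight 0 u * of_bool (0 < last u)) = ballot (n - 1) r" .
  moreover have "2 * real n * (2 * real n + 1) \<noteq> 0" using assms(1) by (simp add: add_nonneg_eq_0_iff)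
  moreover have "ballot n r \<noteq> 0" using ballot_pos[OF assms(2)] by simp
  ultimately show ?thesis
    using ballot_ratio[OF assms] by (subst frac_eq_eq) auto
qed

lemma sorted_01_eq:
  fixes u :: "int list"
  assumes "sorted u" "set u \<subseteq> {0, 1}"
  shows "u = replicate (count_list u 0) 0 @ replicate (length u - count_list u 0) 1"
  using assms
proof (induction u)
  case (Cons a u)
  show ?case
  proof (cases "a = 0")
    case True
    then show ?thesis using Cons by simp
  next
    case False
    then have "\<forall>x\<in>set u. x = 1" "a = 1" using Cons.prems by force+
    moreover from this have "0 \<notin> set u" by auto
    ultimately show ?thesis
      by (simp add: count_list_0_iff) (metis replicate_length_same)
  qed
qed simp

text \<open>
  Every word reaches \<open>0 \<dots> 0 1 \<dots> 1\<close>: sort by descents, and turn a negative first letter into a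
  positive one. The first moment of the letters increases at each of these moves, so the procedure
  ends. The relation \<open>R\<close> is arbitrary because the use is with the relation "the density has the
  same limit", which is an equivalence but has no direction.
\<close>

lemma words_connected:
  assumes n: "0 < n"
    and R: "\<And>u i. u \<in> words n r \<Longrightarrow> i \<in> moves u \<Longrightarrow> R u (step i u)"
    and "equivp R"
    and uv: "u \<in> words n r" "v \<in> words n r"
  shows "R u v"
proof -
  define top where "top = replicate r (0::int) @ replicate (n - r) 1"
  \<comment> \<open>The weights \<open>Suc j\<close> are positive so that negating the first letter increases \<open>\<Phi>\<close> as well.\<close>
  define \<Phi> where "\<Phi> u = (\<Sum>j<n. int (Suc j) * u ! j)" for u :: "int list"
  have top: "R u top" if "u \<in> words n r" for u
    using that
  proof (induction "nat (int n * int n - \<Phi> u)" arbitrary: u rule: less_induct)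
    case less
    have u: "u \<noteq> []" "length u = n" "set u \<subseteq> {- 1, 0, 1}" "count_list u 0 = r"
      using less.prems n by (auto simp: words_def)
    show ?case
    proof (cases "\<exists>i<n. i \<in> moves u")
      case False
      have "0 \<notin> moves u" using False n by auto
      then have "0 \<le> u ! 0"
        using n u by (simp add: moves_def padded_def Suc_le_eq)
      moreover have "sorted u"
        unfolding sorted_iff_nth_Suc
      proof (intro allI impI)
        fix i assume "Suc i < length u"
        moreover from this have "Suc i \<notin> moves u" using False u(2) by auto
        ultimately show "u ! i \<le> u ! Suc i"
          by (simp add: moves_def padded_def)
      qed
      moreover from this have "u ! 0 \<le> x" if "x \<in> set u" for x using that by (cases u) auto
      ultimately have "0 \<le> x" if "x \<in> set u" for x using that by (meson order_trans)
      then have "set u \<subseteq> {0, 1}" using u(3) by (force simp: subset_iff)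
      with \<open>sorted u\<close> have "u = top"
        using sorted_01_eq[of u] u by (simp add: top_def)
      then show ?thesis using \<open>equivp R\<close> by (simp add: equivp_reflp)
    next
      case True
      then obtain i where i: "i < n" "i \<in> moves u" by auto
      have st: "step i u \<in> words n r" using less.prems i n by (intro step_in_words) auto
      define A where "A = (if i = 0 then 0 else int i * (u ! i - u ! (i - 1)))"
      define B where "B = int (Suc i) * (padded u i - u ! i)"
      have "\<Phi> (step i u) - \<Phi> u = (\<Sum>j<n. int (Suc j) * (step i u ! j - u ! j))"
        unfolding \<Phi>_def sum_subtractf[symmetric] right_diff_distrib ..
      also have "\<dots> = (\<Sum>j<n. (if j = i - 1 then A else 0) + (if j = i then B else 0))"
      proof (intro sum.cong HOL.refl)
        fix j assume j: "j \<in> {..<n}"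
        consider "Suc j = i" | "j = i" | "Suc j \<noteq> i" "j \<noteq> i" by blast
        then show "int (Suc j) * (step i u ! j - u ! j) = (if j = i - 1 then A else 0) + (if j = i then B else 0)"
        proof cases
          case 1
          then have "padded u (Suc i) = u ! i" using i u by (simp add: padded_def)
          with 1 show ?thesis using step_nth[OF u(1), of i j] i j u(2) by (auto simp: A_def)
        next
          case 2
          then show ?thesis using step_nth[OF u(1), of i j] i j u(2) by (auto simp: A_def B_def)
        next
          case 3
          then show ?thesis using step_nth[OF u(1), of i j] i j u(2) by (auto simp: A_def)
        qed
      qed
      also have "\<dots> = A + B"
        using i n by (simp add: sum.distrib)
      also have "\<dots> > 0"
      proof (cases "i = 0")
        case True
        then show ?thesis using i u by (simp add: A_def B_def moves_def padded_def Suc_le_eq)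
      next
        case False
        then have "padded u i = u ! (i - 1)" "u ! i < u ! (i - 1)"
          using i u by (auto simp: moves_def padded_def)
        moreover from this have "A + B = u ! (i - 1) - u ! i"
          using False by (simp add: A_def B_def algebra_simps)
        ultimately show ?thesis by simp
      qed
      finally have inc: "\<Phi> u < \<Phi> (step i u)" by simp
      have "\<Phi> w \<le> int n * int n" if "w \<in> words n r" for w
      proof -
        have "int (Suc j) * w ! j \<le> int n" if "j < n" for j
        proof -
          have "w ! j \<in> {-1,0,1}" using that \<open>w \<in> words n r\<close> nth_mem[of j w] by (auto simp: words_def simp del: nth_mem)
          then show ?thesis using that by auto
        qed
        then have "\<Phi> w \<le> (\<Sum>j<n. int n)" unfolding \<Phi>_def by (intro sum_mono) auto
        then show ?thesis by simp
      qed
      from this[OF st] inc have "R (step i u) top"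
        by (intro less.hyps st) auto
      then show ?thesis
        using R[OF less.prems i(2)] \<open>equivp R\<close> by (meson equivp_transp)
    qed
  qed
  show ?thesis using top[OF uv(1)] top[OF uv(2)] \<open>equivp R\<close> by (meson equivp_symp equivp_transp)
qed

section \<open>Convergence to the stationary weights\<close>

text \<open>
  With \<open>\<mu> = weight \<cdot> h\<close>, the defect of \<open>\<mu>\<close> from stationarity, tested against \<open>h\<close> itself, is the
  Dirichlet form of \<open>h\<close>. The process is not reversible; what makes the identity hold is stationarity
  applied to \<open>h\<^sup>2\<close>.
\<close>

lemma dirichlet_identity:
  assumes "0 < n"
  shows "(\<Sum>u\<in>words n r. weight 0 u * (\<Sum>i\<in>moves u. (h (step i u) - h u)\<^sup>2))
       = - 2 * (\<Sum>u\<in>words n r. weight 0 u * h u * generator h u)"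
proof -
  have "(\<Sum>i\<in>moves u. (h (step i u) - h u)\<^sup>2) = generator (\<lambda>x. (h x)\<^sup>2) u - 2 * h u * generator h u" for u
  proof -
    have "(h (step i u) - h u)\<^sup>2 = ((h (step i u))\<^sup>2 - (h u)\<^sup>2) - 2 * h u * (h (step i u) - h u)" for i
      by (simp add: power2_eq_square algebra_simps)
    then show ?thesis unfolding generator_def sum_distrib_left sum_subtractf[symmetric] by simp
  qed
  then have "(\<Sum>u\<in>words n r. weight 0 u * (\<Sum>i\<in>moves u. (h (step i u) - h u)\<^sup>2))
     = (\<Sum>u\<in>words n r. weight 0 u * generator (\<lambda>x. (h x)\<^sup>2) u - 2 * (weight 0 u * h u * generator h u))"
    by (intro sum.cong HOL.refl) (simp add: right_diff_distrib)
  also have "\<dots> = (\<Sum>u\<in>words n r. weight 0 u * generator (\<lambda>x. (h x)\<^sup>2) u) - 2 * (\<Sum>u\<in>words n r. weight 0 u * h u * generator h u)"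
    by (simp only: sum_subtractf sum_distrib_left)
  finally show ?thesis using weight_stationary[OF assms] by simp
qed

lemma generator_expand:
  assumes "0 < n" "u \<in> words n r"
  shows "generator h u = (\<Sum>y\<in>words n r. h y * generator (\<lambda>x. of_bool (x = y)) u)"
proof -
  have h: "h x = (\<Sum>y\<in>words n r. h y * of_bool (x = y))" if "x \<in> words n r" for x
    using that by (simp add: if_distrib of_bool_def cong: if_cong)
  have st: "step i u \<in> words n r" if "i \<in> moves u" for i
    using that assms by (intro step_in_words) (auto simp: moves_def words_def)
  have "generator h u = (\<Sum>i\<in>moves u. \<Sum>y\<in>words n r. h y * (of_bool (step i u = y) - of_bool (u = y)))"
    unfolding generator_def
  proof (intro sum.cong HOL.refl)
    fix i assume i: "i \<in> moves u"
    show "h (step i u) - h u = (\<Sum>y\<in>words n r. h y * (of_bool (step i u = y) - of_bool (u = y)))"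
      by (subst h[OF st[OF i]], subst h[OF assms(2)])
        (simp add: sum_subtractf[symmetric] right_diff_distrib del: sum_of_bool_mult_eq sum_mult_of_bool_eq)
  qed
  also have "\<dots> = (\<Sum>y\<in>words n r. h y * generator (\<lambda>x. of_bool (x = y)) u)"
    unfolding generator_def by (subst sum.swap) (simp add: sum_distrib_left del: sum_of_bool_mult_eq sum_mult_of_bool_eq)
  finally show ?thesis .
qed

text \<open>
  Probability vectors that are asymptotically stationary converge to the stationary one. The
  Dirichlet form of the density \<open>h = \<mu> / weight\<close> tends to \<open>0\<close> because \<open>h\<close> is bounded and the
  defects tend to \<open>0\<close>; hence the differences of \<open>h\<close> along moves tend to \<open>0\<close>, and
  by connectedness all differences do. This plays the part of an ergodic theorem along a single
  trajectory.
\<close>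

lemma tendsto_stationary:
  fixes \<mu> :: "nat \<Rightarrow> int list \<Rightarrow> real"
  assumes n: "0 < n" and r: "r \<le> n"
    and nonneg: "\<And>j u. 0 \<le> \<mu> j u"
    and total: "\<And>j. (\<Sum>u\<in>words n r. \<mu> j u) = 1"
    and balance: "\<And>y. y \<in> words n r \<Longrightarrow>
       (\<lambda>j. \<Sum>u\<in>words n r. \<mu> j u * generator (\<lambda>x. of_bool (x = y)) u) \<longlonglongrightarrow> 0"
    and u: "u \<in> words n r"
  shows "(\<lambda>j. \<mu> j u) \<longlonglongrightarrow> weight 0 u / ballot n r"
proof -
  define h where "h j u = \<mu> j u / weight 0 u" for j u
  have w: "weight 0 u > 0" "weight 0 u \<noteq> 0" for u using weight_pos[of u] by auto
  have \<mu>: "\<mu> j u = weight 0 u * h j u" for j u using w(2)[of u] by (simp add: h_def)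
  define D where "D j = (\<Sum>u\<in>words n r. weight 0 u * (\<Sum>i\<in>moves u. (h j (step i u) - h j u)\<^sup>2))" for j
  define B where "B j y = (\<Sum>u\<in>words n r. \<mu> j u * generator (\<lambda>x. of_bool (x = y)) u)" for j y
  have le1: "\<mu> j u \<le> 1" if "u \<in> words n r" for j u
    using member_le_sum[of u "words n r" "\<mu> j"] that nonneg total[of j] by simp
  have hB: "(\<lambda>j. h j y * B j y) \<longlonglongrightarrow> 0" if "y \<in> words n r" for y
  proof (rule Lim_null_comparison)
    show "\<forall>\<^sub>F j in sequentially. norm (h j y * B j y) \<le> (1 / weight 0 y) * \<bar>B j y\<bar>"
    proof (intro always_eventually allI)
      fix j
      have "\<bar>h j y\<bar> \<le> 1 / weight 0 y"
        using le1[OF that, of j] nonneg[of j y] w(1)[of y] by (simp add: h_def divide_right_mono)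
      then show "norm (h j y * B j y) \<le> (1 / weight 0 y) * \<bar>B j y\<bar>"
        by (simp only: real_norm_def abs_mult mult_right_mono abs_ge_zero)
    qed
    show "(\<lambda>j. (1 / weight 0 y) * \<bar>B j y\<bar>) \<longlonglongrightarrow> 0"
      using balance[OF that] unfolding B_def[symmetric] by (intro tendsto_mult_right_zero tendsto_rabs_zero)
  qed
  have D: "D j = - 2 * (\<Sum>y\<in>words n r. h j y * B j y)" for j
  proof -
    have "(\<Sum>u\<in>words n r. weight 0 u * h j u * generator (h j) u)
        = (\<Sum>u\<in>words n r. \<Sum>y\<in>words n r. h j y * (\<mu> j u * generator (\<lambda>x. of_bool (x = y)) u))"
      unfolding \<mu>[symmetric]
      by (intro sum.cong HOL.refl, subst generator_expand[OF n]) (auto simp: sum_distrib_left mult.left_commute)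
    also have "\<dots> = (\<Sum>y\<in>words n r. h j y * B j y)"
      unfolding B_def by (subst sum.swap) (simp add: sum_distrib_left)
    finally show ?thesis unfolding D_def dirichlet_identity[OF n] by simp
  qed
  have "(\<lambda>j. - 2 * (\<Sum>y\<in>words n r. h j y * B j y)) \<longlonglongrightarrow> 0"
    by (intro tendsto_mult_right_zero tendsto_null_sum hB)
  then have D0: "D \<longlonglongrightarrow> 0" using D by presburger
  have edge: "(\<lambda>j. h j u - h j (step i u)) \<longlonglongrightarrow> 0" if "u \<in> words n r" "i \<in> moves u" for u i
  proof -
    have "(h j u - h j (step i u))\<^sup>2 \<le> D j / weight 0 u" for j
    proof -
      have "(h j u - h j (step i u))\<^sup>2 \<le> (\<Sum>i\<in>moves u. (h j (step i u) - h j u)\<^sup>2)"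
        using member_le_sum[of i "moves u" "\<lambda>i. (h j (step i u) - h j u)\<^sup>2"] that
        by (simp add: power2_commute)
      also have "weight 0 u * \<dots> \<le> D j" unfolding D_def
        by (rule member_le_sum[of u "words n r" "\<lambda>u. weight 0 u * (\<Sum>i\<in>moves u. (h j (step i u) - h j u)\<^sup>2)"])
          (use that in \<open>auto intro!: mult_nonneg_nonneg sum_nonneg\<close>)
      finally show ?thesis using w(1)[of u] by (simp add: field_simps)
    qed
    then have "(\<lambda>j. (h j u - h j (step i u))\<^sup>2) \<longlonglongrightarrow> 0"
      by (intro Lim_null_comparison[OF _ tendsto_divide_zero[OF D0, of "weight 0 u"]] always_eventually) auto
    then show ?thesis using tendsto_real_sqrt[of _ 0]
      by (fastforce simp: tendsto_rabs_zero_iff)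
  qed
  have hh: "(\<lambda>j. h j u - h j v) \<longlonglongrightarrow> 0" if "u \<in> words n r" "v \<in> words n r" for u v
  proof (rule words_connected[OF n, where R = "\<lambda>u v. (\<lambda>j. h j u - h j v) \<longlonglongrightarrow> 0"])
    show "equivp (\<lambda>u v. (\<lambda>j. h j u - h j v) \<longlonglongrightarrow> 0)"
    proof (rule equivpI)
      show "symp (\<lambda>u v. (\<lambda>j. h j u - h j v) \<longlonglongrightarrow> 0)"
        by (rule sympI) (drule tendsto_minus, simp)
      show "transp (\<lambda>u v. (\<lambda>j. h j u - h j v) \<longlonglongrightarrow> 0)"
        by (rule transpI) (drule (1) tendsto_add, simp)
    qed (auto simp: reflp_def)
  qed (use edge that in auto)
  have Z: "(\<Sum>v\<in>words n r. weight 0 v) = ballot n r" using weight_sum[of 0 n r] by simp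
  have "h j u * ballot n r - 1 = (\<Sum>v\<in>words n r. weight 0 v * (h j u - h j v))" for j
    using total[of j] by (simp add: right_diff_distrib sum_subtractf \<mu>[symmetric] sum_distrib_right[symmetric] Z)
  moreover have "(\<lambda>j. \<Sum>v\<in>words n r. weight 0 v * (h j u - h j v)) \<longlonglongrightarrow> 0"
    by (intro tendsto_null_sum tendsto_mult_right_zero hh u)
  ultimately have "(\<lambda>j. h j u * ballot n r - 1) \<longlonglongrightarrow> 0" by simp
  then have "(\<lambda>j. (h j u * ballot n r - 1 + 1) * (weight 0 u / ballot n r)) \<longlonglongrightarrow> (0 + 1) * (weight 0 u / ballot n r)"
    by (intro tendsto_intros)
  then show ?thesis using ballot_pos[OF r] by (simp add: \<mu> mult.commute)
qed

section \<open>Histories and their occupation frequencies\<close>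

text \<open>
  A history is the list of the moves made so far, the latest one first, so that appending a move
  is \<open>Cons\<close>. The process starts in the increasing word.
\<close>

fun word :: "nat \<Rightarrow> nat list \<Rightarrow> int list" where
  "word n [] = map int [1..<Suc n]"
| "word n (i # p) = step i (word n p)"

text \<open>
  Additive functionals of a history: \<open>f\<close> may depend on the word before the move and on the move.
\<close>

fun path_sum :: "nat \<Rightarrow> (int list \<Rightarrow> nat \<Rightarrow> real) \<Rightarrow> nat list \<Rightarrow> real" where
  "path_sum n f [] = 0"
| "path_sum n f (i # p) = path_sum n f p + f (word n p) i"

lemma path_sum_diff: "path_sum n (\<lambda>u i. f u i - g u i) p = path_sum n f p - path_sum n g p"
  by (induction p) auto

lemma path_sum_sum: "path_sum n (\<lambda>u i. \<Sum>x\<in>A. f x u i) p = (\<Sum>x\<in>A. path_sum n (f x) p)"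
  by (induction p) (auto simp: sum.distrib)

lemma path_sum_mult_left: "path_sum n (\<lambda>u i. c * f u i) p = c * path_sum n f p"
  by (induction p) (auto simp: algebra_simps)

lemma path_sum_nonneg: "(\<And>u i. 0 \<le> f u i) \<Longrightarrow> 0 \<le> path_sum n f p"
  by (induction p) auto

text \<open>
  Comparing multisets makes invariance under moves a statement about swapping two entries.
\<close>

definition signed_perm :: "nat \<Rightarrow> int list \<Rightarrow> bool" where
  "signed_perm n u \<longleftrightarrow> mset (map abs u) = mset (map int [1..<Suc n])"

lemma signed_perm_length: "signed_perm n u \<Longrightarrow> length u = n"
  unfolding signed_perm_def by (drule arg_cong[where f = size]) simp

lemma signed_perm_step:
  assumes "signed_perm n u" "0 < n"
  shows "signed_perm n (step i u)"
proof -
  have u: "u \<noteq> []" using assms signed_perm_length by fastforce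
  have "mset (map abs (step i u)) = mset (map abs u)"
  proof -
    consider "i = 0" | "0 < i" "i < length u" | "i \<ge> length u" "0 < i" by linarith
    then show ?thesis
    proof cases
      case 1
      then show ?thesis using u by (cases u) (auto simp: step_def)
    next
      case 2
      then show ?thesis using mset_swap[of i "map abs u" "i - 1"] by (simp add: step_def map_update)
    next
      case 3
      obtain a p where "u = p @ [a]" using u by (metis rev_exhaust)
      then show ?thesis using 3 by (simp add: step_def)
    qed
  qed
  then show ?thesis using assms by (simp add: signed_perm_def)
qed

lemma signed_perm_word: "0 < n \<Longrightarrow> signed_perm n (word n p)"
  by (induction p) (auto simp: signed_perm_step, simp add: signed_perm_def o_def)

lemma signed_perm_set: "signed_perm n u \<Longrightarrow> abs ` set u = int ` {1..n}"
  unfolding signed_perm_def by (drule arg_cong[where f = set_mset]) (auto simp: image_iff)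

lemma length_word: "0 < n \<Longrightarrow> length (word n p) = n"
  using signed_perm_word signed_perm_length by blast

lemma zero_notin_signed_perm: "signed_perm n u \<Longrightarrow> 0 \<notin> set u"
  using signed_perm_set[of n u] by (force simp: image_iff)

lemma moves_word_nonempty: "0 < n \<Longrightarrow> moves (word n p) \<noteq> {}"
  using moves_nonempty zero_notin_signed_perm signed_perm_word length_word
  by (metis length_0_conv less_numeral_extra(3))

lemma card_moves_word: 
  assumes "0 < n"
  shows "0 < card (moves (word n p))" "card (moves (word n p)) \<le> Suc n"
proof -
  show "0 < card (moves (word n p))" using moves_word_nonempty[OF assms] by (simp add: card_gt_0_iff)
  have "moves (word n p) \<subseteq> {..n}" using length_word[OF assms] by (auto simp: moves_def)
  then show "card (moves (word n p)) \<le> Suc n" using card_mono[of "{..n}"] by fastforce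
qed

text \<open>
  Forgetting everything about a label except its sign and whether its modulus reaches \<open>k\<close>. This
  turns the process on signed permutations into one with three kinds of letters.
\<close>

definition charge :: "nat \<Rightarrow> int \<Rightarrow> int" where
  "charge k v = (if int k \<le> v then 1 else if v \<le> - int k then - 1 else 0)"

lemma charge_minus: "0 < k \<Longrightarrow> charge k (- v) = - charge k v"
  by (auto simp: charge_def)

lemma charge_mono: "0 < k \<Longrightarrow> v \<le> w \<Longrightarrow> charge k v \<le> charge k w"
  by (auto simp: charge_def)

text \<open>
  The zeros are the labels of modulus less than \<open>k\<close>, of which a signed permutation has \<open>k - 1\<close>.
\<close>

lemma charge_word_in_words:
  assumes k: "1 \<le> k" "k \<le> n" and u: "signed_perm n u"
  shows "map (charge k) u \<in> words n (k - 1)"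
proof -
  have "count_list (map (charge k) u) 0 = size (filter_mset (\<lambda>v. v < int k) (mset (map abs u)))"
  proof (induction u)
    case (Cons a u)
    then show ?case using k by (auto simp: charge_def)
  qed simp
  also have "\<dots> = length (filter (\<lambda>v. v < int k) (map int [1..<Suc n]))"
    using u unfolding signed_perm_def by (metis mset_filter size_mset)
  also have "\<dots> = card {i. i < n \<and> int (Suc i) < int k}"
    by (subst length_filter_conv_card) (auto simp del: upt_Suc intro!: arg_cong[where f = card])
  also have "{i. i < n \<and> int (Suc i) < int k} = {..<k - 1}" using k by auto
  finally have "count_list (map (charge k) u) 0 = k - 1" by simp
  then show ?thesis using signed_perm_length[OF u] by (auto simp: words_def charge_def)
qed

text \<open>
  The projection is a Markov process in its own right. It is monotone and odd, so a descent of the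
  projected word is a descent of the word, and a descent that disappears in the projection is
  a move that the projected word does not notice.
\<close>

lemma generator_charge:
  assumes "0 < k" "u \<noteq> []"
  shows "(\<Sum>i\<in>moves u. \<phi> (map (charge k) (step i u)) - \<phi> (map (charge k) u)) = generator \<phi> (map (charge k) u)"
proof -
  let ?v = "map (charge k) u"
  have padded: "padded ?v i = charge k (padded u i)" for i
    using padded_map[OF assms(2), of "charge k"] charge_minus[OF assms(1)] by blast
  have st: "map (charge k) (step i u) = step i ?v" for i
    using step_map[OF assms(2), of "charge k"] charge_minus[OF assms(1)] by simp
  have "moves ?v \<subseteq> moves u"
    using charge_mono[OF assms(1)] unfolding moves_def padded by (force simp: not_less[symmetric])
  moreover have "\<phi> (step i ?v) - \<phi> ?v = 0" if "i \<in> moves u - moves ?v" for i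
  proof -
    have "padded ?v i = padded ?v (Suc i)" "i \<le> length ?v"
      using that charge_mono[OF assms(1), of "padded u (Suc i)" "padded u i"] by (auto simp: moves_def padded)
    then show ?thesis using step_eq_self[of ?v i] assms(2) by simp
  qed
  ultimately show ?thesis
    unfolding generator_def st by (intro sum.mono_neutral_right) auto
qed

definition avg :: "(int list \<Rightarrow> nat \<Rightarrow> real) \<Rightarrow> int list \<Rightarrow> real" where
  "avg \<xi> u = (\<Sum>i\<in>moves u. \<xi> u i) / card (moves u)"

text \<open>
  The martingale part of an additive functional along the chain that picks one of the available
  moves uniformly.
\<close>

definition mart :: "nat \<Rightarrow> (int list \<Rightarrow> nat \<Rightarrow> real) \<Rightarrow> nat list \<Rightarrow> real" where
  "mart n \<xi> = path_sum n (\<lambda>u i. \<xi> u i - avg \<xi> u)"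

text \<open>
  The chain that picks uniformly among the available moves is the jump chain of the process with
  rates \<open>1\<close>; the clock adds up the mean holding times and converts between the two.
\<close>

definition clock :: "nat \<Rightarrow> nat list \<Rightarrow> real" where
  "clock n = path_sum n (\<lambda>u i. 1 / card (moves u))"

definition jump :: "nat \<Rightarrow> int list \<Rightarrow> int list \<Rightarrow> nat \<Rightarrow> real" where
  "jump k y u i = of_bool (map (charge k) (step i u) = y) - of_bool (map (charge k) u = y)"

text \<open>
  The charge carried through the right end. Only right end moves translate an alcove, so this is
  what measures its displacement.
\<close>

definition exit_charge :: "nat \<Rightarrow> int list \<Rightarrow> nat \<Rightarrow> real" where
  "exit_charge k u i = (if i = length u then real_of_int (charge k (last u)) else 0)"

text \<open>
  Division by the number of moves is the factor between the jump chain and the generator; it is the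
  increment of the clock.
\<close>

lemma avg_jump:
  assumes "0 < k" "u \<noteq> []"
  shows "avg (jump k y) u = generator (\<lambda>x. of_bool (x = y)) (map (charge k) u) / card (moves u)"
  unfolding avg_def jump_def generator_charge[OF assms, of "\<lambda>x. of_bool (x = y)"] ..

lemma avg_exit_charge:
  assumes "0 < k" "u \<noteq> []"
  shows "avg (exit_charge k) u = of_bool (0 < last (map (charge k) u)) / card (moves u)"
proof -
  have m: "length u \<in> moves u \<longleftrightarrow> 0 < last u"
    using assms(2) by (simp add: moves_def padded_def last_conv_nth Suc_le_eq)
  have "(\<Sum>i\<in>moves u. exit_charge k u i) = (if length u \<in> moves u then real_of_int (charge k (last u)) else 0)"
    unfolding exit_charge_def by (subst sum.delta) auto
  also have "\<dots> = of_bool (0 < last (map (charge k) u))"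
    using assms unfolding m by (auto simp: last_map charge_def)
  finally show ?thesis by (simp add: avg_def)
qed

definition occupation :: "nat \<Rightarrow> nat \<Rightarrow> int list \<Rightarrow> nat list \<Rightarrow> real" where
  "occupation n k x = path_sum n (\<lambda>u i. of_bool (map (charge k) u = x) / card (moves u))"

lemma path_sum_cong: 
  assumes "\<And>q i. f (word n q) i = g (word n q) i"
  shows "path_sum n f p = path_sum n g p"
  by (induction p) (auto simp: assms)

lemma path_sum_occupation:
  assumes "1 \<le> k" "k \<le> n"
  shows "path_sum n (\<lambda>u i. f (map (charge k) u) / card (moves u)) p = (\<Sum>x\<in>words n (k - 1). occupation n k x p * f x)"
proof -
  have "path_sum n (\<lambda>u i. f (map (charge k) u) / card (moves u)) p
     = path_sum n (\<lambda>u i. \<Sum>x\<in>words n (k - 1). f x * (of_bool (map (charge k) u = x) / card (moves u))) p"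
  proof (rule path_sum_cong)
    fix q i
    have "map (charge k) (word n q) \<in> words n (k - 1)"
      using assms by (intro charge_word_in_words signed_perm_word) auto
    then show "f (map (charge k) (word n q)) / card (moves (word n q))
      = (\<Sum>x\<in>words n (k - 1). f x * (of_bool (map (charge k) (word n q) = x) / card (moves (word n q))))"
      by (subst sum.cong[OF HOL.refl, of _ _ "\<lambda>x. if map (charge k) (word n q) = x then f x / card (moves (word n q)) else 0"]) auto
  qed
  then show ?thesis unfolding path_sum_sum path_sum_mult_left by (simp only: occupation_def mult.commute)
qed

lemma path_sum_jump: "\<bar>path_sum n (jump k y) p\<bar> \<le> 1"
proof -
  have "path_sum n (jump k y) p = of_bool (map (charge k) (word n p) = y) - of_bool (map (charge k) (word n []) = y)"
    by (induction p) (auto simp: jump_def)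
  then show ?thesis by simp
qed

lemma clock_ge:
  assumes "0 < n"
  shows "length p / Suc n \<le> clock n p"
proof (induction p)
  case (Cons i p)
  have "1 / real (Suc n) \<le> 1 / card (moves (word n p))"
    using card_moves_word[OF assms, of p] by (intro divide_left_mono) auto
  then show ?case using Cons by (simp add: clock_def add_divide_distrib)
qed (simp add: clock_def)

text \<open>
  The finitely many functionals whose martingale parts have to be small for a history to behave
  like the stationary process.
\<close>

definition observables :: "nat \<Rightarrow> (int list \<Rightarrow> nat \<Rightarrow> real) set" where
  "observables n = (\<Union>k\<in>{1..n}. insert (exit_charge k) (jump k ` words n (k - 1)))"

lemma finite_observables: "finite (observables n)"
  by (auto simp: observables_def)

lemma observables_bounded: "\<xi> \<in> observables n \<Longrightarrow> \<bar>\<xi> u i\<bar> \<le> 1"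
  by (auto simp: observables_def jump_def exit_charge_def charge_def)

text \<open>
  A statement about arbitrary histories, without probability: if the martingale parts of all
  observables are negligible, then the charge of modulus at least \<open>k\<close> leaves through the right end
  at the stationary rate. The occupation frequencies, weighted by the clock, are asymptotically
  stationary because the net number of jumps into any word is bounded.
\<close>

lemma exit_rate_tendsto:
  assumes k: "1 \<le> k" "k \<le> n"
    and len: "\<And>j. 0 < length (p j)" "filterlim (\<lambda>j. length (p j)) at_top sequentially"
    and mart: "\<And>\<xi>. \<xi> \<in> observables n \<Longrightarrow> (\<lambda>j. mart n \<xi> (p j) / length (p j)) \<longlonglongrightarrow> 0"
  shows "(\<lambda>j. path_sum n (exit_charge k) (p j) / clock n (p j))
           \<longlonglongrightarrow> ((real n + 1)\<^sup>2 - (real k)\<^sup>2) / (2 * real n * (2 * real n + 1))"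
proof -
  define S where "S = words n (k - 1)"
  have n: "0 < n" "0 < k" "k - 1 \<le> n" using k by auto
  have c: "0 < clock n (p j)" for j
    using clock_ge[OF n(1), of "p j"] len(1)[of j]
    by (intro less_le_trans[OF _ clock_ge[OF n(1), of "p j"]]) simp
  have ne: "word n q \<noteq> []" for q using length_word[OF n(1), of q] n(1) by auto
  have small: "(\<lambda>j. a j / clock n (p j)) \<longlonglongrightarrow> 0" if "(\<lambda>j. a j / length (p j)) \<longlonglongrightarrow> 0" for a
  proof (rule Lim_null_comparison)
    show "\<forall>\<^sub>F j in sequentially. norm (a j / clock n (p j)) \<le> Suc n * norm (a j / length (p j))"
    proof (intro always_eventually allI)
      fix j
      have "inverse (clock n (p j)) \<le> inverse (length (p j) / Suc n)"
        using clock_ge[OF n(1), of "p j"] len(1)[of j] by (intro le_imp_inverse_le) auto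
      then have "\<bar>a j\<bar> * inverse (clock n (p j)) \<le> \<bar>a j\<bar> * inverse (length (p j) / Suc n)"
        by (rule mult_left_mono) simp
      then show "norm (a j / clock n (p j)) \<le> Suc n * norm (a j / length (p j))"
        using c[of j] by (simp add: abs_mult divide_inverse mult_ac)
    qed
    show "(\<lambda>j. Suc n * norm (a j / length (p j))) \<longlonglongrightarrow> 0"
      by (intro tendsto_mult_right_zero tendsto_norm_zero that)
  qed
  \<comment> \<open>The fraction of the process time that is spent in the projected word \<open>x\<close>.\<close>
  define \<mu> where "\<mu> j x = occupation n k x (p j) / clock n (p j)" for j x
  have nonneg: "0 \<le> \<mu> j x" for j x
    unfolding \<mu>_def occupation_def by (intro divide_nonneg_nonneg path_sum_nonneg less_imp_le[OF c]) auto
  have total: "(\<Sum>x\<in>S. \<mu> j x) = 1" for j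
    using path_sum_occupation[OF k, of "\<lambda>x. 1" "p j"] c[of j]
    by (simp add: \<mu>_def S_def clock_def sum_divide_distrib[symmetric])
  have bal: "(\<lambda>j. \<Sum>x\<in>S. \<mu> j x * generator (\<lambda>x. of_bool (x = y)) x) \<longlonglongrightarrow> 0" if "y \<in> S" for y
  proof -
    have "(\<Sum>x\<in>S. \<mu> j x * generator (\<lambda>x. of_bool (x = y)) x)
        = (path_sum n (jump k y) (p j) - mart n (jump k y) (p j)) / clock n (p j)" for j
    proof -
      have "path_sum n (jump k y) (p j) - mart n (jump k y) (p j)
          = path_sum n (\<lambda>u i. avg (jump k y) u) (p j)"
        by (simp add: mart_def path_sum_diff)
      also have "\<dots> = path_sum n (\<lambda>u i. generator (\<lambda>x. of_bool (x = y)) (map (charge k) u) / card (moves u)) (p j)"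
        by (intro path_sum_cong avg_jump n ne)
      also have "\<dots> = (\<Sum>x\<in>S. occupation n k x (p j) * generator (\<lambda>x. of_bool (x = y)) x)"
        unfolding S_def by (rule path_sum_occupation[OF k])
      finally show ?thesis by (simp add: \<mu>_def sum_divide_distrib)
    qed
    moreover have "(\<lambda>j. (path_sum n (jump k y) (p j) - mart n (jump k y) (p j)) / clock n (p j)) \<longlonglongrightarrow> 0"
    proof (rule small)
      have "(\<lambda>j. 1 / real (length (p j))) \<longlonglongrightarrow> 0"
        using filterlim_compose[OF lim_1_over_n len(2)] by (simp add: o_def)
      then have "(\<lambda>j. path_sum n (jump k y) (p j) / length (p j)) \<longlonglongrightarrow> 0"
        by (rule Lim_null_comparison[rotated])
          (use path_sum_jump[of n k y] in \<open>auto intro!: always_eventually divide_right_mono\<close>)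
      moreover have "(\<lambda>j. mart n (jump k y) (p j) / length (p j)) \<longlonglongrightarrow> 0"
        by (rule mart) (use that k in \<open>force simp: observables_def S_def\<close>)
      ultimately show "(\<lambda>j. (path_sum n (jump k y) (p j) - mart n (jump k y) (p j)) / length (p j)) \<longlonglongrightarrow> 0"
        using tendsto_diff by (fastforce simp: diff_divide_distrib)
    qed
    ultimately show ?thesis by simp
  qed
  have lim: "(\<lambda>j. \<mu> j x) \<longlonglongrightarrow> weight 0 x / ballot n (k - 1)" if "x \<in> S" for x
    using tendsto_stationary[OF n(1,3), of \<mu> x] nonneg total bal that unfolding S_def by blast
  have "path_sum n (exit_charge k) (p j) / clock n (p j)
      = mart n (exit_charge k) (p j) / clock n (p j) + (\<Sum>x\<in>S. \<mu> j x * of_bool (0 < last x))" for j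
  proof -
    have "path_sum n (exit_charge k) (p j) - mart n (exit_charge k) (p j) = path_sum n (\<lambda>u i. avg (exit_charge k) u) (p j)"
      by (simp add: mart_def path_sum_diff)
    also have "\<dots> = path_sum n (\<lambda>u i. of_bool (0 < last (map (charge k) u)) / card (moves u)) (p j)"
      by (intro path_sum_cong avg_exit_charge n ne)
    also have "\<dots> = (\<Sum>x\<in>S. occupation n k x (p j) * of_bool (0 < last x))"
      unfolding S_def by (rule path_sum_occupation[OF k])
    finally have "path_sum n (exit_charge k) (p j) = mart n (exit_charge k) (p j) + (\<Sum>x\<in>S. occupation n k x (p j) * of_bool (0 < last x))"
      by simp
    then show ?thesis
      unfolding \<mu>_def by (simp only: add_divide_distrib sum_divide_distrib times_divide_eq_left)
  qed
  moreover have "(\<lambda>j. mart n (exit_charge k) (p j) / clock n (p j) + (\<Sum>x\<in>S. \<mu> j x * of_bool (0 < last x)))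
     \<longlonglongrightarrow> 0 + (\<Sum>x\<in>S. weight 0 x / ballot n (k - 1) * of_bool (0 < last x))"
    by (intro tendsto_intros lim small mart) (use k in \<open>auto simp: observables_def\<close>)
  moreover have "(\<Sum>x\<in>S. weight 0 x / ballot n (k - 1) * of_bool (0 < last x))
     = ((real n + 1)\<^sup>2 - (real k)\<^sup>2) / (2 * real n * (2 * real n + 1))"
  proof -
    have "(\<Sum>x\<in>S. weight 0 x / ballot n (k - 1) * of_bool (0 < last x))
        = (\<Sum>x\<in>S. weight 0 x * of_bool (0 < last x)) / ballot n (k - 1)"
      by (simp only: sum_divide_distrib times_divide_eq_left)
    also have "\<dots> = (real n - real (k - 1)) * (real n + real (k - 1) + 2) / (2 * real n * (2 * real n + 1))"
      unfolding S_def by (rule current[OF n(1,3)])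
    also have "(real n - real (k - 1)) * (real n + real (k - 1) + 2) = (real n + 1)\<^sup>2 - (real k)\<^sup>2"
      using k by (simp add: of_nat_diff power2_eq_square algebra_simps)
    finally show ?thesis .
  qed
  ultimately show ?thesis by simp
qed

section \<open>Martingale deviations\<close>

text \<open>
  The law of the first \<open>t\<close> moves when each move is uniform among the available ones. It is the
  reduced walk with the finite walls of the chamber removed.
\<close>

primrec ascent_pmf :: "nat \<Rightarrow> nat \<Rightarrow> nat list pmf" where
  "ascent_pmf n 0 = return_pmf []"
| "ascent_pmf n (Suc t) = bind_pmf (ascent_pmf n t) (\<lambda>p. map_pmf (\<lambda>i. i # p) (pmf_of_set (moves (word n p))))"

primrec valid :: "nat \<Rightarrow> nat list \<Rightarrow> bool" where
  "valid n [] \<longleftrightarrow> True"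
| "valid n (i # p) \<longleftrightarrow> valid n p \<and> i \<in> moves (word n p)"

lemma set_ascent_pmf:
  assumes "0 < n"
  shows "set_pmf (ascent_pmf n t) = {p. valid n p \<and> length p = t}"
proof (induction t)
  case (Suc t)
  show ?case
  proof (intro set_eqI)
    fix p show "p \<in> set_pmf (ascent_pmf n (Suc t)) \<longleftrightarrow> p \<in> {p. valid n p \<and> length p = Suc t}"
      using Suc moves_word_nonempty[OF assms] by (cases p) auto
  qed
qed auto

lemma finite_set_ascent_pmf: "0 < n \<Longrightarrow> finite (set_pmf (ascent_pmf n t))"
  by (induction t) (auto simp: moves_word_nonempty)

lemma ascent_pmf_expectation:
  fixes F :: "nat list \<Rightarrow> real"
  assumes "0 < n"
  shows "measure_pmf.expectation (ascent_pmf n (Suc t)) F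
       = measure_pmf.expectation (ascent_pmf n t) (\<lambda>p. (\<Sum>i\<in>moves (word n p). F (i # p)) / card (moves (word n p)))"
proof -
  let ?A = "set_pmf (ascent_pmf n t)"
  have fin: "finite ?A" using finite_set_ascent_pmf[OF assms] .
  have "measure_pmf.expectation (ascent_pmf n (Suc t)) F
      = (\<Sum>p\<in>?A. pmf (ascent_pmf n t) p *\<^sub>R measure_pmf.expectation (map_pmf (\<lambda>i. i # p) (pmf_of_set (moves (word n p)))) F)"
    unfolding ascent_pmf.simps
    by (rule pmf_expectation_bind[OF fin]) (auto simp: moves_word_nonempty[OF assms])
  also have "\<dots> = (\<Sum>p\<in>?A. pmf (ascent_pmf n t) p *\<^sub>R ((\<Sum>i\<in>moves (word n p). F (i # p)) / card (moves (word n p))))"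
    by (simp add: integral_pmf_of_set moves_word_nonempty[OF assms])
  also have "\<dots> = measure_pmf.expectation (ascent_pmf n t) (\<lambda>p. (\<Sum>i\<in>moves (word n p). F (i # p)) / card (moves (word n p)))"
    by (subst integral_measure_pmf[OF fin]) auto
  finally show ?thesis .
qed

text \<open>
  The law as a product of one-step probabilities, which is how it is compared with the walk.
\<close>

lemma pmf_ascent_pmf_Cons:
  assumes "0 < n" "i \<in> moves (word n p)" "length p = t"
  shows "pmf (ascent_pmf n (Suc t)) (i # p) = pmf (ascent_pmf n t) p / card (moves (word n p))"
proof -
  have "pmf (ascent_pmf n (Suc t)) (i # p) = measure_pmf.expectation (ascent_pmf n (Suc t)) (indicator {i # p})"
    by (simp add: measure_pmf_single)
  also have "\<dots> = measure_pmf.expectation (ascent_pmf n t)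
      (\<lambda>q. indicator {p} q * (1 / card (moves (word n p))))"
  proof (subst ascent_pmf_expectation[OF assms(1)], rule arg_cong[where f = "measure_pmf.expectation (ascent_pmf n t)"], rule HOL.ext)
    fix q
    have "(\<Sum>j\<in>moves (word n q). indicator {i # p} (j # q)) = (if q = p then \<Sum>j\<in>moves (word n p). if j = i then 1 else 0 else (0::real))"
      by (auto simp: indicator_def intro!: sum.cong sum.neutral)
    then show "(\<Sum>j\<in>moves (word n q). indicator {i # p} (j # q)) / card (moves (word n q))
        = indicator {p} q * (1 / real (card (moves (word n p))))"
      using assms(2) by auto
  qed
  also have "\<dots> = pmf (ascent_pmf n t) p * (1 / card (moves (word n p)))"
    by (subst integral_mult_left_zero) (simp add: measure_pmf_single)
  finally show ?thesis by simp
qed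

text \<open>
  One step of the moment recursion. For the fourth moment the cubic term is absorbed by
  \<open>4 m \<eta>\<^sup>3 \<le> 2 m\<^sup>2 \<eta>\<^sup>2 + 2 \<eta>\<^sup>4\<close>, and the term linear in \<open>\<eta>\<close> averages out.
\<close>

lemma centered_moments:
  fixes \<eta> :: "'a \<Rightarrow> real"
  assumes "finite A" "A \<noteq> {}" "(\<Sum>i\<in>A. \<eta> i) = 0" "\<And>i. i \<in> A \<Longrightarrow> \<bar>\<eta> i\<bar> \<le> c"
  shows "(\<Sum>i\<in>A. (m + \<eta> i)\<^sup>2) / card A \<le> m\<^sup>2 + c\<^sup>2"
    and "(\<Sum>i\<in>A. (m + \<eta> i) ^ 4) / card A \<le> m ^ 4 + 8 * c\<^sup>2 * m\<^sup>2 + 3 * c ^ 4"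
proof -
  have card: "0 < real (card A)" using assms by (simp add: card_gt_0_iff)
  have sq: "(\<eta> i)\<^sup>2 \<le> c\<^sup>2" if "i \<in> A" for i using assms(4)[OF that] by (metis abs_ge_zero order_trans power2_abs power_mono)
  have "(\<Sum>i\<in>A. (m + \<eta> i)\<^sup>2) \<le> (\<Sum>i\<in>A. m\<^sup>2 + c\<^sup>2 + 2 * m * \<eta> i)"
    using sq by (intro sum_mono) (simp add: power2_sum)
  also have "\<dots> = (m\<^sup>2 + c\<^sup>2) * card A"
    by (simp add: sum.distrib sum_distrib_left[symmetric] assms(3))
  finally show "(\<Sum>i\<in>A. (m + \<eta> i)\<^sup>2) / card A \<le> m\<^sup>2 + c\<^sup>2" using card by (simp add: pos_divide_le_eq)
  have "(\<Sum>i\<in>A. (m + \<eta> i) ^ 4) \<le> (\<Sum>i\<in>A. m ^ 4 + 8 * c\<^sup>2 * m\<^sup>2 + 3 * c ^ 4 + 4 * m ^ 3 * \<eta> i)"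
  proof (intro sum_mono)
    fix i assume i: "i \<in> A"
    have "0 \<le> 2 * (\<eta> i)\<^sup>2 * (m - \<eta> i)\<^sup>2" by simp
    then have 1: "(m + \<eta> i) ^ 4 \<le> m ^ 4 + 4 * m ^ 3 * \<eta> i + 8 * (\<eta> i)\<^sup>2 * m\<^sup>2 + 3 * ((\<eta> i)\<^sup>2)\<^sup>2"
      by (simp add: power2_eq_square power4_eq_xxxx power3_eq_cube algebra_simps)
    have "8 * (\<eta> i)\<^sup>2 * m\<^sup>2 \<le> 8 * c\<^sup>2 * m\<^sup>2" using sq[OF i] by (intro mult_right_mono) auto
    moreover have "((\<eta> i)\<^sup>2)\<^sup>2 \<le> (c\<^sup>2)\<^sup>2" by (rule power_mono[OF sq[OF i]]) simp
    then have "((\<eta> i)\<^sup>2)\<^sup>2 \<le> c ^ 4" by (metis mult_2 numeral_Bit0 power_mult)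
    ultimately show "(m + \<eta> i) ^ 4 \<le> m ^ 4 + 8 * c\<^sup>2 * m\<^sup>2 + 3 * c ^ 4 + 4 * m ^ 3 * \<eta> i"
      using 1 by linarith
  qed
  also have "\<dots> = (m ^ 4 + 8 * c\<^sup>2 * m\<^sup>2 + 3 * c ^ 4) * card A"
    by (simp add: sum.distrib sum_distrib_left[symmetric] assms(3))
  finally show "(\<Sum>i\<in>A. (m + \<eta> i) ^ 4) / card A \<le> m ^ 4 + 8 * c\<^sup>2 * m\<^sup>2 + 3 * c ^ 4"
    using card by (simp add: pos_divide_le_eq)
qed

text \<open>
  Increments are bounded by \<open>c = 2\<close>, the observable and its mean being bounded by \<open>1\<close>; the
  constant is \<open>11 c\<^sup>4\<close>. The fourth moment is used because it makes the tail
  probabilities below summable over all times.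
\<close>

lemma mart_fourth_moment:
  assumes n: "0 < n" and \<xi>: "\<And>u i. \<bar>\<xi> u i\<bar> \<le> 1"
  shows "measure_pmf.expectation (ascent_pmf n t) (\<lambda>p. (mart n \<xi> p) ^ 4) \<le> 176 * t\<^sup>2"
proof -
  let ?E = "\<lambda>t. measure_pmf.expectation (ascent_pmf n t)"
  have int: "integrable (ascent_pmf n t) f" for t and f :: "nat list \<Rightarrow> real"
    by (intro integrable_measure_pmf_finite finite_set_ascent_pmf n)
  have cen: "(\<Sum>i\<in>moves (word n p). \<xi> (word n p) i - avg \<xi> (word n p)) = 0" for p
    using card_moves_word[OF n, of p] by (simp add: sum_subtractf avg_def)
  have avg: "\<bar>avg \<xi> (word n p)\<bar> \<le> 1" for p
  proof -
    have "\<bar>\<Sum>i\<in>moves (word n p). \<xi> (word n p) i\<bar> \<le> (\<Sum>i\<in>moves (word n p). 1)"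
      by (intro order_trans[OF sum_abs] sum_mono \<xi>)
    then show ?thesis using card_moves_word[OF n, of p] by (simp add: avg_def abs_divide)
  qed
  have bd: "\<bar>\<xi> (word n p) i - avg \<xi> (word n p)\<bar> \<le> 2" for p i
    using \<xi>[of "word n p" i] avg[of p] by linarith
  note m = centered_moments[OF finite_moves moves_word_nonempty[OF n] cen bd]
  have M: "mart n \<xi> (i # p) = mart n \<xi> p + (\<xi> (word n p) i - avg \<xi> (word n p))" for i p
    by (simp add: mart_def)
  have E2: "?E t (\<lambda>p. (mart n \<xi> p)\<^sup>2) \<le> 4 * t" for t
  proof (induction t)
    case 0
    show ?case by (simp add: mart_def)
  next
    case (Suc t)
    have "?E (Suc t) (\<lambda>p. (mart n \<xi> p)\<^sup>2) \<le> ?E t (\<lambda>p. (mart n \<xi> p)\<^sup>2 + 2\<^sup>2)"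
      unfolding ascent_pmf_expectation[OF n] M by (intro integral_mono int m(1))
    also have "\<dots> = ?E t (\<lambda>p. (mart n \<xi> p)\<^sup>2) + 4"
      by (subst Bochner_Integration.integral_add) (auto intro: int)
    finally show ?case using Suc by simp
  qed
  show "?E t (\<lambda>p. (mart n \<xi> p) ^ 4) \<le> 176 * t\<^sup>2"
  proof (induction t)
    case 0
    show ?case by (simp add: mart_def)
  next
    case (Suc t)
    have "?E (Suc t) (\<lambda>p. (mart n \<xi> p) ^ 4) \<le> ?E t (\<lambda>p. (mart n \<xi> p) ^ 4 + 8 * 2\<^sup>2 * (mart n \<xi> p)\<^sup>2 + 3 * 2 ^ 4)"
      unfolding ascent_pmf_expectation[OF n] M by (intro integral_mono int m(2))
    also have "\<dots> = ?E t (\<lambda>p. (mart n \<xi> p) ^ 4) + 32 * ?E t (\<lambda>p. (mart n \<xi> p)\<^sup>2) + 48"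
      by (simp add: Bochner_Integration.integral_add int)
    also have "\<dots> \<le> 176 * t\<^sup>2 + 32 * (4 * t) + 48" using Suc E2[of t] by simp
    also have "\<dots> \<le> 176 * (Suc t)\<^sup>2" by (simp add: power2_eq_square algebra_simps)
    finally show ?case by simp
  qed
qed

lemma mart_tail:
  assumes n: "0 < n" and \<xi>: "\<And>u i. \<bar>\<xi> u i\<bar> \<le> 1" and \<epsilon>: "0 < \<epsilon>" and t: "0 < t"
  shows "measure (measure_pmf (ascent_pmf n t)) {p. \<epsilon> * real t \<le> \<bar>mart n \<xi> p\<bar>} \<le> 176 / \<epsilon> ^ 4 * (1 / (real t)\<^sup>2)"
proof -
  have pos: "0 < (\<epsilon> * real t) ^ 4" using \<epsilon> t by simp
  have "{p. \<epsilon> * real t \<le> \<bar>mart n \<xi> p\<bar>} \<subseteq> {p \<in> space (measure_pmf (ascent_pmf n t)). (\<epsilon> * real t) ^ 4 \<le> (mart n \<xi> p) ^ 4}"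
  proof clarsimp
    fix p assume "\<epsilon> * real t \<le> \<bar>mart n \<xi> p\<bar>"
    then have "(\<epsilon> * real t) ^ 4 \<le> \<bar>mart n \<xi> p\<bar> ^ 4" using \<epsilon> by (intro power_mono) auto
    then show "(\<epsilon> * real t) ^ 4 \<le> (mart n \<xi> p) ^ 4" by (simp add: power_even_abs)
  qed
  then have "measure (measure_pmf (ascent_pmf n t)) {p. \<epsilon> * real t \<le> \<bar>mart n \<xi> p\<bar>}
      \<le> measure (measure_pmf (ascent_pmf n t)) {p \<in> space (measure_pmf (ascent_pmf n t)). (\<epsilon> * real t) ^ 4 \<le> (mart n \<xi> p) ^ 4}"
    by (intro measure_pmf.finite_measure_mono) auto
  also have "\<dots> \<le> measure_pmf.expectation (ascent_pmf n t) (\<lambda>p. (mart n \<xi> p) ^ 4) / (\<epsilon> * real t) ^ 4"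
    by (intro integral_Markov_inequality_measure[where A = "{}"] pos integrable_measure_pmf_finite finite_set_ascent_pmf n) auto
  also have "\<dots> \<le> 176 * t\<^sup>2 / (\<epsilon> * real t) ^ 4"
    using mart_fourth_moment[OF n \<xi>, of t] pos by (intro divide_right_mono) auto
  also have "\<dots> = 176 / \<epsilon> ^ 4 * (1 / (real t)\<^sup>2)"
    using \<epsilon> t by (simp add: power_mult_distrib field_simps power2_eq_square power4_eq_xxxx)
  finally show ?thesis .
qed

section \<open>Signed permutations and wall midpoints\<close>

lemma signed_perm_iff: "signed_perm n u \<longleftrightarrow> length u = n \<and> abs ` set u = int ` {1..n}"
proof
  assume "length u = n \<and> abs ` set u = int ` {1..n}"
  then have len: "length (map abs u) = n" and set: "set (map abs u) = int ` {1..n}" by auto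
  have "distinct (map abs u)"
  proof (rule card_distinct)
    have "card (int ` {1..n}) = n" by (subst card_image) (auto intro: inj_on_of_nat)
    then show "card (set (map abs u)) = length (map abs u)" unfolding set len .
  qed
  then have "mset (map abs u) = mset_set (int ` {1..n})" by (metis mset_set_set set)
  moreover have "mset (map int [1..<Suc n]) = mset_set (set (map int [1..<Suc n]))"
    by (rule mset_set_set[symmetric]) (simp add: distinct_map del: upt_Suc)
  moreover have "set (map int [1..<Suc n]) = int ` {1..n}" by auto
  ultimately show "signed_perm n u" unfolding signed_perm_def by simp
qed (use signed_perm_length signed_perm_set in auto)

lemma signed_perm_distinct:
  assumes "signed_perm n u" "i < n" "j < n" "\<bar>u ! i\<bar> = \<bar>u ! j\<bar>"
  shows "i = j"
proof -
  have "mset (map abs u) = mset (map int [1..<Suc n])" using assms(1) by (simp add: signed_perm_def)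
  then have "distinct (map abs u)"
    by (metis distinct_map distinct_upt inj_on_of_nat mset_eq_imp_distinct_iff)
  then show ?thesis using assms signed_perm_length[OF assms(1)] by (simp add: distinct_conv_nth) (metis nth_map)
qed

text \<open>
  Half of \<open>\<rho> + s\<^sub>i \<rho>\<close> on the scale where \<open>\<rho>\<close> has coordinates \<open>2 a\<close>: the coordinates of a point on
  the \<open>i\<close>-th wall of the fundamental alcove, midway between the centre and its mirror image. The
  full period \<open>1\<close> is \<open>4 n + 4\<close> on this scale.
\<close>

definition midpoint_coord :: "int \<Rightarrow> int \<Rightarrow> int \<Rightarrow> int" where
  "midpoint_coord n i a = 2 * a + (if i = 0 then (if a = 1 then - 2 else 0)
      else if i = n then (if a = n then 2 else 0)
      else if a = i then 1 else if a = i + 1 then - 1 else 0)"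

text \<open>
  The modulus of the coordinate is injective except for the pair of neighbours that the wall
  identifies, and reaches the ends \<open>0\<close> and \<open>2 n + 2\<close> only on the two end walls. So two
  coordinates with signs add up to a multiple of the period only in the way dictated by the wall.
\<close>

lemma midpoint_integrality:
  fixes n i v w k :: int
  assumes i: "0 \<le> i" "i \<le> n" and v: "1 \<le> \<bar>v\<bar>" "\<bar>v\<bar> \<le> n" and w: "1 \<le> \<bar>w\<bar>" "\<bar>w\<bar> \<le> n" and vw: "v + w \<noteq> 0"
    and eq: "sgn v * midpoint_coord n i \<bar>v\<bar> + sgn w * midpoint_coord n i \<bar>w\<bar> = (4 * n + 4) * k"
  shows "(i = 0 \<and> v = w \<and> \<bar>v\<bar> = 1 \<and> k = 0) \<or> (i = n \<and> v = w \<and> v = n * k \<and> \<bar>k\<bar> = 1)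
     \<or> (0 < i \<and> i < n \<and> k = 0 \<and> ((v = i \<and> w = - i - 1) \<or> (v = - i \<and> w = i + 1) \<or> (w = i \<and> v = - i - 1) \<or> (w = - i \<and> v = i + 1)))"
proof -
  let ?p = "midpoint_coord n i"
  have bound: "0 \<le> ?p a \<and> ?p a \<le> 2 * n + 2 \<and> (?p a = 2 * n + 2 \<longrightarrow> i = n \<and> 0 < i \<and> a = n)
      \<and> (?p a = 0 \<longrightarrow> i = 0 \<and> a = 1)" if "1 \<le> a" "a \<le> n" for a
    using that i by (simp add: midpoint_coord_def)
  have inj: "a = b \<or> (0 < i \<and> i < n \<and> (a = i \<and> b = i + 1 \<or> a = i + 1 \<and> b = i))"
    if "1 \<le> a" "a \<le> n" "1 \<le> b" "b \<le> n" "?p a = ?p b" for a b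
    using that i unfolding midpoint_coord_def by (auto split: if_splits)
  have sg: "\<exists>s a. (s = 1 \<or> s = - 1) \<and> x = s * a \<and> sgn x = s \<and> \<bar>x\<bar> = a" if "1 \<le> \<bar>x\<bar>" for x :: int
    using that by (intro exI[of _ "sgn x"] exI[of _ "\<bar>x\<bar>"]) (auto simp: sgn_if)
  obtain s a where s: "s = 1 \<or> s = - 1" "v = s * a" "sgn v = s" "\<bar>v\<bar> = a" using sg[OF v(1)] by blast
  obtain t b where t: "t = 1 \<or> t = - 1" "w = t * b" "sgn w = t" "\<bar>w\<bar> = b" using sg[OF w(1)] by blast
  have ab: "1 \<le> a" "a \<le> n" "1 \<le> b" "b \<le> n" using v w s(4) t(4) by auto
  obtain P Q where PQ: "P = ?p a" "Q = ?p b" by blast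
  note ba = bound[OF ab(1,2), folded PQ] and bb = bound[OF ab(3,4), folded PQ]
  have le: "0 \<le> P" "P \<le> 2 * n + 2" "0 \<le> Q" "Q \<le> 2 * n + 2" using ba bb by blast+
  have eq': "s * P + t * Q = (4 * n + 4) * k" using eq s(3,4) t(3,4) PQ by simp
  have "\<bar>s * P + t * Q\<bar> \<le> P + Q" using s(1) t(1) le by (elim disjE) simp_all
  also have "P + Q \<le> (4 * n + 4) * 1" using le by simp
  finally have "\<bar>(4 * n + 4) * k\<bar> \<le> (4 * n + 4) * 1" unfolding eq' .
  then have "(4 * n + 4) * \<bar>k\<bar> \<le> (4 * n + 4) * 1" using i by (simp add: abs_mult)
  then have "\<bar>k\<bar> \<le> 1" using i by (subst (asm) mult_le_cancel_left_pos) auto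
  then consider "k = 0" | "k = 1" | "k = - 1" by linarith
  then show ?thesis
  proof cases
    case 1
    then have z: "s * P + t * Q = 0" using eq' by simp
    show ?thesis
    proof (cases "P = 0")
      case True
      with z t(1) have "Q = 0" by auto
      with True ba bb have "i = 0" "a = 1" "b = 1" by auto
      then show ?thesis using vw 1 s(1,2) t(1,2) by (elim disjE) simp_all
    next
      case False
      then have "0 < P" using le by linarith
      then have "s = - t \<and> P = Q" using s(1) t(1) z le by (elim disjE) simp_all
      then have "s = - t" "P = Q" by blast+
      moreover have "a \<noteq> b" using vw s(2) t(2) \<open>s = - t\<close> by auto
      ultimately have "0 < i" "i < n" "a = i \<and> b = i + 1 \<or> a = i + 1 \<and> b = i"
        using inj[OF ab] PQ by blast+
      then show ?thesis using \<open>s = - t\<close> t(1) s(2) t(2) 1 by (elim disjE) simp_all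
    qed
  next
    case 2
    then have "s * P + t * Q = 4 * n + 4" using eq' by simp
    then have "s = 1 \<and> t = 1 \<and> P = 2 * n + 2 \<and> Q = 2 * n + 2"
      using s(1) t(1) le i by (elim disjE) simp_all
    then have "i = n" "a = n" "b = n" using ba bb by blast+
    then show ?thesis using \<open>s = 1 \<and> t = 1 \<and> P = 2 * n + 2 \<and> Q = 2 * n + 2\<close> s(2) t(2) 2 by simp
  next
    case 3
    then have "s * P + t * Q = - (4 * n + 4)" using eq' by simp
    then have "s = - 1 \<and> t = - 1 \<and> P = 2 * n + 2 \<and> Q = 2 * n + 2"
      using s(1) t(1) le i by (elim disjE) simp_all
    then have "i = n" "a = n" "b = n" using ba bb by blast+
    then show ?thesis using \<open>s = - 1 \<and> t = - 1 \<and> P = 2 * n + 2 \<and> Q = 2 * n + 2\<close> s(2) t(2) 3 by simp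
  qed
qed

section \<open>Roots, chambers and cells\<close>

text \<open>
  The rank is a parameter equal to the dimension, so that words and histories, which are indexed by
  numbers, can refer to it without mentioning the index type.
\<close>

locale coordinates =
  fixes e :: "nat \<Rightarrow> real ^ 'n" and n :: nat
  assumes bij': "bij_betw e {1..CARD('n)} Basis" and n_eq: "n = CARD('n)"
begin

abbreviation "A\<^sub>0 \<equiv> fundamental_alcove e"
abbreviation "C\<^sub>0 \<equiv> identity_chamber e"

lemma n_pos: "0 < n" by (simp add: n_eq)

lemma bij: "bij_betw e {1..n} Basis" using bij' n_eq by simp

text \<open>
  Labels are the nonzero integers of modulus at most \<open>n\<close>, and a negative label stands for the
  opposite basis vector.
\<close>

definition axis :: "int \<Rightarrow> real ^ 'n" where
  "axis v = (if 0 < v then e (nat v) else - e (nat (- v)))"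

definition label :: "int \<Rightarrow> bool" where
  "label v \<longleftrightarrow> 1 \<le> \<bar>v\<bar> \<and> \<bar>v\<bar> \<le> int n"

lemma label_minus [simp]: "label (- v) \<longleftrightarrow> label v"
  by (simp add: label_def)

lemma axis_minus: "label v \<Longrightarrow> axis (- v) = - axis v"
  by (auto simp: axis_def label_def)

lemma axis_int: "1 \<le> i \<Longrightarrow> axis (int i) = e i"
  by (simp add: axis_def)

lemma inner_e: "1 \<le> i \<Longrightarrow> i \<le> n \<Longrightarrow> 1 \<le> j \<Longrightarrow> j \<le> n \<Longrightarrow> e i \<bullet> e j = (if i = j then 1 else 0)"
  using bij_betwE[OF bij] inj_onD[OF bij_betw_imp_inj_on[OF bij], of i j]
  by (auto simp: inner_same_Basis intro!: inner_not_same_Basis)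

lemma inner_axis:
  "label v \<Longrightarrow> label w \<Longrightarrow> axis v \<bullet> axis w = (if v = w then 1 else if v = - w then - 1 else 0)"
  by (auto simp: axis_def label_def inner_e nat_eq_iff2 split: if_splits)

lemma eq_if_inner_e:
  assumes "\<And>i. 1 \<le> i \<Longrightarrow> i \<le> n \<Longrightarrow> x \<bullet> e i = y \<bullet> e i"
  shows "x = y"
proof (rule euclidean_eqI)
  fix b :: "real ^ 'n" assume "b \<in> Basis"
  then obtain i where "i \<in> {1..n}" "b = e i" using bij unfolding bij_betw_def by blast
  then show "x \<bullet> b = y \<bullet> b" using assms by auto
qed

lemma label_cases:
  assumes "label v"
  obtains i where "1 \<le> i" "i \<le> n" "v = int i" | i where "1 \<le> i" "i \<le> n" "v = - int i"
proof (cases "0 < v")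
  case True
  then show ?thesis using assms that(1)[of "nat v"] by (auto simp: label_def)
next
  case False
  then show ?thesis using assms that(2)[of "nat (- v)"] by (auto simp: label_def)
qed

lemma label_int: "1 \<le> i \<Longrightarrow> i \<le> n \<Longrightarrow> label (int i)"
  by (simp add: label_def)

text \<open>
  With signed labels all roots have one shape, the long ones being the case \<open>v = w\<close>. A root is
  positive if and only if \<open>v + w > 0\<close>.
\<close>

lemma roots_eq: "roots e = {axis v + axis w | v w. label v \<and> label w \<and> v + w \<noteq> 0}"
proof (intro equalityI subsetI)
  have sgn: "\<exists>v. label v \<and> axis v = \<sigma> *\<^sub>R e i \<and> \<bar>v\<bar> = int i" if "\<sigma> \<in> {- 1, 1}" "1 \<le> i" "i \<le> n" for \<sigma> i
  proof (cases "\<sigma> = 1")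
    case True
    then show ?thesis using that by (intro exI[of _ "int i"]) (auto simp: label_int axis_int)
  next
    case False
    then show ?thesis using that by (intro exI[of _ "- int i"]) (auto simp: label_int axis_int axis_minus)
  qed
  fix \<alpha> assume "\<alpha> \<in> roots e"
  then consider \<sigma> \<tau> i j where "\<alpha> = \<sigma> *\<^sub>R e i + \<tau> *\<^sub>R e j" "\<sigma> \<in> {- 1, 1}" "\<tau> \<in> {- 1, 1}" "1 \<le> i" "i < j" "j \<le> n"
    | \<sigma> i where "\<alpha> = (2 * \<sigma>) *\<^sub>R e i" "\<sigma> \<in> {- 1, 1}" "1 \<le> i" "i \<le> n"
    unfolding roots_def n_eq[symmetric] by blast
  then show "\<alpha> \<in> {axis v + axis w | v w. label v \<and> label w \<and> v + w \<noteq> 0}"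
  proof cases
    case 1
    then obtain v w where "label v" "axis v = \<sigma> *\<^sub>R e i" "\<bar>v\<bar> = int i" "label w" "axis w = \<tau> *\<^sub>R e j" "\<bar>w\<bar> = int j"
      using sgn[of \<sigma> i] sgn[of \<tau> j] by fastforce
    moreover from this 1 have "v + w \<noteq> 0" by linarith
    moreover have "\<alpha> = axis v + axis w" using 1(1) calculation by simp
    ultimately show ?thesis by blast
  next
    case 2
    then obtain v where "label v" "axis v = \<sigma> *\<^sub>R e i" using sgn[of \<sigma> i] by fastforce
    then show ?thesis using 2 by (auto simp: label_def scaleR_2 simp flip: scaleR_scaleR intro!: exI[of _ v])
  qed
next
  fix \<alpha> assume "\<alpha> \<in> {axis v + axis w | v w. label v \<and> label w \<and> v + w \<noteq> 0}"
  then obtain v w where vw: "\<alpha> = axis v + axis w" "label v" "label w" "v + w \<noteq> 0" by blast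
  have sgn: "\<exists>\<sigma>. \<sigma> \<in> {- 1, 1} \<and> axis v = \<sigma> *\<^sub>R e (nat \<bar>v\<bar>)" for v
    by (cases "0 < v") (auto simp: axis_def)
  obtain \<sigma> \<tau> where st: "\<sigma> \<in> {- 1, 1}" "axis v = \<sigma> *\<^sub>R e (nat \<bar>v\<bar>)" "\<tau> \<in> {- 1, 1}" "axis w = \<tau> *\<^sub>R e (nat \<bar>w\<bar>)"
    using sgn[of v] sgn[of w] by blast
  have r: "1 \<le> nat \<bar>v\<bar>" "nat \<bar>v\<bar> \<le> n" "1 \<le> nat \<bar>w\<bar>" "nat \<bar>w\<bar> \<le> n" using vw by (auto simp: label_def)
  consider "nat \<bar>v\<bar> < nat \<bar>w\<bar>" | "nat \<bar>w\<bar> < nat \<bar>v\<bar>" | "\<bar>v\<bar> = \<bar>w\<bar>" by linarith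
  then show "\<alpha> \<in> roots e"
  proof cases
    case 1
    have "\<alpha> = \<sigma> *\<^sub>R e (nat \<bar>v\<bar>) + \<tau> *\<^sub>R e (nat \<bar>w\<bar>)" using vw st by simp
    then show ?thesis unfolding roots_def n_eq[symmetric] using st(1,3) r 1 by blast
  next
    case 2
    then have "\<alpha> = \<tau> *\<^sub>R e (nat \<bar>w\<bar>) + \<sigma> *\<^sub>R e (nat \<bar>v\<bar>)" using vw st by simp
    then show ?thesis unfolding roots_def n_eq[symmetric] using st(1,3) r 2 by blast
  next
    case 3
    then have "v = w" using vw(4) by linarith
    then have "\<alpha> = axis v + axis v" using vw(1) by simp
    also have "\<dots> = (2 * \<sigma>) *\<^sub>R e (nat \<bar>v\<bar>)" unfolding st(2) by (simp flip: scaleR_left_distrib)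
    finally have "\<alpha> = (2 * \<sigma>) *\<^sub>R e (nat \<bar>v\<bar>)" .
    then show ?thesis unfolding roots_def n_eq[symmetric] using st(1) r by blast
  qed
qed

lemma A0_iff:
  "x \<in> A\<^sub>0 \<longleftrightarrow> 0 < x \<bullet> e 1 \<and> (\<forall>i. 1 \<le> i \<longrightarrow> i < n \<longrightarrow> x \<bullet> e i < x \<bullet> e (Suc i)) \<and> x \<bullet> e n < 1 / 2"
proof -
  have "(\<forall>i<n. 0 < x \<bullet> simple_root e i) \<longleftrightarrow> 0 < x \<bullet> simple_root e 0 \<and> (\<forall>i. 1 \<le> i \<longrightarrow> i < n \<longrightarrow> 0 < x \<bullet> simple_root e i)"
    using n_pos by (metis One_nat_def Suc_leI bot_nat_0.not_eq_extremum)
  then show ?thesis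
    by (auto simp: fundamental_alcove_def n_eq[symmetric] simple_root_def highest_root_def inner_diff_right)
qed

lemma chamber_iff:
  "x \<in> C\<^sub>0 \<longleftrightarrow> 0 < x \<bullet> e 1 \<and> (\<forall>i. 1 \<le> i \<longrightarrow> i < n \<longrightarrow> x \<bullet> e i < x \<bullet> e (Suc i))"
proof -
  have "(\<forall>i<n. 0 < x \<bullet> simple_root e i) \<longleftrightarrow> 0 < x \<bullet> simple_root e 0 \<and> (\<forall>i. 1 \<le> i \<longrightarrow> i < n \<longrightarrow> 0 < x \<bullet> simple_root e i)"
    using n_pos by (metis One_nat_def Suc_leI bot_nat_0.not_eq_extremum)
  then show ?thesis
    by (auto simp: identity_chamber_def n_eq[symmetric] simple_root_def inner_diff_right)
qed

text \<open>
  In the identity chamber the linear order of the labels is the order of the values. This single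
  fact contains the signs of all roots.
\<close>

lemma chamber_axis_mono:
  assumes x: "x \<in> C\<^sub>0" and vw: "label v" "label w" "v < w"
  shows "x \<bullet> axis v < x \<bullet> axis w"
proof -
  have inc: "x \<bullet> e i < x \<bullet> e j" if "1 \<le> i" "i < j" "j \<le> n" for i j
    using that(2,3)
  proof (induction j)
    case (Suc j)
    have "x \<bullet> e j < x \<bullet> e (Suc j)" using x Suc.prems that(1) by (simp add: chamber_iff)
    then show ?case using Suc by (cases "i = j") auto
  qed simp
  have pos: "0 < x \<bullet> e i" if "1 \<le> i" "i \<le> n" for i
    using x inc[of 1 i] that by (cases "i = 1") (auto simp: chamber_iff)
  from vw(1) show ?thesis
  proof (cases rule: label_cases)
    case (1 i)
    from vw(2) show ?thesis
      by (cases rule: label_cases) (use 1 vw(3) inc in \<open>auto simp: axis_int\<close>)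
  next
    case (2 i)
    then have i: "axis v = - e i" by (simp add: axis_minus label_int axis_int)
    from vw(2) show ?thesis
    proof (cases rule: label_cases)
      case (1 j)
      then show ?thesis using i pos[of i] pos[of j] 2 by (simp add: axis_int)
    next
      case (2 j)
      then have "axis w = - e j" by (simp add: axis_minus label_int axis_int)
      then show ?thesis using i inc[of j i] 2 \<open>v = - int i\<close> vw(3) \<open>i \<le> n\<close> by simp
    qed
  qed
qed

lemma A0_subset_chamber: "A\<^sub>0 \<subseteq> C\<^sub>0"
  by (auto simp: A0_iff chamber_iff)

lemma chamber_root_pos:
  assumes "x \<in> C\<^sub>0" "label v" "label w" "0 < v + w"
  shows "0 < x \<bullet> (axis v + axis w)"
  using chamber_axis_mono[OF assms(1), of "- w" v] assms by (simp add: axis_minus inner_add_right)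

lemma chamber_root_neg:
  assumes "x \<in> C\<^sub>0" "label v" "label w" "v + w < 0"
  shows "x \<bullet> (axis v + axis w) < 0"
  using chamber_axis_mono[OF assms(1), of v "- w"] assms by (simp add: axis_minus inner_add_right)

lemma A0_axis_bound:
  assumes x: "x \<in> A\<^sub>0" and v: "label v"
  shows "\<bar>x \<bullet> axis v\<bar> < 1 / 2"
proof -
  have C: "x \<in> C\<^sub>0" using x A0_subset_chamber by auto
  have n: "label (int n)" "axis (int n) = e n" using n_pos by (auto simp: label_int axis_int)
  have "x \<bullet> e n < 1 / 2" using x by (simp add: A0_iff)
  moreover have "x \<bullet> axis v \<le> x \<bullet> e n" if "label v" for v
    using chamber_axis_mono[OF C that n(1)] that n by (cases "v = int n") (auto simp: label_def less_imp_le)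
  ultimately have "x \<bullet> axis w < 1 / 2" if "label w" for w using that by (meson le_less_trans)
  from this[of v] this[of "- v"] show ?thesis using v by (simp add: axis_minus abs_less_iff)
qed

text \<open>
  On the fundamental alcove every root has values in \<open>(- 1, 1)\<close> and a constant sign, so no
  hyperplane meets it.
\<close>

lemma A0_same_side:
  assumes "x \<in> A\<^sub>0" "y \<in> A\<^sub>0" "label v" "label w" "v + w \<noteq> 0"
  shows "0 < (x \<bullet> (axis v + axis w) - of_int k) * (y \<bullet> (axis v + axis w) - of_int k)"
proof -
  have b: "\<bar>z \<bullet> (axis v + axis w)\<bar> < 1" if "z \<in> A\<^sub>0" for z
    using A0_axis_bound[OF that, of v] A0_axis_bound[OF that, of w] assms by (simp add: inner_add_right)
  consider "1 \<le> k" | "k \<le> - 1" | "k = 0" by linarith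
  then show ?thesis
  proof cases
    case 1
    then have "1 \<le> real_of_int k" by simp
    then show ?thesis using b[OF assms(1)] b[OF assms(2)] by (intro mult_neg_neg) auto
  next
    case 2
    then have "real_of_int k \<le> - 1" by (metis of_int_1 of_int_le_iff of_int_minus)
    then show ?thesis using b[OF assms(1)] b[OF assms(2)] by (intro mult_pos_pos) auto
  next
    case 3
    have "x \<in> C\<^sub>0" "y \<in> C\<^sub>0" using assms A0_subset_chamber by auto
    then show ?thesis
      using 3 chamber_root_pos[of _ v w] chamber_root_neg[of _ v w] assms
      by (cases "0 < v + w") (auto intro: mult_pos_pos mult_neg_neg)
  qed
qed

text \<open>
  The points that no hyperplane separates from \<open>p\<close>. Alcoves are defined as topological components;
  cells give the same sets by inequalities.
\<close>

definition cell :: "real ^ 'n \<Rightarrow> (real ^ 'n) set" where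
  "cell p = {z. \<forall>\<alpha>\<in>roots e. \<forall>k::int. 0 < (z \<bullet> \<alpha> - k) * (p \<bullet> \<alpha> - k)}"

definition regular :: "(real ^ 'n) set" where
  "regular = UNIV - (\<Union>\<alpha>\<in>roots e. \<Union>k. hyperplane \<alpha> k)"

lemma regular_iff: "p \<in> regular \<longleftrightarrow> (\<forall>\<alpha>\<in>roots e. \<forall>k::int. p \<bullet> \<alpha> \<noteq> k)"
  by (auto simp: regular_def hyperplane_def)

lemma cell_convex: "convex (cell p)"
proof -
  have "cell p = (\<Inter>\<alpha>\<in>roots e. \<Inter>k::int. {z. 0 < (z \<bullet> \<alpha> - k) * (p \<bullet> \<alpha> - k)})"
    by (auto simp: cell_def)
  moreover have "convex {z. 0 < (z \<bullet> \<alpha> - k) * (p \<bullet> \<alpha> - k)}" for \<alpha> :: "real ^ 'n" and k :: real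
  proof -
    have "{z. 0 < (z \<bullet> \<alpha> - k) * (p \<bullet> \<alpha> - k)} = {z. ((p \<bullet> \<alpha> - k) *\<^sub>R \<alpha>) \<bullet> z > k * (p \<bullet> \<alpha> - k)}"
      by (auto simp: algebra_simps inner_commute)
    then show ?thesis using convex_halfspace_gt[of "k * (p \<bullet> \<alpha> - k)" "(p \<bullet> \<alpha> - k) *\<^sub>R \<alpha>"] by simp
  qed
  ultimately show ?thesis by (auto intro!: convex_INT)
qed

text \<open>
  Cells are convex, hence connected; conversely a connected set that avoids a hyperplane
  stays on one side of it.
\<close>

lemma cell_eq_component:
  assumes "p \<in> regular"
  shows "cell p = connected_component_set regular p"
proof
  have "p \<in> cell p" unfolding cell_def
  proof (clarify)
    fix \<alpha> and k :: int assume "\<alpha> \<in> roots e"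
    then have "p \<bullet> \<alpha> - k \<noteq> 0" using assms unfolding regular_iff by auto
    then show "0 < (p \<bullet> \<alpha> - k) * (p \<bullet> \<alpha> - k)" using not_real_square_gt_zero by blast
  qed
  moreover have "cell p \<subseteq> regular"
  proof
    fix z assume z: "z \<in> cell p"
    show "z \<in> regular" unfolding regular_iff
    proof (intro ballI allI notI)
      fix \<alpha> and k :: int assume "\<alpha> \<in> roots e" "z \<bullet> \<alpha> = k"
      moreover from this z have "0 < (z \<bullet> \<alpha> - k) * (p \<bullet> \<alpha> - k)" unfolding cell_def by blast
      ultimately show False by simp
    qed
  qed
  ultimately show "cell p \<subseteq> connected_component_set regular p"
    using cell_convex by (intro connected_component_maximal convex_connected) auto
  show "connected_component_set regular p \<subseteq> cell p"
  proof (clarsimp simp: cell_def)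
    fix z \<alpha> and k :: int
    assume z: "connected_component regular p z" and \<alpha>: "\<alpha> \<in> roots e"
    let ?S = "connected_component_set regular p"
    have S: "connected ?S" "p \<in> ?S" "z \<in> ?S" "?S \<subseteq> regular"
      using z assms connected_component_subset by (auto simp: connected_component_refl_eq)
    then have ne: "y \<bullet> \<alpha> \<noteq> k" if "y \<in> ?S" for y
      using that \<alpha> unfolding regular_iff by (meson regular_iff subsetD)
    show "0 < (z \<bullet> \<alpha> - k) * (p \<bullet> \<alpha> - k)"
    proof (rule ccontr)
      assume "\<not> ?thesis"
      then have "(z \<bullet> \<alpha> \<le> k \<and> k \<le> p \<bullet> \<alpha>) \<or> (p \<bullet> \<alpha> \<le> k \<and> k \<le> z \<bullet> \<alpha>)"
        by (simp add: zero_less_mult_iff) linarith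
      then have "\<exists>y\<in>?S. \<alpha> \<bullet> y = k"
        using connected_ivt_hyperplane[OF S(1) S(2) S(3), of \<alpha> k] connected_ivt_hyperplane[OF S(1) S(3) S(2), of \<alpha> k]
        by (auto simp: inner_commute)
      then show False using ne by (auto simp: inner_commute)
    qed
  qed
qed

lemma alcoves_eq_cell:
  assumes "B \<in> alcoves e" "p \<in> B"
  shows "B = cell p" "p \<in> regular"
proof -
  obtain q where q: "q \<in> regular" "B = connected_component_set regular q"
    using assms(1) unfolding alcoves_def regular_def[symmetric] by (rule componentsE)
  then show p: "p \<in> regular" using assms(2) connected_component_in by auto
  show "B = cell p"
    unfolding cell_eq_component[OF p] using q assms(2) connected_component_eq by blast
qed

lemma cell_in_alcoves: "p \<in> regular \<Longrightarrow> cell p \<in> alcoves e"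
  unfolding alcoves_def regular_def[symmetric] cell_eq_component by (rule componentsI)

lemma finite_roots: "finite (roots e)"
proof (rule finite_subset)
  show "roots e \<subseteq> (\<lambda>(v, w). axis v + axis w) ` ({- int n..int n} \<times> {- int n..int n})"
    by (force simp: roots_eq label_def)
qed auto

lemma open_regular: "open regular"
proof -
  have "regular = (\<Inter>\<alpha>\<in>roots e. (\<lambda>p. p \<bullet> \<alpha>) -` (- \<int>))"
    unfolding regular_iff[abs_def] set_eq_iff regular_iff by (auto simp: Ints_def image_iff)
  moreover have "open ((\<lambda>p. p \<bullet> \<alpha>) -` (- \<int>))" for \<alpha> :: "real ^ 'n"
    by (intro open_vimage continuous_intros) (simp add: closed_Ints open_Compl)
  ultimately show ?thesis using finite_roots by (simp add: open_INT)
qed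

lemma countable_alcoves: "countable (alcoves e)"
proof (rule countable_disjoint_open_subsets)
  show "open S" if "S \<in> alcoves e" for S
    using that open_components[OF open_regular] unfolding alcoves_def regular_def by blast
  show "pairwise disjnt (alcoves e)"
    using pairwise_disjoint_components unfolding alcoves_def pairwise_def disjnt_def by blast
qed

lemma alcove_nonempty: "B \<in> alcoves e \<Longrightarrow> B \<noteq> {}"
  unfolding alcoves_def by (rule in_components_nonempty)

text \<open>
  A point of the closure that is off a hyperplane lies on the side of the alcove.
\<close>

lemma closure_side:
  assumes "B \<in> alcoves e" "b \<in> B" "q \<in> closure B" "\<alpha> \<in> roots e" "q \<bullet> \<alpha> \<noteq> of_int k"
  shows "0 < (b \<bullet> \<alpha> - of_int k) * (q \<bullet> \<alpha> - of_int k)"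
proof -
  have B: "B = cell b" by (rule alcoves_eq_cell(1)[OF assms(1,2)])
  then have "B \<subseteq> {z. 0 \<le> (b \<bullet> \<alpha> - k) * (z \<bullet> \<alpha> - k)}"
    using assms(4) by (auto simp: cell_def mult.commute less_imp_le)
  moreover have "closed {z. 0 \<le> (b \<bullet> \<alpha> - k) * (z \<bullet> \<alpha> - k)}"
    by (intro closed_Collect_le continuous_intros)
  ultimately have "0 \<le> (b \<bullet> \<alpha> - k) * (q \<bullet> \<alpha> - k)"
    using assms(3) closure_minimal by blast
  moreover have "b \<bullet> \<alpha> \<noteq> k" using alcoves_eq_cell(2)[OF assms(1,2)] assms(4) by (auto simp: regular_iff)
  ultimately show ?thesis using assms(5) by (simp add: less_le)
qed

section \<open>The affine Weyl group as words with translations\<close>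

text \<open>
  The affine map with linear part the signed permutation matrix of the word \<open>u\<close> and translation
  part \<open>c\<close>. The affine Weyl group consists of these maps with \<open>c\<close> in the integer lattice.
\<close>

definition place :: "int list \<Rightarrow> real ^ 'n \<Rightarrow> real ^ 'n \<Rightarrow> real ^ 'n" where
  "place u c x = c + (\<Sum>j<n. (x \<bullet> e (Suc j)) *\<^sub>R axis (u ! j))"

definition lattice :: "real ^ 'n \<Rightarrow> bool" where
  "lattice c \<longleftrightarrow> (\<forall>v. label v \<longrightarrow> c \<bullet> axis v \<in> \<int>)"

lemma inner_sum_e:
  assumes "1 \<le> i" "i \<le> n"
  shows "(\<Sum>j<n. f j *\<^sub>R e (Suc j)) \<bullet> e i = f (i - 1)"
proof -
  have "(\<Sum>j<n. f j *\<^sub>R e (Suc j)) \<bullet> e i = (\<Sum>j<n. if i - 1 = j then f j else 0)"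
    unfolding inner_sum_left using assms by (intro sum.cong HOL.refl) (auto simp: inner_e)
  then show ?thesis using assms by (auto simp: sum.delta')
qed

lemma label_nth: "signed_perm n u \<Longrightarrow> j < n \<Longrightarrow> label (u ! j)"
proof -
  assume "signed_perm n u" "j < n"
  then have "\<bar>u ! j\<bar> \<in> int ` {1..n}"
    using signed_perm_iff[of n u] by (metis image_eqI nth_mem)
  then show ?thesis by (auto simp: label_def)
qed

lemma label_index:
  assumes "signed_perm n u" "label v"
  obtains j where "j < n" "v = u ! j" | j where "j < n" "v = - u ! j"
proof -
  have "\<bar>v\<bar> \<in> int ` {1..n}" using assms(2) by (auto simp: label_def image_iff intro!: bexI[of _ "nat \<bar>v\<bar>"])
  then obtain l where "l \<in> set u" "\<bar>v\<bar> = \<bar>l\<bar>" using assms(1) unfolding signed_perm_iff by (metis imageE)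
  then show ?thesis using that assms(1) unfolding signed_perm_iff in_set_conv_nth by (metis abs_eq_iff)
qed

lemma inner_axis_nth:
  assumes "signed_perm n u" "i < n" "j < n"
  shows "axis (u ! i) \<bullet> axis (u ! j) = (if i = j then 1 else 0)"
proof -
  have "u ! i = u ! j \<longleftrightarrow> i = j" "u ! i \<noteq> - u ! j"
    using signed_perm_distinct[OF assms] label_nth[OF assms(1), of i] assms by (auto simp: label_def)
  then show ?thesis using inner_axis label_nth assms by auto
qed

lemma inner_place:
  assumes "signed_perm n u" "i < n"
  shows "place u c x \<bullet> axis (u ! i) = c \<bullet> axis (u ! i) + x \<bullet> e (Suc i)"
proof -
  have "(\<Sum>j<n. ((x \<bullet> e (Suc j)) *\<^sub>R axis (u ! j)) \<bullet> axis (u ! i)) = (\<Sum>j<n. if i = j then x \<bullet> e (Suc j) else 0)"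
    using assms by (intro sum.cong HOL.refl) (auto simp: inner_axis_nth)
  then show ?thesis using assms(2) by (simp add: place_def inner_add_left inner_sum_left)
qed

lemma eq_if_inner_word:
  assumes "signed_perm n u" "\<And>j. j < n \<Longrightarrow> x \<bullet> axis (u ! j) = y \<bullet> axis (u ! j)"
  shows "x = y"
proof (rule eq_if_inner_e)
  fix i assume "1 \<le> i" "i \<le> n"
  then have "label (int i)" "axis (int i) = e i" by (auto simp: label_int axis_int)
  from label_index[OF assms(1) this(1)] show "x \<bullet> e i = y \<bullet> e i"
  proof cases
    case (1 j)
    then show ?thesis using assms(2)[of j] \<open>axis (int i) = e i\<close> by simp
  next
    case (2 j)
    then have "e i = - axis (u ! j)" using axis_minus[OF label_nth[OF assms(1), of j]] \<open>axis (int i) = e i\<close> by simp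
    then show ?thesis using assms(2)[of j] 2(1) by simp
  qed
qed

lemma pull_label:
  assumes u: "signed_perm n u" and v: "label v"
  obtains v' j where "label v'" "j < n" "v' = int (Suc j) \<and> v = u ! j \<or> v' = - int (Suc j) \<and> v = - u ! j"
    "\<forall>x c. (place u c x - c) \<bullet> axis v = x \<bullet> axis v'"
proof -
  from label_index[OF u v] show thesis
  proof cases
    case (1 j)
    then show ?thesis
      using that[of "int (Suc j)" j] inner_place[OF u, of j]
      by (simp add: label_int axis_int inner_diff_left del: of_nat_Suc)
  next
    case (2 j)
    then show ?thesis
      using that[of "- int (Suc j)" j] inner_place[OF u, of j] label_nth[OF u, of j]
      by (simp add: label_int axis_int axis_minus inner_diff_left del: of_nat_Suc)
  qed
qed

text \<open>
  Pulling a root back along \<open>place u c\<close> gives a root again.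
\<close>

lemma pull_root:
  assumes u: "signed_perm n u" and \<alpha>: "\<alpha> \<in> roots e"
  obtains v w where "label v" "label w" "v + w \<noteq> 0" "\<forall>x c. (place u c x - c) \<bullet> \<alpha> = x \<bullet> (axis v + axis w)"
proof -
  obtain a b where ab: "\<alpha> = axis a + axis b" "label a" "label b" "a + b \<noteq> 0" using \<alpha> by (auto simp: roots_eq)
  obtain v j where v: "label v" "j < n" "v = int (Suc j) \<and> a = u ! j \<or> v = - int (Suc j) \<and> a = - u ! j"
    "\<forall>x c. (place u c x - c) \<bullet> axis a = x \<bullet> axis v" by (rule pull_label[OF u ab(2)])
  obtain w k where w: "label w" "k < n" "w = int (Suc k) \<and> b = u ! k \<or> w = - int (Suc k) \<and> b = - u ! k"
    "\<forall>x c. (place u c x - c) \<bullet> axis b = x \<bullet> axis w" by (rule pull_label[OF u ab(3)])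
  have "v + w \<noteq> 0" using v(3) w(3) ab(4) by auto
  moreover have "(place u c x - c) \<bullet> \<alpha> = x \<bullet> (axis v + axis w)" for x c
    using v(4) w(4) by (simp add: ab(1) inner_add_right)
  ultimately show ?thesis using that v(1) w(1) by blast
qed

lemma lattice_root:
  assumes "lattice c" "\<alpha> \<in> roots e"
  obtains k :: int where "c \<bullet> \<alpha> = of_int k"
proof -
  have "c \<bullet> \<alpha> \<in> \<int>" using assms unfolding lattice_def roots_eq by (auto simp: inner_add_right)
  then show ?thesis using that by (auto elim: Ints_cases)
qed

definition alcove :: "int list \<Rightarrow> real ^ 'n \<Rightarrow> (real ^ 'n) set" where
  "alcove u c = place u c ` A\<^sub>0"

lemma place_linear: "place u c x = c + place u 0 x"
  by (simp add: place_def)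

lemma linear_place0: "linear (place u 0)"
  by (rule linearI) (auto simp: place_def inner_add_left scaleR_add_left sum.distrib scaleR_sum_right)

lemma surj_place:
  assumes "signed_perm n u"
  obtains x where "place u c x = z"
proof -
  define x where "x = (\<Sum>j<n. ((z - c) \<bullet> axis (u ! j)) *\<^sub>R e (Suc j))"
  have "x \<bullet> e (Suc i) = (z - c) \<bullet> axis (u ! i)" if "i < n" for i
    using that inner_sum_e[of "Suc i"] by (simp add: x_def)
  then have "place u c x = z"
    using assms by (intro eq_if_inner_word[OF assms]) (simp add: inner_place inner_diff_left)
  then show ?thesis using that by blast
qed

lemma inj_place:
  assumes "signed_perm n u" "place u c x = place u c y"
  shows "x = y"
proof (rule eq_if_inner_e)
  fix i assume "1 \<le> i" "i \<le> n"
  then show "x \<bullet> e i = y \<bullet> e i"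
    using inner_place[OF assms(1), of "i - 1" c x] inner_place[OF assms(1), of "i - 1" c y] assms(2) by simp
qed

text \<open>
  The only point of the fundamental alcove whose coordinates are integers over \<open>2 n + 2\<close>.
\<close>

definition rho :: "real ^ 'n" where
  "rho = (\<Sum>j<n. (real (Suc j) / real (2 * n + 2)) *\<^sub>R e (Suc j))"

lemma inner_rho: "1 \<le> i \<Longrightarrow> i \<le> n \<Longrightarrow> rho \<bullet> e i = real i / real (2 * n + 2)"
  unfolding rho_def by (subst inner_sum_e) auto

lemma rho_in_A0: "rho \<in> A\<^sub>0"
  unfolding A0_iff using n_pos by (auto simp: inner_rho divide_strict_right_mono field_simps)

lemma simple_root_label:
  assumes "i < n"
  obtains v w where "label v" "label w" "v + w > 0" "simple_root e i = axis v + axis w"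
proof (cases "i = 0")
  case True
  then show ?thesis using that[of 1 1] n_pos by (auto simp: simple_root_def label_def axis_def scaleR_2)
next
  case False
  then show ?thesis using that[of "int (Suc i)" "- int i"] assms
    by (simp add: simple_root_def label_int axis_int axis_minus del: of_nat_Suc)
qed

lemma simple_root_in_roots: "i < n \<Longrightarrow> simple_root e i \<in> roots e"
  by (rule simple_root_label[of i]) (force simp: roots_eq)+

lemma alcove_same_side:
  assumes u: "signed_perm n u" and c: "lattice c" and p: "p \<in> alcove u c" and z: "z \<in> alcove u c"
    and \<alpha>: "\<alpha> \<in> roots e"
  shows "0 < (z \<bullet> \<alpha> - of_int k) * (p \<bullet> \<alpha> - of_int k)"
proof -
  obtain v w where vw: "label v" "label w" "v + w \<noteq> 0" "\<forall>x c. (place u c x - c) \<bullet> \<alpha> = x \<bullet> (axis v + axis w)"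
    by (rule pull_root[OF u \<alpha>])
  obtain m where m: "c \<bullet> \<alpha> = of_int m" by (rule lattice_root[OF c \<alpha>])
  obtain x y where "x \<in> A\<^sub>0" "p = place u c x" "y \<in> A\<^sub>0" "z = place u c y" using p z by (auto simp: alcove_def)
  then show ?thesis
    using A0_same_side[of y x v w "k - m"] vw m by (simp add: inner_diff_left algebra_simps)
qed

lemma alcove_regular: "signed_perm n u \<Longrightarrow> lattice c \<Longrightarrow> alcove u c \<subseteq> regular"
proof
  fix z assume *: "signed_perm n u" "lattice c" "z \<in> alcove u c"
  show "z \<in> regular" unfolding regular_iff
  proof (intro ballI allI notI)
    fix \<alpha> and k :: int assume "\<alpha> \<in> roots e" "z \<bullet> \<alpha> = k"
    with alcove_same_side[OF * *(3), of \<alpha> k] show False by simp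
  qed
qed

lemma alcove_eq_cell:
  assumes u: "signed_perm n u" and c: "lattice c" and p: "p \<in> alcove u c"
  shows "alcove u c = cell p"
proof
  show "alcove u c \<subseteq> cell p" using alcove_same_side[OF u c p] by (auto simp: cell_def)
  show "cell p \<subseteq> alcove u c"
  proof
    fix z assume z: "z \<in> cell p"
    obtain x where x: "place u c x = z" by (rule surj_place[OF u])
    obtain y where y: "y \<in> A\<^sub>0" "p = place u c y" using p by (auto simp: alcove_def)
    have side: "0 < (x \<bullet> e i - s * (x \<bullet> e j) - m) * (y \<bullet> e i - s * (y \<bullet> e j) - m)"
      if ij: "1 \<le> i" "i \<le> n" "1 \<le> j" "j \<le> n" and s: "s = 1 \<and> i \<noteq> j \<or> s = - 1" for i j s and m :: int
    proof -
      define \<alpha> where "\<alpha> = axis (u ! (i - 1)) - s *\<^sub>R axis (u ! (j - 1))"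
      have l: "label (u ! (i - 1))" "label (u ! (j - 1))" using ij label_nth[OF u] by auto
      have "\<alpha> \<in> roots e"
      proof (cases "s = 1")
        case True
        then have "i - 1 < n" "j - 1 < n" "i - 1 \<noteq> j - 1" using s ij by auto
        then have "u ! (i - 1) \<noteq> u ! (j - 1)" using signed_perm_distinct[OF u, of "i - 1" "j - 1"] by metis
        then show ?thesis using True l unfolding roots_eq \<alpha>_def
          by (intro CollectI exI[of _ "u ! (i - 1)"] exI[of _ "- u ! (j - 1)"]) (simp add: axis_minus)
      next
        case False
        then have "s = - 1" using s by auto
        moreover have "u ! (i - 1) + u ! (j - 1) \<noteq> 0"
        proof
          assume z: "u ! (i - 1) + u ! (j - 1) = 0"
          have "i - 1 < n" "j - 1 < n" using ij by auto
          moreover have "\<bar>u ! (i - 1)\<bar> = \<bar>u ! (j - 1)\<bar>" using z by linarith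
          ultimately have "i - 1 = j - 1" by (rule signed_perm_distinct[OF u])
          then show False using z l by (simp add: label_def)
        qed
        ultimately show ?thesis using l unfolding roots_eq \<alpha>_def
          by (intro CollectI exI[of _ "u ! (i - 1)"] exI[of _ "u ! (j - 1)"]) simp
      qed
      from this obtain l :: int where l: "c \<bullet> \<alpha> = l" using lattice_root[OF c] by blast
      have pl: "place u c x \<bullet> \<alpha> = c \<bullet> \<alpha> + (x \<bullet> e i - s * (x \<bullet> e j))" for x
        using ij inner_place[OF u, of "i - 1"] inner_place[OF u, of "j - 1"]
        by (simp add: \<alpha>_def inner_diff_right algebra_simps)
      have "0 < (z \<bullet> \<alpha> - of_int (l + m)) * (p \<bullet> \<alpha> - of_int (l + m))"
        using z \<open>\<alpha> \<in> roots e\<close> unfolding cell_def by blast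
      then have "0 < ((c \<bullet> \<alpha> + (x \<bullet> e i - s * (x \<bullet> e j))) - of_int (l + m)) * ((c \<bullet> \<alpha> + (y \<bullet> e i - s * (y \<bullet> e j))) - of_int (l + m))"
        unfolding pl[symmetric] x y(2) .
      then show ?thesis using l by simp
    qed
    have "x \<in> A\<^sub>0"
      unfolding A0_iff
    proof (intro conjI allI impI)
      show "0 < x \<bullet> e 1"
        using side[of 1 1 "- 1" 0] y(1) n_pos by (auto simp: A0_iff zero_less_mult_iff)
      show "x \<bullet> e n < 1 / 2"
        using side[of n n "- 1" 1] y(1) n_pos by (auto simp: A0_iff zero_less_mult_iff)
      fix i assume "1 \<le> i" "i < n"
      then show "x \<bullet> e i < x \<bullet> e (Suc i)"
        using side[of i "Suc i" 1 0] y(1) by (force simp: A0_iff zero_less_mult_iff)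
    qed
    then show "z \<in> alcove u c" using x by (auto simp: alcove_def)
  qed
qed

lemma center_in_alcove: "place u c rho \<in> alcove u c"
  using rho_in_A0 by (simp add: alcove_def)

lemma alcove_in_alcoves: "signed_perm n u \<Longrightarrow> lattice c \<Longrightarrow> alcove u c \<in> alcoves e"
  using alcove_eq_cell[OF _ _ center_in_alcove] alcove_regular[of u c] center_in_alcove[of u c] cell_in_alcoves by fastforce

text \<open>
  Simple transitivity. The image of \<open>\<rho>\<close> under one map is pulled back by the other to a point of
  the fundamental alcove with coordinates integral over \<open>2 n + 2\<close>, hence to \<open>\<rho>\<close>. Comparing
  coordinates modulo \<open>1\<close> then identifies both the labels and the translations.
\<close>

lemma alcove_inj:
  assumes u: "signed_perm n u" "lattice c" and u': "signed_perm n u'" "lattice c'" and eq: "alcove u c = alcove u' c'"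
  shows "u = u'" "c = c'"
proof -
  define N where "N = real (2 * n + 2)"
  have N: "N > 0" by (simp add: N_def)
  obtain x where x: "x \<in> A\<^sub>0" "place u c x = place u' c' rho"
    using eq center_in_alcove[of u' c'] unfolding alcove_def by (metis imageE)
  have int: "\<exists>m::int. N * (x \<bullet> e i) = m" if i: "1 \<le> i" "i \<le> n" for i
  proof -
    have l: "label (u ! (i - 1))" using label_nth[OF u(1)] i by simp
    obtain v' j where v': "label v'" "j < n"
      "v' = int (Suc j) \<and> u ! (i - 1) = u' ! j \<or> v' = - int (Suc j) \<and> u ! (i - 1) = - u' ! j"
      "\<forall>x c. (place u' c x - c) \<bullet> axis (u ! (i - 1)) = x \<bullet> axis v'"
      by (rule pull_label[OF u'(1) l])
    have "x \<bullet> e i = c' \<bullet> axis (u ! (i - 1)) + rho \<bullet> axis v' - c \<bullet> axis (u ! (i - 1))"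
      using v'(4)[rule_format, of c' rho] inner_place[OF u(1), of "i - 1" c x] i x(2) by (simp add: inner_diff_left)
    moreover have "N * (rho \<bullet> axis v') \<in> \<int>"
      using v' N by (auto simp: axis_int axis_minus label_int inner_rho N_def simp del: of_nat_Suc)
    moreover have "N * (c' \<bullet> axis (u ! (i - 1))) \<in> \<int>" "N * (c \<bullet> axis (u ! (i - 1))) \<in> \<int>"
      using u(2) u'(2) l by (auto simp: lattice_def N_def intro!: Ints_mult)
    ultimately have "N * (x \<bullet> e i) \<in> \<int>" by (simp add: distrib_left right_diff_distrib)
    then show ?thesis by (auto elim: Ints_cases)
  qed
  then obtain m :: "nat \<Rightarrow> int" where m: "\<And>i. 1 \<le> i \<Longrightarrow> i \<le> n \<Longrightarrow> N * (x \<bullet> e i) = m i" by metis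
  \<comment> \<open>A strictly increasing sequence of integers between \<open>0\<close> and \<open>n + 1\<close> has no choice.\<close>
  have low: "int i \<le> m i" if "1 \<le> i" "i \<le> n" for i
    using that
  proof (induction i rule: dec_induct)
    case base
    have "0 < N * (x \<bullet> e 1)" using x(1) N by (simp add: A0_iff)
    then show ?case using m[of 1] n_pos by simp
  next
    case (step i)
    have "N * (x \<bullet> e i) < N * (x \<bullet> e (Suc i))" using x(1) N step by (simp add: A0_iff)
    then show ?case using m[of i] m[of "Suc i"] step by simp
  qed
  have high: "m i \<le> int i" if "1 \<le> i" "i \<le> n" for i
    using that(2,1)
  proof (induction i rule: inc_induct)
    case base
    have "N * (x \<bullet> e n) < N * (1 / 2)" using x(1) N by (intro mult_strict_left_mono) (auto simp: A0_iff)
    moreover have "N * (x \<bullet> e n) = m n" using m[of n] n_pos by simp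
    moreover have "N * (1 / 2) = real n + 1" by (simp add: N_def)
    ultimately have "m n < real n + 1" by metis
    then show ?case by linarith
  next
    case (step i)
    have "N * (x \<bullet> e i) < N * (x \<bullet> e (Suc i))" using x(1) N step by (simp add: A0_iff)
    then show ?case using m[of i] m[of "Suc i"] step by simp
  qed
  have "x = rho"
  proof (rule eq_if_inner_e)
    fix i assume "1 \<le> i" "i \<le> n"
    then show "x \<bullet> e i = rho \<bullet> e i"
      using low[of i] high[of i] m[of i] N by (simp add: inner_rho N_def field_simps)
  qed
  have key: "u ! i = u' ! i \<and> c \<bullet> axis (u ! i) = c' \<bullet> axis (u ! i)" if i: "i < n" for i
  proof -
    have l: "label (u ! i)" using label_nth[OF u(1)] i by simp
    obtain v' j where v': "label v'" "j < n"
      "v' = int (Suc j) \<and> u ! i = u' ! j \<or> v' = - int (Suc j) \<and> u ! i = - u' ! j"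
      "\<forall>x c. (place u' c x - c) \<bullet> axis (u ! i) = x \<bullet> axis v'"
      by (rule pull_label[OF u'(1) l])
    obtain a b :: int where ab: "c \<bullet> axis (u ! i) = a" "c' \<bullet> axis (u ! i) = b"
      using u(2) u'(2) l unfolding lattice_def by (meson Ints_cases)
    have "place u' c' rho \<bullet> axis (u ! i) = a + x \<bullet> e (Suc i)"
      using inner_place[OF u(1) i, of c x] unfolding x(2) ab(1) .
    moreover have "x \<bullet> e (Suc i) = real (Suc i) / N"
      unfolding \<open>x = rho\<close> N_def using i by (intro inner_rho) auto
    moreover have "place u' c' rho \<bullet> axis (u ! i) - b = rho \<bullet> axis v'"
      using v'(4)[rule_format, of c' rho] unfolding inner_diff_left ab(2) .
    moreover have "rho \<bullet> axis v' = v' / N"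
      using v'(3)
    proof
      assume "v' = int (Suc j) \<and> u ! i = u' ! j"
      then show ?thesis using v'(2) inner_rho[of "Suc j"] by (simp add: axis_int N_def del: of_nat_Suc)
    next
      assume "v' = - int (Suc j) \<and> u ! i = - u' ! j"
      then show ?thesis using v'(2) inner_rho[of "Suc j"]
        by (simp add: axis_int axis_minus label_int N_def del: of_nat_Suc)
    qed
    ultimately have "a - b = (v' - real (Suc i)) / N" by (simp add: diff_divide_distrib)
    then have "(a - b) * N = v' - real (Suc i)" using N by (simp only: nonzero_eq_divide_eq)
    then have eq: "(a - b) * int (2 * n + 2) = v' - int (Suc i)" unfolding N_def
      by (metis (no_types, lifting) of_int_diff of_int_eq_iff of_int_mult of_int_of_nat_eq)
    have "\<bar>v' - int (Suc i)\<bar> < int (2 * n + 2)" using v'(1) i by (auto simp: label_def)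
    then have "\<bar>a - b\<bar> * int (2 * n + 2) < 1 * int (2 * n + 2)" unfolding eq[symmetric] abs_mult by simp
    then have "\<bar>a - b\<bar> < 1" by (subst (asm) mult_less_cancel_right_pos) auto
    then have "a = b" "v' = int (Suc i)" using eq by auto
    then show ?thesis using v'(3) ab by auto
  qed
  show "u = u'" using key signed_perm_length[OF u(1)] signed_perm_length[OF u'(1)] by (intro nth_equalityI) auto
  show "c = c'" 
  proof (rule eq_if_inner_word[OF u(1)])
    fix j assume "j < n"
    with key show "c \<bullet> axis (u ! j) = c' \<bullet> axis (u ! j)" by blast
  qed
qed

abbreviation id_word :: "int list" where "id_word \<equiv> word n []"

section \<open>Walls and facets of the fundamental alcove\<close>

text \<open>
  The outward normal of the \<open>i\<close>-th wall. By the description of positive roots it is positive exactly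
  when \<open>i\<close> is a descent of the padded word.
\<close>

definition outward :: "int list \<Rightarrow> nat \<Rightarrow> real ^ 'n" where
  "outward u i = axis (padded u i) - axis (padded u (Suc i))"

text \<open>
  Among the walls of the fundamental alcove only the affine one is off the origin.
\<close>

definition \<delta> :: "nat \<Rightarrow> real" where "\<delta> i = of_bool (i = n)"

lemma signed_perm_id_word: "signed_perm n id_word" by (rule signed_perm_word[OF n_pos])

lemma nth_id_word: "j < n \<Longrightarrow> id_word ! j = int (Suc j)"
  by (simp del: upt_Suc add: nth_upt)

lemma label_padded:
  assumes "signed_perm n u" "i \<le> Suc n"
  shows "label (padded u i)"
  using label_nth[OF assms(1)] assms(2) n_pos signed_perm_length[OF assms(1)] by (auto simp: padded_def)

lemma padded_distinct:
  assumes "signed_perm n u" "i \<le> n"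
  shows "padded u i \<noteq> padded u (Suc i)"
proof -
  have len: "length u = n" using signed_perm_length[OF assms(1)] .
  have l0: "u ! j \<noteq> 0" if "j < n" for j using label_nth[OF assms(1) that] by (auto simp: label_def)
  consider "i = 0" | "i = n" "0 < i" | "0 < i" "i < n" using assms(2) by linarith
  then show ?thesis
  proof cases
    case 1 then show ?thesis using l0[of 0] n_pos len by (simp add: padded_def)
  next
    case 2 then show ?thesis using l0[of "n - 1"] n_pos len by (simp add: padded_def)
  next
    case 3
    then have "u ! (i - 1) \<noteq> u ! i" using signed_perm_distinct[OF assms(1), of "i - 1" i] by fastforce
    then show ?thesis using 3 len by (simp add: padded_def)
  qed
qed

lemma outward_alt:
  assumes "signed_perm n u" "i \<le> n"
  shows "outward u i = axis (padded u i) + axis (- padded u (Suc i))"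
  using label_padded[OF assms(1), of "Suc i"] assms by (simp add: outward_def axis_minus)

lemma outward_in_roots: "signed_perm n u \<Longrightarrow> i \<le> n \<Longrightarrow> outward u i \<in> roots e"
  unfolding roots_eq outward_alt using label_padded[of u i] label_padded[of u "Suc i"] padded_distinct[of u i] by force

lemma outward_cases:
  assumes "signed_perm n u" "i \<le> n"
  shows "i = 0 \<Longrightarrow> outward u i = - 2 *\<^sub>R axis (u ! 0)"
    and "i = n \<Longrightarrow> outward u i = 2 *\<^sub>R axis (u ! (n - 1))"
    and "0 < i \<Longrightarrow> i < n \<Longrightarrow> outward u i = axis (u ! (i - 1)) - axis (u ! i)"
  using assms n_pos signed_perm_length[OF assms(1)] label_nth[OF assms(1), of 0] label_nth[OF assms(1), of "n - 1"]
  by (auto simp: outward_def padded_def axis_minus scaleR_2)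

text \<open>
  The negative simple roots and the highest root: the outward normals of the fundamental alcove.
\<close>

definition theta :: "nat \<Rightarrow> real ^ 'n" where "theta i = outward id_word i"

lemma theta_cases:
  assumes "i \<le> n"
  shows "i = 0 \<Longrightarrow> x \<bullet> theta i = - 2 * (x \<bullet> e 1)"
    and "i = n \<Longrightarrow> x \<bullet> theta i = 2 * (x \<bullet> e n)"
    and "0 < i \<Longrightarrow> i < n \<Longrightarrow> x \<bullet> theta i = x \<bullet> e i - x \<bullet> e (Suc i)"
  unfolding theta_def using outward_cases[OF signed_perm_id_word assms] nth_id_word[of 0] nth_id_word[of "n - 1"] nth_id_word[of "i - 1"] nth_id_word[of i] n_pos assms
  by (auto simp: axis_int inner_diff_right simp del: of_nat_Suc word.simps)

lemma place_outward:
  assumes u: "signed_perm n u" and i: "i \<le> n"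
  shows "place u c x \<bullet> outward u i = c \<bullet> outward u i + x \<bullet> theta i"
proof -
  consider "i = 0" | "i = n" "0 < i" | "0 < i" "i < n" using assms(2) by linarith
  then show ?thesis
  proof cases
    case 1 then show ?thesis using outward_cases(1)[OF assms] theta_cases(1)[OF i] inner_place[OF u, of 0] n_pos by simp
  next
    case 2 then show ?thesis using outward_cases(2)[OF assms] theta_cases(2)[OF i] inner_place[OF u, of "n - 1"] n_pos by simp
  next
    case 3 then show ?thesis
      using outward_cases(3)[OF assms] theta_cases(3)[OF i] inner_place[OF u, of "i - 1"] inner_place[OF u, of i]
      by (simp add: inner_diff_right)
  qed
qed

lemma A0_theta: "x \<in> A\<^sub>0 \<longleftrightarrow> (\<forall>i\<le>n. x \<bullet> theta i < \<delta> i)"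
proof
  assume x: "x \<in> A\<^sub>0"
  show "\<forall>i\<le>n. x \<bullet> theta i < \<delta> i"
  proof (intro allI impI)
    fix i assume i: "i \<le> n"
    consider "i = 0" | "i = n" "0 < i" | "0 < i" "i < n" using i by linarith
    then show "x \<bullet> theta i < \<delta> i"
      by cases (use x theta_cases[OF i, of x] n_pos in \<open>auto simp: A0_iff \<delta>_def\<close>)
  qed
next
  assume r: "\<forall>i\<le>n. x \<bullet> theta i < \<delta> i"
  show "x \<in> A\<^sub>0" unfolding A0_iff
  proof (intro conjI allI impI)
    show "0 < x \<bullet> e 1" using r[rule_format, of 0] theta_cases(1)[of 0 x] n_pos by (simp add: \<delta>_def)
    show "x \<bullet> e n < 1 / 2" using r[rule_format, of n] theta_cases(2)[of n x] by (simp add: \<delta>_def)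
    fix i assume "1 \<le> i" "i < n"
    then show "x \<bullet> e i < x \<bullet> e (Suc i)" using r[rule_format, of i] theta_cases(3)[of i x] by (simp add: \<delta>_def)
  qed
qed

lemma wall_eq: "i \<le> n \<Longrightarrow> wall e i = {x. theta i \<bullet> x = \<delta> i}"
proof -
  assume i: "i \<le> n"
  consider "i = 0" | "i = n" "0 < i" | "0 < i" "i < n" using i by linarith
  then show ?thesis
    by cases (use theta_cases[OF i] n_pos in \<open>auto simp: wall_def n_eq[symmetric] hyperplane_def simple_root_def highest_root_def \<delta>_def
      inner_diff_right inner_commute[of "theta _"]\<close>)
qed

definition facet0 :: "nat \<Rightarrow> (real ^ 'n) set" where
  "facet0 i = closure A\<^sub>0 \<inter> wall e i"

definition mid :: "nat \<Rightarrow> real ^ 'n" where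
  "mid i = (\<Sum>j<n. (of_int (midpoint_coord (int n) (int i) (int (Suc j))) / real (4 * n + 4)) *\<^sub>R e (Suc j))"

lemma inner_mid: "1 \<le> j \<Longrightarrow> j \<le> n \<Longrightarrow> mid i \<bullet> e j = of_int (midpoint_coord (int n) (int i) (int j)) / real (4 * n + 4)"
  unfolding mid_def by (subst inner_sum_e) (auto simp: algebra_simps)

text \<open>
  The midpoint lies on its own wall and strictly inside all the others.
\<close>

lemma mid_theta: 
  assumes "i \<le> n" "j \<le> n"
  shows "if j = i then mid i \<bullet> theta j = \<delta> j else mid i \<bullet> theta j < \<delta> j"
proof -
  define D where "D = real (4 * n + 4)"
  have D: "0 < D" by (simp add: D_def)
  let ?G = "\<lambda>j. midpoint_coord (int n) (int i) (int j)"
  have m: "mid i \<bullet> e j = of_int (?G j) / D" if "1 \<le> j" "j \<le> n" for j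
    using inner_mid[OF that] unfolding D_def .
  consider "j = 0" | "j = n" "0 < j" | "0 < j" "j < n" using assms(2) by linarith
  then show ?thesis
  proof cases
    case 1
    have v: "mid i \<bullet> theta j = - (2 * of_int (?G 1) / D)"
      using theta_cases(1)[OF assms(2) 1, of "mid i"] m[of 1] n_pos by simp
    have "if i = 0 then ?G 1 = 0 else 0 < ?G 1" by (simp add: midpoint_coord_def)
    then show ?thesis using v 1 D n_pos by (auto simp: \<delta>_def)
  next
    case 2
    have v: "mid i \<bullet> theta j = of_int (2 * ?G n) / D"
      using theta_cases(2)[OF assms(2) 2(1), of "mid i"] m[of n] n_pos by simp
    have "if i = n then 2 * ?G n = 4 * int n + 4 else 2 * ?G n < 4 * int n + 4"
      using assms n_pos by (simp add: midpoint_coord_def)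
    moreover have "D = of_int (4 * int n + 4)" by (simp add: D_def)
    ultimately show ?thesis unfolding \<delta>_def using v 2(1) D
      by (cases "i = n") (simp_all del: of_int_add of_int_mult)
  next
    case 3
    have v: "mid i \<bullet> theta j = of_int (?G j - ?G (Suc j)) / D"
      using theta_cases(3)[OF assms(2) 3, of "mid i"] m[of j] m[of "Suc j"] 3 by (simp add: diff_divide_distrib)
    have "if j = i then ?G j - ?G (Suc j) = 0 else ?G j - ?G (Suc j) < 0"
      using assms 3 by (simp add: midpoint_coord_def)
    then show ?thesis using v 3 D by (auto simp: \<delta>_def divide_neg_pos simp del: of_int_diff)
  qed
qed

text \<open>
  Move the point towards \<open>\<rho>\<close>: all the weak inequalities become strict at once.
\<close>

lemma near_wall_in_closure:
  assumes "i \<le> n" "x \<bullet> theta i = \<delta> i" "\<And>j. j \<le> n \<Longrightarrow> j \<noteq> i \<Longrightarrow> x \<bullet> theta j < \<delta> j"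
  shows "x \<in> closure A\<^sub>0"
proof -
  \<comment> \<open>A sequence in the open alcove that approaches \<open>x\<close> along the segment to \<open>\<rho>\<close>.\<close>
  define f where "f m = x + (1 / real (Suc m)) *\<^sub>R (rho - x)" for m
  have "f m \<in> A\<^sub>0" for m
    unfolding A0_theta
  proof (intro allI impI)
    fix j assume j: "j \<le> n"
    define t where "t = 1 / real (Suc m)"
    have t: "0 < t" "t \<le> 1" by (auto simp: t_def)
    have r: "rho \<bullet> theta j < \<delta> j" using rho_in_A0 j by (simp add: A0_theta)
    have xj: "x \<bullet> theta j \<le> \<delta> j" using assms j by (cases "j = i") (auto simp: less_imp_le)
    have "f m \<bullet> theta j = (1 - t) * (x \<bullet> theta j) + t * (rho \<bullet> theta j)"
      unfolding f_def t_def[symmetric] by (simp add: inner_add_left inner_diff_left algebra_simps)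
    also have "\<dots> < (1 - t) * \<delta> j + t * \<delta> j"
      using t r xj by (intro add_le_less_mono mult_left_mono mult_strict_left_mono) auto
    finally show "f m \<bullet> theta j < \<delta> j" by (simp add: algebra_simps)
  qed
  moreover have "f \<longlonglongrightarrow> x + 0 *\<^sub>R (rho - x)"
    unfolding f_def by (intro tendsto_intros LIMSEQ_Suc[OF lim_1_over_n])
  ultimately show ?thesis unfolding closure_sequential by (intro exI[of _ f]) auto
qed

lemma convex_A0: "convex A\<^sub>0"
proof -
  have "A\<^sub>0 = (\<Inter>i\<in>{..n}. {x. theta i \<bullet> x < \<delta> i})"
    by (auto simp: A0_theta inner_commute)
  then show ?thesis by (auto intro!: convex_INT convex_halfspace_lt)
qed

lemma open_A0: "open A\<^sub>0"
proof -
  have "A\<^sub>0 = (\<Inter>i\<in>{..n}. {x. theta i \<bullet> x < \<delta> i})"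
    by (auto simp: A0_theta inner_commute)
  then show ?thesis by (auto intro!: open_INT open_halfspace_lt)
qed

lemma closure_A0_le: "x \<in> closure A\<^sub>0 \<Longrightarrow> i \<le> n \<Longrightarrow> theta i \<bullet> x \<le> \<delta> i"
proof -
  assume "x \<in> closure A\<^sub>0" "i \<le> n"
  moreover have "closure A\<^sub>0 \<subseteq> {x. theta i \<bullet> x \<le> \<delta> i}"
    using \<open>i \<le> n\<close> by (intro closure_minimal closed_halfspace_le) (auto simp: A0_theta inner_commute less_imp_le)
  ultimately show ?thesis by auto
qed

lemma mid_in_facet0:
  assumes "i \<le> n"
  shows "mid i \<in> facet0 i"
proof -
  have "mid i \<bullet> theta i = \<delta> i" using mid_theta[OF assms assms] by simp
  moreover have "mid i \<bullet> theta j < \<delta> j" if "j \<le> n" "j \<noteq> i" for j using mid_theta[OF assms that(1)] that(2) by simp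
  ultimately show ?thesis
    unfolding facet0_def using near_wall_in_closure[OF assms] wall_eq[OF assms] by (auto simp: inner_commute)
qed

lemma theta_nonzero: "i \<le> n \<Longrightarrow> theta i \<noteq> 0"
  using A0_theta rho_in_A0 mid_theta[of i i] by (cases "i = n") (force simp: \<delta>_def)+

text \<open>
  The dimension is found from below: near its midpoint the face is open in the wall.
\<close>

lemma facet0_facet:
  assumes i: "i \<le> n"
  shows "facet0 i facet_of closure A\<^sub>0"
proof -
  let ?H = "{x. theta i \<bullet> x = \<delta> i}"
  have f: "facet0 i = closure A\<^sub>0 \<inter> ?H" by (simp add: facet0_def wall_eq[OF i])
  have conv: "convex (closure A\<^sub>0)" by (intro convex_closure convex_A0)
  have face: "facet0 i face_of closure A\<^sub>0"
    unfolding f by (rule face_of_Int_supporting_hyperplane_le[OF conv closure_A0_le[OF _ i]])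
  \<comment> \<open>The part of the wall that is strictly inside all other walls.\<close>
  let ?U = "?H \<inter> (\<Inter>j\<in>{..n} - {i}. {x. theta j \<bullet> x < \<delta> j})"
  have "openin (top_of_set ?H) ?U"
    by (intro openin_open_Int open_INT ballI open_halfspace_lt) auto
  moreover have "mid i \<in> ?U"
    using mid_theta[OF i i] mid_theta[OF i] by (auto simp: inner_commute[of "theta _"] split: if_splits)
  ultimately have "aff_dim ?U = aff_dim ?H" by (intro aff_dim_openin affine_hyperplane) auto
  moreover have "?U \<subseteq> facet0 i"
    unfolding f using near_wall_in_closure[OF i] by (auto simp: inner_commute)
  ultimately have ge: "int (DIM(real ^ 'n)) - 1 \<le> aff_dim (facet0 i)"
    using aff_dim_subset[of ?U "facet0 i"] theta_nonzero[OF i] by (simp add: aff_dim_hyperplane)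
  have dim: "aff_dim (closure A\<^sub>0) = DIM(real ^ 'n)"
    using aff_dim_open[OF open_A0] rho_in_A0 by auto
  have "rho \<notin> facet0 i" using rho_in_A0 i by (auto simp: f A0_theta inner_commute)
  moreover have "rho \<in> closure A\<^sub>0" using rho_in_A0 closure_subset by auto
  ultimately have "facet0 i \<noteq> closure A\<^sub>0" by auto
  then have "aff_dim (facet0 i) < DIM(real ^ 'n)" using face_of_aff_dim_lt[OF conv face] dim by simp
  then show ?thesis
    unfolding facet_of_def using face ge dim mid_in_facet0[OF i] by auto
qed

text \<open>
  A facet inside the wall is a face of the full intersection and of the same dimension.
\<close>

lemma facet0_unique:
  assumes i: "i \<le> n" and F: "F facet_of closure A\<^sub>0" "F \<subseteq> wall e i"
  shows "F = facet0 i"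
proof (rule ccontr)
  assume "F \<noteq> facet0 i"
  have "F \<subseteq> facet0 i" using F facet_of_imp_subset by (auto simp: facet0_def)
  moreover have "facet0 i \<subseteq> closure A\<^sub>0" by (simp add: facet0_def)
  ultimately have "F face_of facet0 i" using F(1) facet_of_imp_face_of face_of_subset by blast
  moreover have "convex (facet0 i)" using facet0_facet[OF i] facet_of_imp_face_of face_of_imp_convex by blast
  ultimately have "aff_dim F < aff_dim (facet0 i)" using face_of_aff_dim_lt \<open>F \<noteq> facet0 i\<close> by blast
  then show False using F(1) facet0_facet[OF i] by (simp add: facet_of_def)
qed

text \<open>
  The wall is the only hyperplane through the midpoint. This makes adjacency a local question: near
  the midpoint only one hyperplane is present.
\<close>

lemma mid_unique:
  assumes i: "i \<le> n" and vw: "label v" "label w" "v + w \<noteq> 0" and eq: "mid i \<bullet> (axis v + axis w) = of_int k"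
  shows "(axis v + axis w = theta i \<and> of_int k = \<delta> i) \<or> (axis v + axis w = - theta i \<and> of_int k = - \<delta> i)"
proof -
  let ?g = "\<lambda>v. sgn v * midpoint_coord (int n) (int i) \<bar>v\<bar>"
  have g: "mid i \<bullet> axis v = of_int (?g v) / real (4 * n + 4)" if "label v" for v
    using that by (cases rule: label_cases) (auto simp: axis_int axis_minus label_int inner_mid simp del: of_nat_Suc)
  have "of_int (?g v + ?g w) / real (4 * n + 4) = of_int k"
    using eq unfolding inner_add_right g[OF vw(1)] g[OF vw(2)] by (simp only: of_int_add add_divide_distrib)
  then have "real_of_int (?g v + ?g w) = of_int k * real (4 * n + 4)"
    by (subst (asm) nonzero_divide_eq_eq) auto
  also have "\<dots> = real_of_int ((4 * int n + 4) * k)" by simp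
  finally have "?g v + ?g w = (4 * int n + 4) * k" unfolding of_int_eq_iff .
  then have "(int i = 0 \<and> v = w \<and> \<bar>v\<bar> = 1 \<and> k = 0) \<or> (int i = int n \<and> v = w \<and> v = int n * k \<and> \<bar>k\<bar> = 1)
     \<or> (0 < int i \<and> int i < int n \<and> k = 0 \<and> ((v = int i \<and> w = - int i - 1) \<or> (v = - int i \<and> w = int i + 1) \<or> (w = int i \<and> v = - int i - 1) \<or> (w = - int i \<and> v = int i + 1)))"
    using i vw unfolding label_def by (intro midpoint_integrality) auto
  then consider "int i = 0" "v = w" "\<bar>v\<bar> = 1" "k = 0" | "int i = int n" "v = w" "v = int n * k" "\<bar>k\<bar> = 1"
    | "0 < int i" "int i < int n" "k = 0" "(v = int i \<and> w = - int i - 1) \<or> (v = - int i \<and> w = int i + 1) \<or> (w = int i \<and> v = - int i - 1) \<or> (w = - int i \<and> v = int i + 1)"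
    by blast
  then show ?thesis
  proof cases
    case c: 1
    then have i0: "i = 0" and v: "v = 1 \<or> v = - 1" by linarith+
    have "theta i = - 2 *\<^sub>R axis 1"
      using outward_cases(1)[OF signed_perm_id_word i i0] nth_id_word[of 0] n_pos by (simp add: theta_def del: word.simps)
    moreover have "axis (- 1) = - axis 1" using n_pos by (intro axis_minus) (simp add: label_def)
    ultimately show ?thesis using v c(2,4) i0 n_pos by (elim disjE) (simp_all add: \<delta>_def scaleR_2)
  next
    case c: 2
    then have i_n: "i = n" and v: "v = int n \<and> k = 1 \<or> v = - int n \<and> k = - 1" by (auto simp: abs_if split: if_splits)
    have "theta i = 2 *\<^sub>R axis (int n)"
      using outward_cases(2)[OF signed_perm_id_word i i_n] nth_id_word[of "n - 1"] n_pos by (simp add: theta_def del: word.simps)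
    moreover have "axis (- int n) = - axis (int n)" using n_pos by (intro axis_minus label_int) auto
    ultimately show ?thesis using v c(2) i_n n_pos by (elim disjE) (simp_all add: \<delta>_def scaleR_2)
  next
    case c: 3
    then have 3: "0 < i" "i < n" by simp_all
    have s: "- int i - 1 = - int (Suc i)" "int i + 1 = int (Suc i)" by simp_all
    have "theta i = axis (int i) - axis (int (Suc i))"
      using outward_cases(3)[OF signed_perm_id_word i 3] nth_id_word[of "i - 1"] nth_id_word[of i] 3
      by (simp add: theta_def del: word.simps of_nat_Suc)
    moreover have "axis (- int i) = - axis (int i)" "axis (- int (Suc i)) = - axis (int (Suc i))"
      using 3 by (auto intro!: axis_minus label_int simp del: of_nat_Suc)
    ultimately show ?thesis using c(3,4) 3 unfolding s by (elim disjE) (simp_all add: \<delta>_def del: of_nat_Suc)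
  qed
qed

section \<open>Reflections\<close>

text \<open>
  The action on labels of the reflection in the root \<open>axis v + axis w\<close>.
\<close>

definition swap_label :: "int \<Rightarrow> int \<Rightarrow> int \<Rightarrow> int" where
  "swap_label v w l = (if l = v then - w else if l = - v then w else if l = w then - v else if l = - w then v else l)"

lemma root_sqnorm:
  assumes "label v" "label w" "v + w \<noteq> 0"
  shows "(axis v + axis w) \<bullet> (axis v + axis w) = (if v = w then 4 else 2)"
proof -
  have "v \<noteq> 0" "w \<noteq> 0" "v \<noteq> - w" "w \<noteq> - v" using assms by (auto simp: label_def)
  then show ?thesis using assms by (simp add: inner_add_left inner_add_right inner_axis)
qed

lemma refl_axis:
  assumes "label v" "label w" "v + w \<noteq> 0" "label l"
  defines "\<alpha> \<equiv> axis v + axis w"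
  shows "axis l - (2 * (axis l \<bullet> \<alpha>) / (\<alpha> \<bullet> \<alpha>)) *\<^sub>R \<alpha> = axis (swap_label v w l)"
proof -
  have ne: "v \<noteq> 0" "w \<noteq> 0" "v \<noteq> - w" "w \<noteq> - v" "l \<noteq> 0" using assms by (auto simp: label_def)
  have sq: "\<alpha> \<bullet> \<alpha> = (if v = w then 4 else 2)" unfolding \<alpha>_def by (rule root_sqnorm[OF assms(1-3)])
  have il: "axis l \<bullet> \<alpha> = (if l = v then 1 else if l = - v then - 1 else 0) + (if l = w then 1 else if l = - w then - 1 else 0)"
    using assms by (simp add: \<alpha>_def inner_add_right inner_axis)
  have m: "axis (- v) = - axis v" "axis (- w) = - axis w" using assms axis_minus by auto
  consider "l = v" | "l = - v" | "l = w" "l \<noteq> v" "l \<noteq> - v" | "l = - w" "l \<noteq> v" "l \<noteq> - v"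
    | "l \<noteq> v" "l \<noteq> - v" "l \<noteq> w" "l \<noteq> - w" by blast
  then show ?thesis
  proof cases
    case 1
    then have co: "2 * (axis l \<bullet> \<alpha>) / (\<alpha> \<bullet> \<alpha>) = 1" using ne unfolding il sq by auto
    show ?thesis unfolding co using 1 by (simp add: \<alpha>_def swap_label_def m)
  next
    case 2
    then have co: "2 * (axis l \<bullet> \<alpha>) / (\<alpha> \<bullet> \<alpha>) = - 1" using ne unfolding il sq by auto
    show ?thesis unfolding co using 2 ne by (simp add: \<alpha>_def swap_label_def m)
  next
    case 3
    then have co: "2 * (axis l \<bullet> \<alpha>) / (\<alpha> \<bullet> \<alpha>) = 1" using ne unfolding il sq by auto
    show ?thesis unfolding co using 3 by (simp add: \<alpha>_def swap_label_def m)
  next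
    case 4
    then have co: "2 * (axis l \<bullet> \<alpha>) / (\<alpha> \<bullet> \<alpha>) = - 1" using ne unfolding il sq by auto
    show ?thesis unfolding co using 4 ne by (simp add: \<alpha>_def swap_label_def m)
  next
    case 5
    then show ?thesis by (simp add: il swap_label_def)
  qed
qed

text \<open>
  Reflections act on the left by relabelling the word and reflecting the translation part, so
  the group consists of maps of the form \<open>place u c\<close>.
\<close>

lemma refl_place:
  assumes u: "signed_perm n u" and vw: "label v" "label w" "v + w \<noteq> 0" and \<alpha>: "\<alpha> = axis v + axis w"
  shows "refl_map \<alpha> k (place u c x) = place (map (swap_label v w) u) (refl_map \<alpha> k c) x"
proof -
  let ?s = "place u 0 x"
  have len: "length u = n" by (rule signed_perm_length[OF u])
  have "(\<Sum>j<n. (x \<bullet> e (Suc j)) *\<^sub>R axis (map (swap_label v w) u ! j))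
      = (\<Sum>j<n. (x \<bullet> e (Suc j)) *\<^sub>R (axis (u ! j) - (2 * (axis (u ! j) \<bullet> \<alpha>) / (\<alpha> \<bullet> \<alpha>)) *\<^sub>R \<alpha>))"
    using refl_axis[OF vw label_nth[OF u]] len by (intro sum.cong) (simp_all add: \<alpha>)
  also have "\<dots> = ?s - (\<Sum>j<n. (2 * ((x \<bullet> e (Suc j)) * (axis (u ! j) \<bullet> \<alpha>)) / (\<alpha> \<bullet> \<alpha>)) *\<^sub>R \<alpha>)"
    by (simp add: place_def scaleR_diff_right sum_subtractf mult.left_commute)
  also have "\<dots> = ?s - (2 * (?s \<bullet> \<alpha>) / (\<alpha> \<bullet> \<alpha>)) *\<^sub>R \<alpha>"
    by (simp add: place_def inner_sum_left scaleR_left.sum[symmetric] sum_divide_distrib[symmetric] sum_distrib_left[symmetric])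
  finally have "place (map (swap_label v w) u) (refl_map \<alpha> k c) x
      = refl_map \<alpha> k c + (?s - (2 * (?s \<bullet> \<alpha>) / (\<alpha> \<bullet> \<alpha>)) *\<^sub>R \<alpha>)"
    by (simp add: place_def)
  also have "\<dots> = refl_map \<alpha> k (c + ?s)"
    by (simp add: refl_map_def inner_add_left add_divide_distrib diff_divide_distrib algebra_simps)
  finally show ?thesis using place_linear[of u c x] by simp
qed

lemma signed_perm_swap_label:
  assumes u: "signed_perm n u" and vw: "label v" "label w"
  shows "signed_perm n (map (swap_label v w) u)"
proof -
  have abs: "\<bar>swap_label v w l\<bar> = (if \<bar>l\<bar> = \<bar>v\<bar> then \<bar>w\<bar> else if \<bar>l\<bar> = \<bar>w\<bar> then \<bar>v\<bar> else \<bar>l\<bar>)" for l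
    by (auto simp: swap_label_def abs_if)
  have S: "abs ` set u = int ` {1..n}" "length u = n" using u by (auto simp: signed_perm_iff)
  have "\<bar>a\<bar> \<in> abs ` set u" if "label a" for a
    using that unfolding S by (auto simp: label_def image_iff intro!: bexI[of _ "nat \<bar>a\<bar>"])
  with vw have vS: "\<bar>v\<bar> \<in> abs ` set u" "\<bar>w\<bar> \<in> abs ` set u" by blast+
  let ?f = "\<lambda>a. if a = \<bar>v\<bar> then \<bar>w\<bar> else if a = \<bar>w\<bar> then \<bar>v\<bar> else a"
  have "abs ` set (map (swap_label v w) u) = ?f ` (abs ` set u)"
    by (simp only: set_map image_image abs)
  also have "\<dots> = abs ` set u"
  proof
    show "?f ` (abs ` set u) \<subseteq> abs ` set u" using vS by auto
    show "abs ` set u \<subseteq> ?f ` (abs ` set u)"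
    proof
      fix a assume a: "a \<in> abs ` set u"
      have "a = ?f (?f a)" by auto
      moreover have "?f a \<in> abs ` set u" using a vS by auto
      ultimately show "a \<in> ?f ` (abs ` set u)" by blast
    qed
  qed
  finally show ?thesis using S by (simp add: signed_perm_iff)
qed

lemma lattice_refl:
  assumes c: "lattice c" and vw: "label v" "label w" "v + w \<noteq> 0"
  shows "lattice (refl_map (axis v + axis w) k c)"
  unfolding lattice_def
proof (intro allI impI)
  fix l assume l: "label l"
  let ?\<alpha> = "axis v + axis w"
  have ci: "c \<bullet> axis a \<in> \<int>" if "label a" for a using c that by (simp add: lattice_def)
  have ai: "axis a \<bullet> axis l \<in> \<int>" if "label a" for a using inner_axis[OF that l] by simp
  have "(2 * (c \<bullet> ?\<alpha> - of_int k) / (?\<alpha> \<bullet> ?\<alpha>)) * (?\<alpha> \<bullet> axis l) \<in> \<int>"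
  proof (cases "v = w")
    case True
    have "(2 * (c \<bullet> ?\<alpha> - of_int k) / (?\<alpha> \<bullet> ?\<alpha>)) * (?\<alpha> \<bullet> axis l)
        = (c \<bullet> axis v + c \<bullet> axis v - of_int k) * (axis v \<bullet> axis l)"
      unfolding root_sqnorm[OF vw] unfolding inner_add_left inner_add_right using True by (simp add: field_simps)
    also have "\<dots> \<in> \<int>" using ci[OF vw(1)] ai[OF vw(1)] by (intro Ints_mult Ints_diff Ints_add Ints_of_int)
    finally show ?thesis .
  next
    case False
    have "(2 * (c \<bullet> ?\<alpha> - of_int k) / (?\<alpha> \<bullet> ?\<alpha>)) * (?\<alpha> \<bullet> axis l)
        = (c \<bullet> axis v + c \<bullet> axis w - of_int k) * (axis v \<bullet> axis l + axis w \<bullet> axis l)"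
      unfolding root_sqnorm[OF vw] unfolding inner_add_left inner_add_right using False by simp
    also have "\<dots> \<in> \<int>" using ci[OF vw(1)] ai[OF vw(1)] ci[OF vw(2)] ai[OF vw(2)]
      by (intro Ints_mult Ints_diff Ints_add Ints_of_int)
    finally show ?thesis .
  qed
  then show "refl_map ?\<alpha> k c \<bullet> axis l \<in> \<int>"
    unfolding refl_map_def inner_diff_left inner_scaleR_left using ci[OF l] by (intro Ints_diff)
qed

lemma place_id_word: "place id_word 0 = id"
proof (rule HOL.ext)
  fix x show "place id_word 0 x = id x"
  proof (rule eq_if_inner_word[OF signed_perm_id_word])
    fix j assume "j < n"
    then show "place id_word 0 x \<bullet> axis (id_word ! j) = id x \<bullet> axis (id_word ! j)"
      using inner_place[OF signed_perm_id_word, of j 0 x] nth_id_word[of j] by (simp add: axis_int del: word.simps of_nat_Suc)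
  qed
qed

lemma affine_group_place:
  assumes "w \<in> affine_weyl_group e"
  obtains u c where "signed_perm n u" "lattice c" "w = place u c"
proof -
  from assms have "\<exists>u c. signed_perm n u \<and> lattice c \<and> w = place u c"
  proof induction
    case id
    show ?case using place_id_word signed_perm_id_word by (intro exI[of _ id_word] exI[of _ 0]) (auto simp: lattice_def)
  next
    case (refl w \<alpha> k)
    then obtain u c where u: "signed_perm n u" "lattice c" "w = place u c" by blast
    obtain a b where ab: "\<alpha> = axis a + axis b" "label a" "label b" "a + b \<noteq> 0" using refl(2) by (auto simp: roots_eq)
    have "refl_map \<alpha> k \<circ> w = place (map (swap_label a b) u) (refl_map \<alpha> k c)"
      using refl_place[OF u(1) ab(2-4,1)] u(3) by (auto simp: fun_eq_iff)
    then show ?case using signed_perm_swap_label[OF u(1) ab(2,3)] lattice_refl[OF u(2) ab(2-4)] ab(1) by blast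
  qed
  then show thesis using that by blast
qed

text \<open>
  Only crossing the affine wall changes the translation part.
\<close>

definition next_shift :: "nat \<Rightarrow> int list \<Rightarrow> real ^ 'n \<Rightarrow> real ^ 'n" where
  "next_shift i u c = (if i = n then c + axis (u ! (n - 1)) else c)"

definition level :: "int list \<Rightarrow> real ^ 'n \<Rightarrow> nat \<Rightarrow> real" where
  "level u c i = c \<bullet> outward u i + \<delta> i"

lemma level_int:
  assumes "signed_perm n u" "lattice c" "i \<le> n"
  obtains k :: int where "level u c i = of_int k"
proof -
  obtain m :: int where "c \<bullet> outward u i = m" by (rule lattice_root[OF assms(2) outward_in_roots[OF assms(1,3)]])
  then show ?thesis using that[of "m + (if i = n then 1 else 0)"] by (simp add: level_def \<delta>_def)
qed

lemma lattice_next_shift: "signed_perm n u \<Longrightarrow> lattice c \<Longrightarrow> lattice (next_shift i u c)"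
  using label_nth[of u "n - 1"] n_pos by (auto simp: lattice_def next_shift_def inner_add_left inner_axis)

lemma signed_perm_step_n: "signed_perm n u \<Longrightarrow> signed_perm n (step i u)"
  using signed_perm_step n_pos by blast

text \<open>
  Reflecting in the \<open>i\<close>-th wall of an alcove is the move \<open>i\<close> on its word: the reflection swaps the
  two padded letters whose difference is the normal of the wall.
\<close>

lemma place_step:
  assumes u: "signed_perm n u" and i: "i \<le> n" and k: "level u c i = of_int k"
  shows "refl_map (outward u i) k \<circ> place u c = place (step i u) (next_shift i u c)"
proof -
  let ?v = "padded u i" and ?w = "- padded u (Suc i)"
  have len: "length u = n" by (rule signed_perm_length[OF u])
  have ne: "u \<noteq> []" using len n_pos by auto
  have vw: "label ?v" "label ?w" "?v + ?w \<noteq> 0" using label_padded[OF u] i padded_distinct[OF u i] by auto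
  have w: "map (swap_label ?v ?w) u = step i u"
  proof (rule nth_equalityI)
    fix j assume "j < length (map (swap_label ?v ?w) u)"
    then have j: "j < n" "j < length u" using len by auto
    have st: "step i u ! j = (if Suc j = i then padded u (Suc i) else if j = i then padded u i else u ! j)"
      using step_nth[OF ne _ j(2)] i len by simp
    have l: "label (u ! j)" using label_nth[OF u j(1)] .
    consider "Suc j = i" | "j = i" | "Suc j \<noteq> i" "j \<noteq> i" by blast
    then show "map (swap_label ?v ?w) u ! j = step i u ! j"
    proof cases
      case 1
      then have "u ! j = padded u i" using j by (auto simp: padded_def)
      then show ?thesis using st 1 j by (simp add: swap_label_def)
    next
      case 2
      then have "u ! j = padded u (Suc i)" using j by (auto simp: padded_def)
      then show ?thesis using st 2 j vw by (auto simp: swap_label_def label_def)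
    next
      case 3
      have "\<bar>u ! j\<bar> \<noteq> \<bar>padded u i\<bar>"
      proof (cases "i = 0")
        case True
        then show ?thesis using signed_perm_distinct[OF u j(1), of 0] 3 n_pos by (auto simp: padded_def)
      next
        case False
        then have "\<bar>padded u i\<bar> = \<bar>u ! (i - 1)\<bar>" "i - 1 < n" "j \<noteq> i - 1" using i len 3 by (auto simp: padded_def)
        then show ?thesis using signed_perm_distinct[OF u j(1), of "i - 1"] by metis
      qed
      moreover have "\<bar>u ! j\<bar> \<noteq> \<bar>padded u (Suc i)\<bar>"
      proof (cases "i = n")
        case True
        then have "\<bar>padded u (Suc i)\<bar> = \<bar>u ! (n - 1)\<bar>" "n - 1 < n" "j \<noteq> n - 1" using len 3 n_pos by (auto simp: padded_def)
        then show ?thesis using signed_perm_distinct[OF u j(1), of "n - 1"] by metis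
      next
        case False
        then have "\<bar>padded u (Suc i)\<bar> = \<bar>u ! i\<bar>" "i < n" using i len by (auto simp: padded_def)
        then show ?thesis using signed_perm_distinct[OF u j(1), of i] 3 by metis
      qed
      ultimately have "swap_label ?v ?w (u ! j) = u ! j" by (auto simp: swap_label_def)
      then show ?thesis using st 3 j by simp
    qed
  qed simp
  have kc: "c \<bullet> outward u i - of_int k = - \<delta> i" using k by (simp add: level_def)
  have "refl_map (outward u i) k c = c + (2 * \<delta> i / (outward u i \<bullet> outward u i)) *\<^sub>R outward u i"
    unfolding refl_map_def kc by simp
  also have "\<dots> = next_shift i u c"
  proof (cases "i = n")
    case True
    have "axis (u ! (n - 1)) \<bullet> axis (u ! (n - 1)) = 1" using inner_axis_nth[OF u] n_pos by simp
    then show ?thesis using True outward_cases(2)[OF u i True] by (simp add: next_shift_def \<delta>_def)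
  qed (simp add: next_shift_def \<delta>_def)
  finally have c': "refl_map (outward u i) k c = next_shift i u c" .
  show ?thesis
    using refl_place[OF u vw outward_alt[OF u i], of k c] unfolding w c' by (auto simp: fun_eq_iff)
qed

section \<open>Crossing a wall\<close>

lemma inj_place0: "signed_perm n u \<Longrightarrow> inj (place u 0)"
  using inj_place by (blast intro: injI)

lemma place_image: "place u c ` S = (+) c ` (place u 0 ` S)"
  unfolding image_image using place_linear[of u c] by auto

lemma closure_place:
  assumes "signed_perm n u"
  shows "closure (place u c ` S) = place u c ` closure S"
  unfolding place_image[of u c] closure_translation
  using closure_injective_linear_image[OF linear_place0 inj_place0[OF assms], of S] by simp

lemma facet_place:
  assumes "signed_perm n u" "F facet_of S"
  shows "place u c ` F facet_of place u c ` S"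
  using assms(2) inj_place0[OF assms(1)] linear_place0[of u]
  unfolding facet_of_def place_image[of u c]
  by (simp add: face_of_linear_image aff_dim_translation_eq)

text \<open>
  By simple transitivity the type of a facet does not depend on the group element that is used.
\<close>

lemma typed_facet_alcove:
  assumes u: "signed_perm n u" "lattice c" and i: "i \<le> n" and F: "typed_facet e i (alcove u c) F"
  shows "F = place u c ` facet0 i"
proof -
  obtain w F0 where w: "w \<in> affine_weyl_group e" "F0 facet_of closure A\<^sub>0" "F0 \<subseteq> wall e i"
    "alcove u c = w ` A\<^sub>0" "F = w ` F0"
    using F unfolding typed_facet_def by blast
  obtain u' c' where u': "signed_perm n u'" "lattice c'" "w = place u' c'" by (rule affine_group_place[OF w(1)])
  have "u = u'" "c = c'" using alcove_inj[OF u u'(1,2)] w(4) u'(3) by (auto simp: alcove_def)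
  then show ?thesis using w(5) u'(3) facet0_unique[OF i w(2,3)] by simp
qed

lemma typed_facet_shape:
  assumes "typed_facet e i A F"
  obtains u c where "signed_perm n u" "lattice c" "A = alcove u c" "place u c \<in> affine_weyl_group e"
proof -
  obtain w where w: "w \<in> affine_weyl_group e" "A = w ` A\<^sub>0" using assms unfolding typed_facet_def by blast
  obtain u c where "signed_perm n u" "lattice c" "w = place u c" by (rule affine_group_place[OF w(1)])
  then show ?thesis using that w by (auto simp: alcove_def)
qed

lemma typed_facet_place:
  assumes "i \<le> n" "place u c \<in> affine_weyl_group e"
  shows "typed_facet e i (alcove u c) (place u c ` facet0 i)"
  unfolding typed_facet_def alcove_def using assms facet0_facet[OF assms(1)]
  by (intro bexI[of _ "place u c"] exI[of _ "facet0 i"]) (auto simp: facet0_def)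

lemma below_level:
  assumes u: "signed_perm n u" and i: "i \<le> n" and z: "z \<in> alcove u c"
  shows "z \<bullet> outward u i < level u c i"
proof -
  obtain x where "x \<in> A\<^sub>0" "z = place u c x" using z by (auto simp: alcove_def)
  then show ?thesis using place_outward[OF u i, of c x] i by (simp add: level_def A0_theta)
qed

text \<open>
  Transport of the statement about the fundamental alcove along \<open>place u c\<close>.
\<close>

lemma mid_only_wall:
  assumes u: "signed_perm n u" "lattice c" and i: "i \<le> n" and \<alpha>: "\<alpha> \<in> roots e"
    and eq: "place u c (mid i) \<bullet> \<alpha> = of_int k"
  shows "(\<alpha> = outward u i \<and> of_int k = level u c i) \<or> (\<alpha> = - outward u i \<and> of_int k = - level u c i)"
proof -
  obtain v w where vw: "label v" "label w" "v + w \<noteq> 0" "\<forall>x c. (place u c x - c) \<bullet> \<alpha> = x \<bullet> (axis v + axis w)"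
    by (rule pull_root[OF u(1) \<alpha>])
  obtain m :: int where m: "c \<bullet> \<alpha> = m" by (rule lattice_root[OF u(2) \<alpha>])
  have "mid i \<bullet> (axis v + axis w) = of_int (k - m)"
    using vw(4)[rule_format, of c "mid i"] eq m by (simp add: inner_diff_left)
  then have s: "(axis v + axis w = theta i \<and> of_int (k - m) = \<delta> i) \<or> (axis v + axis w = - theta i \<and> of_int (k - m) = - \<delta> i)"
    by (rule mid_unique[OF i vw(1-3)])
  have pl: "place u 0 x \<bullet> \<alpha> = x \<bullet> (axis v + axis w)" for x
    using vw(4)[rule_format, of 0 x] by simp
  have po: "place u 0 x \<bullet> outward u i = x \<bullet> theta i" for x
    using place_outward[OF u(1) i, of 0 x] by simp
  have all: "\<alpha> = \<beta>" if "\<And>x. place u 0 x \<bullet> \<alpha> = place u 0 x \<bullet> \<beta>" for \<beta>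
  proof (rule vector_eq_ldot[THEN iffD1], intro allI)
    fix z obtain x where "place u 0 x = z" by (rule surj_place[OF u(1)])
    then show "z \<bullet> \<alpha> = z \<bullet> \<beta>" using that[of x] by simp
  qed
  from s show ?thesis
  proof
    assume a: "axis v + axis w = theta i \<and> of_int (k - m) = \<delta> i"
    then have "\<alpha> = outward u i" using pl po by (intro all) auto
    then show ?thesis using a m by (auto simp: level_def)
  next
    assume a: "axis v + axis w = - theta i \<and> of_int (k - m) = - \<delta> i"
    then have "\<alpha> = - outward u i" using pl po by (intro all) auto
    then show ?thesis using a m by (auto simp: level_def algebra_simps)
  qed
qed

lemma refl_level:
  assumes "\<alpha> \<bullet> \<alpha> \<noteq> 0"
  shows "refl_map \<alpha> k z \<bullet> \<alpha> = 2 * of_int k - z \<bullet> \<alpha>"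
  using assms by (simp add: refl_map_def inner_diff_left field_simps)

context
  fixes u c i
  assumes u: "signed_perm n u" "lattice c" and i: "i \<le> n"
begin

lemma next_alcove: "signed_perm n (step i u)" "lattice (next_shift i u c)" "alcove (step i u) (next_shift i u c) \<in> alcoves e"
  using signed_perm_step_n[OF u(1)] lattice_next_shift[OF u] alcove_in_alcoves by auto

text \<open>
  The wall is fixed pointwise by the reflection, so both alcoves have the same facet in it.
\<close>

lemma place_step_fixes:
  assumes "x \<in> facet0 i"
  shows "place (step i u) (next_shift i u c) x = place u c x"
proof -
  obtain k :: int where k: "level u c i = k" by (rule level_int[OF u i])
  have "x \<bullet> theta i = \<delta> i" using assms wall_eq[OF i] by (auto simp: facet0_def inner_commute)
  then have "place u c x \<bullet> outward u i = k" using place_outward[OF u(1) i, of c x] k by (simp add: level_def)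
  then show ?thesis using fun_cong[OF place_step[OF u(1) i k], of x] by (simp add: refl_map_def)
qed

lemma next_facet: "place (step i u) (next_shift i u c) ` facet0 i = place u c ` facet0 i"
  using place_step_fixes by (auto intro!: image_cong)

lemma above_level:
  assumes "z \<in> alcove (step i u) (next_shift i u c)"
  shows "level u c i < z \<bullet> outward u i"
proof -
  obtain k :: int where k: "level u c i = k" by (rule level_int[OF u i])
  obtain x where x: "x \<in> A\<^sub>0" "z = place (step i u) (next_shift i u c) x" using assms by (auto simp: alcove_def)
  have "z = refl_map (outward u i) k (place u c x)" using place_step[OF u(1) i k] x by (auto simp: fun_eq_iff)
  moreover have "outward u i \<bullet> outward u i \<noteq> 0"
    using root_sqnorm[OF label_padded[OF u(1), of i], of "- padded u (Suc i)"] label_padded[OF u(1), of "Suc i"]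
      padded_distinct[OF u(1) i] i unfolding outward_alt[OF u(1) i] by auto
  ultimately have "z \<bullet> outward u i = 2 * k - place u c x \<bullet> outward u i" by (simp add: refl_level)
  moreover have "place u c x \<bullet> outward u i < k" using below_level[OF u(1) i, of "place u c x" c] x k by (simp add: alcove_def)
  ultimately show ?thesis using k by simp
qed

lemma mid_in_closure:
  assumes "B \<in> alcoves e" "place u c ` facet0 i \<subseteq> closure B"
  shows "place u c (mid i) \<in> closure B"
  using assms(2) mid_in_facet0[OF i] by auto

lemma facet_in_closure: "place u c ` facet0 i \<subseteq> closure (alcove u c)"
  "place u c ` facet0 i \<subseteq> closure (alcove (step i u) (next_shift i u c))"
proof -
  show "place u c ` facet0 i \<subseteq> closure (alcove u c)"
    unfolding alcove_def closure_place[OF u(1)] by (auto simp: facet0_def)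
  show "place u c ` facet0 i \<subseteq> closure (alcove (step i u) (next_shift i u c))"
    unfolding alcove_def closure_place[OF next_alcove(1)] next_facet[symmetric] by (auto simp: facet0_def)
qed

text \<open>
  Two alcoves that contain the facet in their closures are separated by no hyperplane but the wall.
\<close>

lemma same_side_across:
  assumes B: "B \<in> alcoves e" "place u c ` facet0 i \<subseteq> closure B" "b \<in> B"
    and B': "B' \<in> alcoves e" "place u c ` facet0 i \<subseteq> closure B'" "b' \<in> B'"
    and \<alpha>: "\<alpha> \<in> roots e" and ne: "\<not> ((\<alpha> = outward u i \<and> of_int k = level u c i) \<or> (\<alpha> = - outward u i \<and> of_int k = - level u c i))"
  shows "0 < (b \<bullet> \<alpha> - of_int k) * (b' \<bullet> \<alpha> - of_int k)"
proof -
  let ?q = "place u c (mid i)"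
  have q: "?q \<bullet> \<alpha> \<noteq> of_int k" using mid_only_wall[OF u i \<alpha>] ne by blast
  have "0 < (b \<bullet> \<alpha> - of_int k) * (?q \<bullet> \<alpha> - of_int k)"
    by (rule closure_side[OF B(1,3) mid_in_closure[OF B(1,2)] \<alpha> q])
  moreover have "0 < (b' \<bullet> \<alpha> - of_int k) * (?q \<bullet> \<alpha> - of_int k)"
    by (rule closure_side[OF B'(1,3) mid_in_closure[OF B'(1,2)] \<alpha> q])
  ultimately show ?thesis by (auto simp: zero_less_mult_iff)
qed

text \<open>
  On its own side of the wall the alcove is determined, and so is the one on the other side.
\<close>

lemma adjacent_alcove:
  assumes B: "B \<in> alcoves e" "place u c ` facet0 i \<subseteq> closure B" "B \<noteq> alcove u c"
  shows "B = alcove (step i u) (next_shift i u c)"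
proof -
  obtain k :: int where k: "level u c i = k" by (rule level_int[OF u i])
  obtain b where b: "b \<in> B" using alcove_nonempty[OF B(1)] by auto
  have eq: "B = A'" if A': "A' \<in> alcoves e" "place u c ` facet0 i \<subseteq> closure A'" "a \<in> A'"
      and s: "0 < (b \<bullet> outward u i - k) * (a \<bullet> outward u i - k)" for A' a
  proof -
    have "0 < (b \<bullet> \<alpha> - of_int m) * (a \<bullet> \<alpha> - of_int m)" if "\<alpha> \<in> roots e" for \<alpha> m
    proof (cases "(\<alpha> = outward u i \<and> of_int m = level u c i) \<or> (\<alpha> = - outward u i \<and> of_int m = - level u c i)")
      case True
      then show ?thesis
      proof
        assume "\<alpha> = outward u i \<and> of_int m = level u c i"
        then show ?thesis using s k by simp
      next
        assume "\<alpha> = - outward u i \<and> of_int m = - level u c i"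
        then have "(b \<bullet> \<alpha> - of_int m) * (a \<bullet> \<alpha> - of_int m) = (b \<bullet> outward u i - k) * (a \<bullet> outward u i - k)"
          using k by (simp add: algebra_simps)
        then show ?thesis using s by simp
      qed
    next
      case False
      then show ?thesis using same_side_across[OF B(1,2) b A' that] by blast
    qed
    then have "b \<in> cell a" by (auto simp: cell_def)
    then have "b \<in> A'" using alcoves_eq_cell(1)[OF A'(1,3)] by simp
    then show ?thesis using alcoves_eq_cell(1)[OF A'(1)] alcoves_eq_cell(1)[OF B(1) b] by simp
  qed
  have ne: "b \<bullet> outward u i \<noteq> k"
    using alcoves_eq_cell(2)[OF B(1) b] outward_in_roots[OF u(1) i] by (auto simp: regular_iff)
  have A: "alcove u c \<in> alcoves e" by (rule alcove_in_alcoves[OF u])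
  show ?thesis
  proof (cases "b \<bullet> outward u i < k")
    case True
    have "place u c rho \<bullet> outward u i < k" using below_level[OF u(1) i center_in_alcove[of u c]] k by simp
    then have "B = alcove u c"
      using True by (intro eq[OF A facet_in_closure(1) center_in_alcove] mult_neg_neg) auto
    then show ?thesis using B(3) by simp
  next
    case False
    have "k < place (step i u) (next_shift i u c) rho \<bullet> outward u i" using above_level[OF center_in_alcove] k by simp
    then show ?thesis
      using False ne by (intro eq[OF next_alcove(3) facet_in_closure(2) center_in_alcove] mult_pos_pos) auto
  qed
qed

text \<open>
  A root and its negative describe the same hyperplane, so the condition
  in \<open>allowed_step\<close> can be tested on the outward normal.
\<close>

lemma separates_wall:
  assumes "\<alpha> \<in> roots e" "place u c ` facet0 i \<subseteq> hyperplane \<alpha> k"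
  shows "separates \<alpha> k (alcove u c) A\<^sub>0 \<longleftrightarrow> (\<forall>y\<in>A\<^sub>0. level u c i < y \<bullet> outward u i)"
proof -
  have "place u c (mid i) \<bullet> \<alpha> = k" using assms(2) mid_in_facet0[OF i] by (auto simp: hyperplane_def)
  then have "(\<alpha> = outward u i \<and> of_int k = level u c i) \<or> (\<alpha> = - outward u i \<and> of_int k = - level u c i)"
    by (rule mid_only_wall[OF u i assms(1)])
  then have "separates \<alpha> k (alcove u c) A\<^sub>0 \<longleftrightarrow> (\<forall>x\<in>alcove u c. \<forall>y\<in>A\<^sub>0. (x \<bullet> outward u i - level u c i) * (y \<bullet> outward u i - level u c i) < 0)"
  proof
    assume "\<alpha> = - outward u i \<and> of_int k = - level u c i"
    moreover have "(x \<bullet> - outward u i - - level u c i) * (y \<bullet> - outward u i - - level u c i)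
      = (x \<bullet> outward u i - level u c i) * (y \<bullet> outward u i - level u c i)" for x y :: "real ^ 'n"
      by (simp add: algebra_simps)
    ultimately show ?thesis by (simp only: separates_def)
  qed (simp add: separates_def)
  also have "\<dots> \<longleftrightarrow> (\<forall>y\<in>A\<^sub>0. level u c i < y \<bullet> outward u i)"
  proof
    assume "\<forall>x\<in>alcove u c. \<forall>y\<in>A\<^sub>0. (x \<bullet> outward u i - level u c i) * (y \<bullet> outward u i - level u c i) < 0"
    then have "(place u c rho \<bullet> outward u i - level u c i) * (y \<bullet> outward u i - level u c i) < 0" if "y \<in> A\<^sub>0" for y
      using that center_in_alcove[of u c] by blast
    then show "\<forall>y\<in>A\<^sub>0. level u c i < y \<bullet> outward u i"
      using below_level[OF u(1) i center_in_alcove[of u c]] by (auto simp: mult_less_0_iff)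
  next
    assume "\<forall>y\<in>A\<^sub>0. level u c i < y \<bullet> outward u i"
    then show "\<forall>x\<in>alcove u c. \<forall>y\<in>A\<^sub>0. (x \<bullet> outward u i - level u c i) * (y \<bullet> outward u i - level u c i) < 0"
      using below_level[OF u(1) i] by (auto intro!: mult_neg_pos)
  qed
  finally show ?thesis .
qed

lemma allowed_stepD:
  assumes "allowed_step e i (alcove u c) B"
  shows "B = alcove (step i u) (next_shift i u c)" and "\<not> (\<forall>y\<in>A\<^sub>0. level u c i < y \<bullet> outward u i)"
proof -
  obtain F \<alpha> k where F: "typed_facet e i (alcove u c) F" "F facet_of closure B" "\<alpha> \<in> roots e" "F \<subseteq> hyperplane \<alpha> k"
    "\<not> separates \<alpha> k (alcove u c) A\<^sub>0" and B: "B \<in> alcoves e" "alcove u c \<noteq> B"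
    using assms unfolding allowed_step_def by blast
  have F': "F = place u c ` facet0 i" by (rule typed_facet_alcove[OF u i F(1)])
  show "B = alcove (step i u) (next_shift i u c)"
    using B F(2) facet_of_imp_subset by (intro adjacent_alcove) (auto simp: F'[symmetric])
  show "\<not> (\<forall>y\<in>A\<^sub>0. level u c i < y \<bullet> outward u i)"
    using separates_wall[OF F(3)] F(4,5) unfolding F' by blast
qed

lemma allowed_stepI:
  assumes g: "place u c \<in> affine_weyl_group e" and "\<not> (\<forall>y\<in>A\<^sub>0. level u c i < y \<bullet> outward u i)"
  shows "allowed_step e i (alcove u c) (alcove (step i u) (next_shift i u c))"
proof -
  obtain k :: int where k: "level u c i = k" by (rule level_int[OF u i])
  let ?F = "place u c ` facet0 i" and ?B = "alcove (step i u) (next_shift i u c)"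
  have "alcove u c \<noteq> ?B"
  proof
    assume "alcove u c = ?B"
    then have "level u c i < place u c rho \<bullet> outward u i" using above_level center_in_alcove[of u c] by blast
    then show False using below_level[OF u(1) i center_in_alcove[of u c]] by simp
  qed
  moreover have "?F facet_of closure ?B"
    unfolding alcove_def closure_place[OF next_alcove(1)] next_facet[symmetric]
    by (rule facet_place[OF next_alcove(1) facet0_facet[OF i]])
  moreover have "?F \<subseteq> hyperplane (outward u i) k"
  proof
    fix z assume "z \<in> ?F"
    then obtain x where "z = place u c x" "x \<bullet> theta i = \<delta> i" using wall_eq[OF i] by (auto simp: facet0_def inner_commute)
    then show "z \<in> hyperplane (outward u i) k" using place_outward[OF u(1) i, of c x] k by (simp add: hyperplane_def level_def)
  qed
  moreover have "\<not> separates (outward u i) k (alcove u c) A\<^sub>0"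
    using separates_wall[OF outward_in_roots[OF u(1) i] calculation(3)] assms(2) by blast
  ultimately show ?thesis
    unfolding allowed_step_def
    using alcove_in_alcoves[OF u] next_alcove(3) typed_facet_place[OF i g] outward_in_roots[OF u(1) i] by blast
qed

lemma next_in_group:
  assumes "place u c \<in> affine_weyl_group e"
  shows "place (step i u) (next_shift i u c) \<in> affine_weyl_group e"
proof -
  obtain k :: int where k: "level u c i = k" by (rule level_int[OF u i])
  show ?thesis
    using affine_weyl_group.refl[OF assms outward_in_roots[OF u(1) i], of k] place_step[OF u(1) i k] by simp
qed

lemma move_iff: "i \<in> moves u \<longleftrightarrow> 0 < padded u i + (- padded u (Suc i))"
  using i signed_perm_length[OF u(1)] by (simp add: moves_def)

lemma chamber_outward:
  assumes "z \<in> C\<^sub>0"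
  shows "if i \<in> moves u then 0 < z \<bullet> outward u i else z \<bullet> outward u i < 0"
  using chamber_root_pos[OF assms label_padded[OF u(1)], of i "- padded u (Suc i)"]
    chamber_root_neg[OF assms label_padded[OF u(1)], of i "- padded u (Suc i)"]
    label_padded[OF u(1), of "Suc i"] padded_distinct[OF u(1) i] i
  unfolding move_iff outward_alt[OF u(1) i] by auto

lemma A0_outward_bound: "y \<in> A\<^sub>0 \<Longrightarrow> \<bar>y \<bullet> outward u i\<bar> < 1"
  using A0_axis_bound[of y "padded u i"] A0_axis_bound[of y "padded u (Suc i)"] label_padded[OF u(1), of i] label_padded[OF u(1), of "Suc i"] i
  by (simp add: outward_def inner_diff_right)

text \<open>
  Inside the chamber a positive root takes positive values, and the level of the wall is an integer above
  some of its values.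
\<close>

lemma move_level_pos:
  assumes "i \<in> moves u" "alcove u c \<subseteq> C\<^sub>0"
  shows "1 \<le> level u c i"
proof -
  obtain k :: int where k: "level u c i = k" by (rule level_int[OF u i])
  have "0 < place u c rho \<bullet> outward u i" using chamber_outward[of "place u c rho"] assms center_in_alcove[of u c] by auto
  then have "0 < level u c i" using below_level[OF u(1) i center_in_alcove[of u c]] by simp
  then show ?thesis using k by simp
qed

lemma move_allowed:
  assumes "i \<in> moves u" "alcove u c \<subseteq> C\<^sub>0" "place u c \<in> affine_weyl_group e"
  shows "allowed_step e i (alcove u c) (alcove (step i u) (next_shift i u c))"
proof (rule allowed_stepI[OF assms(3)], rule notI)
  assume "\<forall>y\<in>A\<^sub>0. level u c i < y \<bullet> outward u i"
  then have "level u c i < rho \<bullet> outward u i" using rho_in_A0 by blast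
  then show False using move_level_pos[OF assms(1,2)] A0_outward_bound[OF rho_in_A0] by (simp add: abs_less_iff)
qed

text \<open>
  The wall has positive level, so it is none of the walls of the chamber, and the signs of the simple
  roots survive the crossing.
\<close>

lemma move_in_chamber:
  assumes "i \<in> moves u" "alcove u c \<subseteq> C\<^sub>0"
  shows "alcove (step i u) (next_shift i u c) \<subseteq> C\<^sub>0"
proof
  fix z assume z: "z \<in> alcove (step i u) (next_shift i u c)"
  show "z \<in> C\<^sub>0" unfolding identity_chamber_def n_eq[symmetric]
  proof (intro CollectI allI impI)
    fix j assume j: "j < n"
    have "0 < (z \<bullet> simple_root e j - of_int 0) * (place u c rho \<bullet> simple_root e j - of_int 0)"
    proof (rule same_side_across[OF next_alcove(3) facet_in_closure(2) z alcove_in_alcoves[OF u] facet_in_closure(1) center_in_alcove simple_root_in_roots[OF j]])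
      show "\<not> (simple_root e j = outward u i \<and> of_int 0 = level u c i \<or> simple_root e j = - outward u i \<and> of_int 0 = - level u c i)"
        using move_level_pos[OF assms] by auto
    qed
    moreover have "0 < place u c rho \<bullet> simple_root e j"
      using assms(2) center_in_alcove[of u c] j unfolding identity_chamber_def n_eq[symmetric] by auto
    ultimately show "0 < z \<bullet> simple_root e j" by (simp add: zero_less_mult_iff)
  qed
qed

text \<open>
  A wall with negative outward normal has negative level if its far side meets the chamber; it then
  separates the alcove from the fundamental one.
\<close>

lemma allowed_in_chamber_move:
  assumes "allowed_step e i (alcove u c) B" "B \<subseteq> C\<^sub>0"
  shows "i \<in> moves u"
proof (rule ccontr)
  assume "i \<notin> moves u"
  obtain k :: int where k: "level u c i = k" by (rule level_int[OF u i])
  have B: "B = alcove (step i u) (next_shift i u c)" by (rule allowed_stepD(1)[OF assms(1)])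
  obtain z where z: "z \<in> B" using alcove_nonempty[OF next_alcove(3)] unfolding B by blast
  have "z \<bullet> outward u i < 0" using chamber_outward[of z] z assms(2) \<open>i \<notin> moves u\<close> by auto
  moreover have "level u c i < z \<bullet> outward u i" using above_level z unfolding B by blast
  ultimately have "real_of_int k < 0" using k by linarith
  then have "k \<le> - 1" by simp
  then have "level u c i \<le> - 1" using k by simp
  then have "\<forall>y\<in>A\<^sub>0. level u c i < y \<bullet> outward u i" using A0_outward_bound by (fastforce simp: abs_less_iff)
  then show False using allowed_stepD(2)[OF assms(1)] by blast
qed

text \<open>
  If a wall of the chamber separates the alcove from the fundamental one, then it cannot
  be crossed back.
\<close>

lemma allowed_no_return:
  assumes "allowed_step e i (alcove u c) B" "\<not> alcove u c \<subseteq> C\<^sub>0"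
  shows "\<not> B \<subseteq> C\<^sub>0"
proof -
  have B: "B = alcove (step i u) (next_shift i u c)" by (rule allowed_stepD(1)[OF assms(1)])
  obtain z where z: "z \<in> alcove u c" "z \<notin> C\<^sub>0" using assms(2) by blast
  then obtain j where j: "j < n" "\<not> 0 < z \<bullet> simple_root e j" unfolding identity_chamber_def n_eq[symmetric] by blast
  let ?\<alpha> = "simple_root e j"
  have r: "?\<alpha> \<in> roots e" by (rule simple_root_in_roots[OF j(1)])
  have "z \<in> regular" using alcove_regular[OF u] z(1) by blast
  then have "z \<bullet> ?\<alpha> \<noteq> of_int 0" using r unfolding regular_iff by blast
  then have neg: "z \<bullet> ?\<alpha> < 0" using j(2) by simp
  have pos: "0 < y \<bullet> ?\<alpha>" if "y \<in> A\<^sub>0" for y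
    using that j(1) unfolding fundamental_alcove_def n_eq[symmetric] by blast
  have ne: "\<not> (?\<alpha> = outward u i \<and> of_int 0 = level u c i \<or> ?\<alpha> = - outward u i \<and> of_int 0 = - level u c i)"
  proof
    assume "?\<alpha> = outward u i \<and> of_int 0 = level u c i \<or> ?\<alpha> = - outward u i \<and> of_int 0 = - level u c i"
    then show False
    proof
      assume "?\<alpha> = outward u i \<and> of_int 0 = level u c i"
      then have "\<forall>y\<in>A\<^sub>0. level u c i < y \<bullet> outward u i" using pos by auto
      then show False using allowed_stepD(2)[OF assms(1)] by blast
    next
      assume "?\<alpha> = - outward u i \<and> of_int 0 = - level u c i"
      then show False using below_level[OF u(1) i z(1)] neg by auto
    qed
  qed
  obtain b where b: "b \<in> B" using alcove_nonempty[OF next_alcove(3)] unfolding B by blast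
  have "0 < (b \<bullet> ?\<alpha> - of_int 0) * (z \<bullet> ?\<alpha> - of_int 0)"
    using same_side_across[OF next_alcove(3) facet_in_closure(2) _ alcove_in_alcoves[OF u] facet_in_closure(1) z(1) r ne] b
    unfolding B by blast
  then have "b \<bullet> ?\<alpha> < 0" using neg by (simp add: zero_less_mult_iff)
  then have "b \<notin> C\<^sub>0" using j(1) unfolding identity_chamber_def n_eq[symmetric] by fastforce
  then show ?thesis using b by blast
qed

end

section \<open>Alcoves along a history\<close>

primrec shift :: "nat list \<Rightarrow> real ^ 'n" where
  "shift [] = 0"
| "shift (i # p) = next_shift i (word n p) (shift p)"

definition alcove_of :: "nat list \<Rightarrow> (real ^ 'n) set" where
  "alcove_of p = alcove (word n p) (shift p)"

text \<open>
  No wall of the chamber bounds the alcove. There the reduced walk and the uniform choice among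
  moves have the same transition probabilities.
\<close>

definition interior_history :: "nat list \<Rightarrow> bool" where
  "interior_history p \<longleftrightarrow> (\<forall>i\<le>n. alcove_of (i # p) \<subseteq> C\<^sub>0)"

lemma signed_perm_history: "signed_perm n (word n p)" by (rule signed_perm_word[OF n_pos])

lemma lattice_shift: "lattice (shift p)"
  by (induction p) (auto simp: lattice_next_shift[OF signed_perm_history], simp add: lattice_def)

lemma alcove_of_Nil: "alcove_of [] = A\<^sub>0"
  by (simp add: alcove_of_def alcove_def place_id_word del: word.simps)

lemma alcove_of_Cons: "alcove_of (i # p) = alcove (step i (word n p)) (next_shift i (word n p) (shift p))"
  by (simp add: alcove_of_def)

lemma moves_le: "i \<in> moves (word n p) \<Longrightarrow> i \<le> n"
  using length_word[OF n_pos, of p] by (simp add: moves_def)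

lemma valid_in_group: "valid n p \<Longrightarrow> place (word n p) (shift p) \<in> affine_weyl_group e"
proof (induction p)
  case Nil
  show ?case unfolding shift.simps place_id_word by (rule affine_weyl_group.id)
next
  case (Cons i p)
  then show ?case using next_in_group[OF signed_perm_history lattice_shift moves_le[of i p]] by simp
qed

lemma valid_in_chamber: "valid n p \<Longrightarrow> alcove_of p \<subseteq> C\<^sub>0"
proof (induction p)
  case Nil
  show ?case unfolding alcove_of_Nil by (rule A0_subset_chamber)
next
  case (Cons i p)
  then show ?case using move_in_chamber[OF signed_perm_history lattice_shift moves_le[of i p], of p p] by (simp add: alcove_of_Cons alcove_of_def)
qed

lemma valid_allowed:
  assumes "valid n p" "i \<in> moves (word n p)"
  shows "allowed_step e i (alcove_of p) (alcove_of (i # p))"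
  using move_allowed[OF signed_perm_history lattice_shift moves_le[OF assms(2)] assms(2)] valid_in_chamber[OF assms(1)] valid_in_group[OF assms(1)]
  by (simp add: alcove_of_def)

lemma allowed_target:
  assumes "i \<le> n" "allowed_step e i (alcove_of p) B"
  shows "B = alcove_of (i # p)"
  unfolding alcove_of_Cons by (rule allowed_stepD(1)[OF signed_perm_history lattice_shift assms(1) assms(2)[unfolded alcove_of_def]])

lemma allowed_valid:
  assumes "i \<le> n" "allowed_step e i (alcove_of p) B" "B \<subseteq> C\<^sub>0"
  shows "i \<in> moves (word n p)"
  by (rule allowed_in_chamber_move[OF signed_perm_history lattice_shift assms(1) assms(2)[unfolded alcove_of_def] assms(3)])

lemma alcove_of_Cons_inj:
  assumes "i \<le> n" "j \<le> n" "alcove_of (i # p) = alcove_of (j # p)"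
  shows "i = j"
proof -
  have "step i (word n p) = step j (word n p)" "next_shift i (word n p) (shift p) = next_shift j (word n p) (shift p)"
    using alcove_inj[OF signed_perm_history[of "i # p"] lattice_shift[of "i # p"] signed_perm_history[of "j # p"] lattice_shift[of "j # p"]] assms(3)
    by (auto simp: alcove_of_def)
  moreover have len: "length (word n p) = n" by (rule length_word[OF n_pos])
  moreover have "axis (word n p ! (n - 1)) \<noteq> 0" using inner_axis_nth[OF signed_perm_history[of p], of "n - 1" "n - 1"] n_pos by auto
  ultimately have nn: "i = n \<longleftrightarrow> j = n" unfolding next_shift_def by (cases "i = n"; cases "j = n") simp_all
  have aux: "step a (word n p) \<noteq> step b (word n p)" if "a < b" "b < n" for a b
  proof
    assume eq: "step a (word n p) = step b (word n p)"
    have ne: "word n p \<noteq> []" using len n_pos by auto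
    have "step a (word n p) ! b = padded (word n p) (Suc b)"
      using step_nth[OF ne, of a b] that len by (simp add: padded_def)
    moreover have "step b (word n p) ! b = padded (word n p) b"
      using step_nth[OF ne, of b b] that len by simp
    ultimately show False using padded_distinct[OF signed_perm_history[of p], of b] eq that by simp
  qed
  show ?thesis
  proof (cases "i = n")
    case False
    then show ?thesis
      using nn assms aux[of i j] aux[of j i] \<open>step i (word n p) = step j (word n p)\<close> by (metis le_neq_implies_less linorder_neqE_nat)
  qed (use nn in simp)
qed

definition options :: "nat list \<Rightarrow> nat set" where
  "options p = {i. i \<le> CARD('n) \<and> (\<exists>C. allowed_step e i (alcove_of p) C)}"

lemma options_bounds:
  assumes "valid n p"
  shows "finite (options p)" "moves (word n p) \<subseteq> options p" "card (options p) \<le> Suc n"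
    "0 < card (options p)"
proof -
  have sub: "options p \<subseteq> {..n}" by (auto simp: options_def n_eq[symmetric])
  show fin: "finite (options p)" using sub finite_subset by blast
  show m: "moves (word n p) \<subseteq> options p"
    using valid_allowed[OF assms] moves_le[of _ p] by (auto simp: options_def n_eq[symmetric])
  show "card (options p) \<le> Suc n" using card_mono[OF _ sub] by simp
  show "0 < card (options p)" using fin m moves_word_nonempty[OF n_pos, of p] by (auto simp: card_gt_0_iff)
qed

text \<open>
  As all weights are equal, only the number of admissible types enters; the type that
  leads to a given alcove is unique.
\<close>

lemma transition_valid:
  assumes "valid n p" "i \<in> moves (word n p)"
  shows "transition_prob e dual_kac_label (alcove_of p) (alcove_of (i # p)) = 1 / card (options p)"
proof -
  have i: "i \<le> n" by (rule moves_le[OF assms(2)])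
  have "{j. j \<le> CARD('n) \<and> allowed_step e j (alcove_of p) (alcove_of (i # p))} = {i}"
  proof (intro equalityI subsetI)
    fix j assume "j \<in> {j. j \<le> CARD('n) \<and> allowed_step e j (alcove_of p) (alcove_of (i # p))}"
    then have j: "j \<le> n" "allowed_step e j (alcove_of p) (alcove_of (i # p))" by (simp_all add: n_eq[symmetric])
    show "j \<in> {i}" using alcove_of_Cons_inj[OF i j(1) allowed_target[OF j]] by simp
  qed (use valid_allowed[OF assms] i in \<open>simp add: n_eq[symmetric]\<close>)
  then show ?thesis unfolding transition_prob_def options_def[symmetric] by (simp add: dual_kac_label_def)
qed

lemma options_interior:
  assumes "valid n p" "interior_history p"
  shows "options p = moves (word n p)"
proof
  show "options p \<subseteq> moves (word n p)"
  proof
    fix i assume "i \<in> options p"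
    then obtain B where i: "i \<le> n" "allowed_step e i (alcove_of p) B" by (auto simp: options_def n_eq[symmetric])
    have "B \<subseteq> C\<^sub>0" using allowed_target[OF i] assms(2) i(1) by (auto simp: interior_history_def)
    then show "i \<in> moves (word n p)" using allowed_valid[OF i] by blast
  qed
qed (rule options_bounds(2)[OF assms(1)])

lemma no_return:
  assumes "i \<le> n" "allowed_step e i A B" "B \<subseteq> C\<^sub>0"
  shows "A \<subseteq> C\<^sub>0"
proof -
  obtain F where "typed_facet e i A F" using assms(2) unfolding allowed_step_def by blast
  then obtain u c where u: "signed_perm n u" "lattice c" and A: "A = alcove u c" by (rule typed_facet_shape)
  have "\<not> alcove u c \<subseteq> C\<^sub>0 \<Longrightarrow> \<not> B \<subseteq> C\<^sub>0"
    by (rule allowed_no_return[OF u assms(1) assms(2)[unfolded A]])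
  with assms(3) show ?thesis unfolding A by argo
qed

section \<open>Displacement along a history\<close>

lemma alcove_near_center:
  assumes "signed_perm n u" "label v" "z \<in> alcove u c"
  shows "\<bar>z \<bullet> axis v - c \<bullet> axis v\<bar> < 1 / 2"
proof -
  obtain x where x: "x \<in> A\<^sub>0" "z = place u c x" using assms(3) by (auto simp: alcove_def)
  obtain v' j where "label v'" "j < n" "v' = int (Suc j) \<and> v = u ! j \<or> v' = - int (Suc j) \<and> v = - u ! j"
    "\<forall>x c. (place u c x - c) \<bullet> axis v = x \<bullet> axis v'" by (rule pull_label[OF assms(1,2)])
  then show ?thesis using A0_axis_bound[OF x(1), of v'] x(2) by (simp add: inner_diff_left)
qed

lemma next_shift_close:
  assumes "signed_perm n u" "label v"
  shows "\<bar>next_shift i u c \<bullet> axis v - c \<bullet> axis v\<bar> \<le> 1"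
  using inner_axis[OF label_nth[OF assms(1), of "n - 1"] assms(2)] n_pos by (auto simp: next_shift_def inner_add_left)

text \<open>
  One step moves the translation part by at most \<open>1\<close> in each coordinate, and the points of an alcove
  differ from it by less than \<open>1 / 2\<close>. So each coordinate is controlled up to \<open>3 / 2\<close>, and the
  difference of two coordinates up to \<open>3\<close>.
\<close>

lemma interior_if_far:
  assumes "2 < shift p \<bullet> e 1" "\<And>a. 1 \<le> a \<Longrightarrow> a < n \<Longrightarrow> 3 < shift p \<bullet> e (Suc a) - shift p \<bullet> e a"
  shows "interior_history p"
  unfolding interior_history_def
proof (intro allI impI subsetI)
  fix i z assume i: "i \<le> n" and z: "z \<in> alcove_of (i # p)"
  have near: "\<bar>z \<bullet> e a - shift p \<bullet> e a\<bar> < 3 / 2" if "1 \<le> a" "a \<le> n" for a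
  proof -
    have l: "label (int a)" "axis (int a) = e a" using that by (auto simp: label_int axis_int)
    have "\<bar>z \<bullet> e a - shift (i # p) \<bullet> e a\<bar> < 1 / 2"
      using alcove_near_center[OF signed_perm_history[of "i # p"] l(1), of z "shift (i # p)"] z l(2) by (simp add: alcove_of_def)
    moreover have "\<bar>shift (i # p) \<bullet> e a - shift p \<bullet> e a\<bar> \<le> 1"
      using next_shift_close[OF signed_perm_history[of p] l(1), of i "shift p"] l(2) by simp
    ultimately show ?thesis by linarith
  qed
  show "z \<in> C\<^sub>0"
    unfolding chamber_iff
  proof (intro conjI allI impI)
    have "\<bar>z \<bullet> e 1 - shift p \<bullet> e 1\<bar> < 3 / 2" by (rule near) (use n_pos in auto)
    then show "0 < z \<bullet> e 1" using assms(1) by linarith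
    fix a assume a: "1 \<le> a" "a < n"
    have "\<bar>z \<bullet> e a - shift p \<bullet> e a\<bar> < 3 / 2" "\<bar>z \<bullet> e (Suc a) - shift p \<bullet> e (Suc a)\<bar> < 3 / 2"
      by (rule near; use a in simp)+
    then show "z \<bullet> e a < z \<bullet> e (Suc a)" using assms(2)[OF a] by linarith
  qed
qed

text \<open>
  Pairing with \<open>e k + \<dots> + e n\<close> gives the charge with threshold \<open>k\<close>. Single coordinates are
  recovered as differences.
\<close>

definition tail_sum :: "nat \<Rightarrow> real ^ 'n" where
  "tail_sum k = (\<Sum>a = k..n. e a)"

lemma axis_tail_sum:
  assumes "label v" "1 \<le> k"
  shows "axis v \<bullet> tail_sum k = of_int (charge k v)"
proof -
  have ek: "e b \<bullet> tail_sum k = of_bool (k \<le> b)" if "1 \<le> b" "b \<le> n" for b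
  proof -
    have "e b \<bullet> tail_sum k = (\<Sum>a = k..n. if b = a then 1 else 0)"
      unfolding tail_sum_def inner_sum_right using that assms(2) by (intro sum.cong HOL.refl) (auto simp: inner_e)
    then show ?thesis using that by (auto simp: sum.delta')
  qed
  from assms(1) show ?thesis
  proof (cases rule: label_cases)
    case (1 i)
    then show ?thesis using ek[of i] assms(2) by (auto simp: axis_int charge_def)
  next
    case (2 i)
    then show ?thesis using ek[of i] assms(2) by (auto simp: axis_int axis_minus label_int charge_def)
  qed
qed

lemma shift_tail_sum: "1 \<le> k \<Longrightarrow> shift p \<bullet> tail_sum k = path_sum n (exit_charge k) p"
proof (induction p)
  case (Cons i p)
  have len: "length (word n p) = n" by (rule length_word[OF n_pos])
  then have "last (word n p) = word n p ! (n - 1)" using n_pos by (subst last_conv_nth) auto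
  then show ?case
    using Cons axis_tail_sum[OF label_nth[OF signed_perm_history[of p], of "n - 1"] Cons.prems] n_pos len
    by (simp add: next_shift_def inner_add_left exit_charge_def)
qed simp

lemma tail_sum_diff:
  assumes "1 \<le> a" "a \<le> n"
  shows "e a = tail_sum a - (if a = n then 0 else tail_sum (Suc a))"
  using assms by (auto simp: tail_sum_def sum.atLeast_Suc_atMost)

definition direction :: "real ^ 'n" where
  "direction = (\<Sum>i = 1..n. (2 * real i + 1) *\<^sub>R e i)"

lemma inner_direction: "1 \<le> a \<Longrightarrow> a \<le> n \<Longrightarrow> direction \<bullet> e a = 2 * real a + 1"
proof -
  assume a: "1 \<le> a" "a \<le> n"
  have "direction \<bullet> e a = (\<Sum>i = 1..n. if a = i then 2 * real i + 1 else 0)"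
    unfolding direction_def inner_sum_left using a by (intro sum.cong HOL.refl) (auto simp: inner_e)
  then show ?thesis using a by (auto simp: sum.delta')
qed

text \<open>
  The rates \<open>(n + 1)\<^sup>2 - k\<^sup>2\<close> of the tail sums differ by \<open>2 k + 1\<close>.
\<close>

lemma center_tendsto:
  assumes len: "\<And>j. 0 < length (p j)" "filterlim (\<lambda>j. length (p j)) at_top sequentially"
    and mart: "\<And>\<xi>. \<xi> \<in> observables n \<Longrightarrow> (\<lambda>j. mart n \<xi> (p j) / length (p j)) \<longlonglongrightarrow> 0"
  shows "(\<lambda>j. shift (p j) /\<^sub>R clock n (p j)) \<longlonglongrightarrow> (1 / (2 * real n * (2 * real n + 1))) *\<^sub>R direction"
proof -
  define \<kappa> where "\<kappa> = 2 * real n * (2 * real n + 1)"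
  let ?f = "\<lambda>j. shift (p j) /\<^sub>R clock n (p j)"
  have tail: "(\<lambda>j. ?f j \<bullet> tail_sum k) \<longlonglongrightarrow> ((real n + 1)\<^sup>2 - (real k)\<^sup>2) / \<kappa>" if "1 \<le> k" "k \<le> n" for k
  proof -
    have "?f j \<bullet> tail_sum k = path_sum n (exit_charge k) (p j) / clock n (p j)" for j
      unfolding inner_scaleR_left shift_tail_sum[OF that(1)] by (simp only: divide_inverse mult.commute)
    moreover have "(\<lambda>j. path_sum n (exit_charge k) (p j) / clock n (p j)) \<longlonglongrightarrow> ((real n + 1)\<^sup>2 - (real k)\<^sup>2) / \<kappa>"
      unfolding \<kappa>_def by (rule exit_rate_tendsto[OF that len]) (rule mart)
    ultimately show ?thesis by (simp only:)
  qed
  have comp: "(\<lambda>j. ?f j \<bullet> e a) \<longlonglongrightarrow> ((1 / \<kappa>) *\<^sub>R direction) \<bullet> e a" if a: "1 \<le> a" "a \<le> n" for a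
  proof (cases "a = n")
    case True
    have e: "e a = tail_sum a" using tail_sum_diff[OF a] True by simp
    have d: "((1 / \<kappa>) *\<^sub>R direction) \<bullet> e a = ((real n + 1)\<^sup>2 - (real a)\<^sup>2) / \<kappa>"
      using inner_direction[OF a] True by (simp add: power2_eq_square algebra_simps add_divide_distrib)
    show ?thesis unfolding d unfolding e by (rule tail[OF a])
  next
    case False
    have lim: "(\<lambda>j. ?f j \<bullet> tail_sum a - ?f j \<bullet> tail_sum (Suc a))
        \<longlonglongrightarrow> ((real n + 1)\<^sup>2 - (real a)\<^sup>2) / \<kappa> - ((real n + 1)\<^sup>2 - (real (Suc a))\<^sup>2) / \<kappa>"
      by (intro tendsto_diff tail) (use a False in auto)
    have d: "((1 / \<kappa>) *\<^sub>R direction) \<bullet> e a = ((real n + 1)\<^sup>2 - (real a)\<^sup>2) / \<kappa> - ((real n + 1)\<^sup>2 - (real (Suc a))\<^sup>2) / \<kappa>"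
      unfolding diff_divide_distrib[symmetric] inner_scaleR_left inner_direction[OF a] by (simp add: power2_eq_square algebra_simps add_divide_distrib)
    have e: "e a = tail_sum a - tail_sum (Suc a)" using tail_sum_diff[OF a] False by simp
    show ?thesis unfolding d unfolding e inner_diff_right by (rule lim)
  qed
  show ?thesis
    unfolding \<kappa>_def[symmetric]
  proof (subst tendsto_componentwise_iff, intro ballI)
    fix b :: "real ^ 'n" assume "b \<in> Basis"
    then obtain a where "a \<in> {1..n}" "b = e a" using bij unfolding bij_betw_def by blast
    then show "(\<lambda>j. ?f j \<bullet> b) \<longlonglongrightarrow> ((1 / \<kappa>) *\<^sub>R direction) \<bullet> b" using comp by auto
  qed
qed

lemma norm_axis: "label v \<Longrightarrow> norm (axis v) = 1"
  using inner_axis[of v v] by (simp add: norm_eq_sqrt_inner)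

lemma norm_alcove_center:
  assumes "signed_perm n u" "z \<in> alcove u c"
  shows "norm (z - c) \<le> real n"
proof -
  obtain x where x: "x \<in> A\<^sub>0" "z = place u c x" using assms(2) by (auto simp: alcove_def)
  have "norm (z - c) \<le> (\<Sum>j<n. norm ((x \<bullet> e (Suc j)) *\<^sub>R axis (u ! j)))"
    unfolding x(2) place_def add_diff_cancel_left' by (rule norm_sum)
  also have "\<dots> \<le> (\<Sum>j<n. 1)"
  proof (intro sum_mono)
    fix j assume "j \<in> {..<n}"
    then have "label (u ! j)" "label (int (Suc j))" "axis (int (Suc j)) = e (Suc j)"
      using label_nth[OF assms(1)] by (auto simp: label_int axis_int simp del: of_nat_Suc)
    then show "norm ((x \<bullet> e (Suc j)) *\<^sub>R axis (u ! j)) \<le> 1"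
      using A0_axis_bound[OF x(1), of "int (Suc j)"] norm_axis by simp
  qed
  finally show ?thesis by simp
qed

lemma direction_nonzero: "direction \<noteq> 0"
  using inner_direction[of 1] n_pos by auto

lemma clock_at_top:
  assumes "filterlim (\<lambda>j. length (p j)) at_top sequentially"
  shows "filterlim (\<lambda>j. clock n (p j)) at_top sequentially"
proof (rule filterlim_at_top_mono)
  have "filterlim (\<lambda>j. real (length (p j))) at_top sequentially"
    by (rule filterlim_compose[OF filterlim_real_sequentially assms])
  then show "filterlim (\<lambda>j. (1 / real (Suc n)) * real (length (p j))) at_top sequentially"
    by (intro filterlim_tendsto_pos_mult_at_top[OF tendsto_const]) auto
  show "\<forall>\<^sub>F j in sequentially. (1 / real (Suc n)) * real (length (p j)) \<le> clock n (p j)"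
    using clock_ge[OF n_pos] by (intro always_eventually) auto
qed

lemma direction_tendsto:
  assumes len: "\<And>j. 0 < length (p j)" "filterlim (\<lambda>j. length (p j)) at_top sequentially"
    and mart: "\<And>\<xi>. \<xi> \<in> observables n \<Longrightarrow> (\<lambda>j. mart n \<xi> (p j) / length (p j)) \<longlonglongrightarrow> 0"
    and z: "\<And>j. z j \<in> alcove_of (p j)"
  shows "(\<lambda>j. z j /\<^sub>R norm (z j)) \<longlonglongrightarrow> direction /\<^sub>R norm direction"
proof -
  define c where "c = 1 / (2 * real n * (2 * real n + 1))"
  have c: "0 < c" using n_pos by (simp add: c_def)
  have top: "filterlim (\<lambda>j. clock n (p j)) at_top sequentially" by (rule clock_at_top[OF len(2)])
  have inv: "(\<lambda>j. inverse (clock n (p j))) \<longlonglongrightarrow> 0"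
    by (rule filterlim_compose[OF tendsto_inverse_0_at_top[OF filterlim_ident] top])
  have "(\<lambda>j. (z j - shift (p j)) /\<^sub>R clock n (p j)) \<longlonglongrightarrow> 0"
  proof (rule Lim_null_comparison)
    have "norm (z j - shift (p j)) \<le> real n" for j
      using norm_alcove_center[OF signed_perm_history] z[of j] unfolding alcove_of_def by blast
    then show "\<forall>\<^sub>F j in sequentially. norm ((z j - shift (p j)) /\<^sub>R clock n (p j)) \<le> \<bar>inverse (clock n (p j))\<bar> * real n"
      by (intro always_eventually allI) (simp add: mult_left_mono)
    show "(\<lambda>j. \<bar>inverse (clock n (p j))\<bar> * real n) \<longlonglongrightarrow> 0"
      by (intro tendsto_mult_left_zero tendsto_rabs_zero inv)
  qed
  moreover have "(\<lambda>j. shift (p j) /\<^sub>R clock n (p j)) \<longlonglongrightarrow> c *\<^sub>R direction"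
    unfolding c_def by (rule center_tendsto[OF len]) (rule mart)
  ultimately have "(\<lambda>j. (z j - shift (p j)) /\<^sub>R clock n (p j) + shift (p j) /\<^sub>R clock n (p j)) \<longlonglongrightarrow> 0 + c *\<^sub>R direction"
    by (rule tendsto_add)
  then have lim: "(\<lambda>j. z j /\<^sub>R clock n (p j)) \<longlonglongrightarrow> c *\<^sub>R direction"
    unfolding scaleR_add_right[symmetric] diff_add_cancel add_0_left .
  have lim': "(\<lambda>j. (z j /\<^sub>R clock n (p j)) /\<^sub>R norm (z j /\<^sub>R clock n (p j))) \<longlonglongrightarrow> (c *\<^sub>R direction) /\<^sub>R norm (c *\<^sub>R direction)"
    using c direction_nonzero by (intro tendsto_scaleR tendsto_inverse tendsto_norm lim) auto
  have d: "(c *\<^sub>R direction) /\<^sub>R norm (c *\<^sub>R direction) = direction /\<^sub>R norm direction"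
    using c by simp
  have zz: "(z j /\<^sub>R clock n (p j)) /\<^sub>R norm (z j /\<^sub>R clock n (p j)) = z j /\<^sub>R norm (z j)" for j
  proof -
    have "0 < clock n (p j)"
      using clock_ge[OF n_pos, of "p j"] len(1)[of j] by (intro less_le_trans[OF _ clock_ge[OF n_pos, of "p j"]]) simp
    then show ?thesis by simp
  qed
  show ?thesis using lim' unfolding d zz .
qed

text \<open>
  A uniform version of the convergence, obtained by contradiction: a sequence of counterexamples
  would have negligible martingale parts, and then the centres move away from all walls linearly.
\<close>

lemma eventually_interior:
  obtains \<epsilon> :: real and t0 :: nat where "0 < \<epsilon>" "0 < t0"
    "\<forall>p. t0 \<le> length p \<longrightarrow> (\<forall>\<xi>\<in>observables n. \<bar>mart n \<xi> p\<bar> < \<epsilon> * real (length p)) \<longrightarrow> interior_history p"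
proof (rule ccontr)
  assume neg: "\<not> thesis"
  have "\<exists>p. Suc j \<le> length p \<and> (\<forall>\<xi>\<in>observables n. \<bar>mart n \<xi> p\<bar> < (1 / real (Suc j)) * length p) \<and> \<not> interior_history p" for j
    using that[of "1 / real (Suc j)" "Suc j"] neg by fastforce
  then obtain p where p: "\<And>j. Suc j \<le> length (p j)"
    "\<And>j \<xi>. \<xi> \<in> observables n \<Longrightarrow> \<bar>mart n \<xi> (p j)\<bar> < (1 / real (Suc j)) * length (p j)" "\<And>j. \<not> interior_history (p j)"
    by metis
  have len: "0 < length (p j)" for j using p(1)[of j] by linarith
  have top: "filterlim (\<lambda>j. length (p j)) at_top sequentially"
    by (rule filterlim_at_top_mono[OF filterlim_Suc]) (use p(1) in \<open>auto intro: always_eventually\<close>)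
  have mart: "(\<lambda>j. mart n \<xi> (p j) / length (p j)) \<longlonglongrightarrow> 0" if "\<xi> \<in> observables n" for \<xi>
  proof (rule Lim_null_comparison)
    show "\<forall>\<^sub>F j in sequentially. norm (mart n \<xi> (p j) / length (p j)) \<le> 1 / real (Suc j)"
    proof (intro always_eventually allI)
      fix j
      have "0 < real (length (p j))" using len[of j] by simp
      then show "norm (mart n \<xi> (p j) / length (p j)) \<le> 1 / real (Suc j)"
        using p(2)[OF that, of j] by (simp add: abs_divide pos_divide_le_eq)
    qed
    show "(\<lambda>j. 1 / real (Suc j)) \<longlonglongrightarrow> 0" by (rule LIMSEQ_Suc[OF lim_1_over_n])
  qed
  define c where "c = 1 / (2 * real n * (2 * real n + 1))"
  have c: "0 < c" using n_pos by (simp add: c_def)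
  have lim: "(\<lambda>j. shift (p j) /\<^sub>R clock n (p j)) \<longlonglongrightarrow> c *\<^sub>R direction"
    unfolding c_def by (rule center_tendsto[OF len top]) (rule mart)
  have ct: "filterlim (\<lambda>j. clock n (p j)) at_top sequentially" by (rule clock_at_top[OF top])
  have cp: "0 < clock n (p j)" for j
    using clock_ge[OF n_pos, of "p j"] len[of j] by (intro less_le_trans[OF _ clock_ge[OF n_pos, of "p j"]]) simp
  have big: "\<forall>\<^sub>F j in sequentially. r < shift (p j) \<bullet> v" if "0 < direction \<bullet> v" for r v
  proof -
    have "(\<lambda>j. (shift (p j) /\<^sub>R clock n (p j)) \<bullet> v) \<longlonglongrightarrow> (c *\<^sub>R direction) \<bullet> v"
      by (intro tendsto_inner lim tendsto_const)
    moreover have "0 < (c *\<^sub>R direction) \<bullet> v" using that c by simp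
    ultimately have "filterlim (\<lambda>j. ((shift (p j) /\<^sub>R clock n (p j)) \<bullet> v) * clock n (p j)) at_top sequentially"
      by (intro filterlim_tendsto_pos_mult_at_top[OF _ _ ct])
    moreover have "((shift (p j) /\<^sub>R clock n (p j)) \<bullet> v) * clock n (p j) = shift (p j) \<bullet> v" for j
      using cp[of j] by simp
    ultimately have "filterlim (\<lambda>j. shift (p j) \<bullet> v) at_top sequentially" by (simp only:)
    then show ?thesis by (simp add: filterlim_at_top_dense)
  qed
  have "\<forall>\<^sub>F j in sequentially. 2 < shift (p j) \<bullet> e 1"
    using inner_direction[of 1] n_pos by (intro big) auto
  moreover have "\<forall>\<^sub>F j in sequentially. \<forall>a\<in>{1..<n}. 3 < shift (p j) \<bullet> (e (Suc a) - e a)"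
    using inner_direction by (intro eventually_ball_finite ballI big) (auto simp: inner_diff_right)
  ultimately have "\<forall>\<^sub>F j in sequentially. interior_history (p j)"
  proof eventually_elim
    case (elim j)
    show ?case
    proof (rule interior_if_far)
      fix a assume "1 \<le> a" "a < n"
      then have "3 < shift (p j) \<bullet> (e (Suc a) - e a)" using elim(2) by (meson atLeastLessThan_iff)
      then show "3 < shift (p j) \<bullet> e (Suc a) - shift (p j) \<bullet> e a" unfolding inner_diff_right .
    qed (rule elim(1))
  qed
  then show False using p(3) by (auto simp: eventually_sequentially)
qed

end

section \<open>The reduced random walk\<close>

lemma map_tl_ascent_pmf:
  "map_pmf tl (ascent_pmf n (Suc t)) = ascent_pmf n t"
  by (simp add: map_bind_pmf map_pmf_comp bind_return_pmf')

text \<open>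
  The property \<open>G\<close> holds at all times from \<open>t0\<close> on; the earlier histories are the suffixes.
\<close>

definition all_good :: "(nat list \<Rightarrow> bool) \<Rightarrow> nat \<Rightarrow> nat list \<Rightarrow> bool" where
  "all_good G t0 p \<longleftrightarrow> (\<forall>s. t0 \<le> s \<longrightarrow> s \<le> length p \<longrightarrow> G (drop (length p - s) p))"

lemma all_good_Cons:
  "all_good G t0 (i # p) \<longleftrightarrow> all_good G t0 p \<and> (t0 \<le> Suc (length p) \<longrightarrow> G (i # p))"
proof -
  have d: "drop (Suc (length p) - s) (i # p) = (if s \<le> length p then drop (length p - s) p else i # p)" if "s \<le> Suc (length p)" for s
    using that by (auto simp: Suc_diff_le)
  have "(\<forall>s. t0 \<le> s \<longrightarrow> s \<le> Suc (length p) \<longrightarrow> G (drop (Suc (length p) - s) (i # p)))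
      \<longleftrightarrow> (\<forall>s. t0 \<le> s \<longrightarrow> s \<le> length p \<longrightarrow> G (drop (length p - s) p)) \<and> (t0 \<le> Suc (length p) \<longrightarrow> G (i # p))"
    using d by (metis le_Suc_eq not_less_eq_eq order_refl)
  then show ?thesis by (simp add: all_good_def)
qed

lemma all_good_prob:
  assumes n: "0 < n" and t0: "0 < t0"
    and b: "\<And>t. 0 < t \<Longrightarrow> measure (measure_pmf (ascent_pmf n t)) {p. \<not> G p} \<le> b t" "\<And>t. 0 \<le> b t"
  shows "measure (measure_pmf (ascent_pmf n t)) {p. \<not> all_good G t0 p} \<le> (\<Sum>s\<in>{t0..t}. b s)"
proof (induction t)
  case 0
  have "{p \<in> set_pmf (ascent_pmf n 0). \<not> all_good G t0 p} = {}" using t0 by (auto simp: all_good_def)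
  then show ?case using t0 by (simp add: all_good_def)
next
  case (Suc t)
  let ?Q = "measure_pmf (ascent_pmf n (Suc t))"
  have "measure ?Q {p. \<not> all_good G t0 p} \<le> measure ?Q ({p. \<not> all_good G t0 (tl p)} \<union> (if t0 \<le> Suc t then {p. \<not> G p} else {}))"
  proof (rule measure_pmf.finite_measure_mono_AE)
    show "AE p in ?Q. p \<in> {p. \<not> all_good G t0 p} \<longrightarrow> p \<in> {p. \<not> all_good G t0 (tl p)} \<union> (if t0 \<le> Suc t then {p. \<not> G p} else {})"
    proof (rule AE_pmfI)
      fix p assume "p \<in> set_pmf (ascent_pmf n (Suc t))"
      then have "length p = Suc t" using set_ascent_pmf[OF n] by auto
      then obtain i q where "p = i # q" "length q = t" by (cases p) auto
      then show "p \<in> {p. \<not> all_good G t0 p} \<longrightarrow> p \<in> {p. \<not> all_good G t0 (tl p)} \<union> (if t0 \<le> Suc t then {p. \<not> G p} else {})"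
        by (auto simp: all_good_Cons)
    qed
  qed auto
  also have "\<dots> \<le> measure ?Q {p. \<not> all_good G t0 (tl p)} + measure ?Q (if t0 \<le> Suc t then {p. \<not> G p} else {})"
    by (rule measure_Un_le) auto
  also have "measure ?Q {p. \<not> all_good G t0 (tl p)} = measure (measure_pmf (map_pmf tl (ascent_pmf n (Suc t)))) {p. \<not> all_good G t0 p}"
    by (simp only: measure_map_pmf) (simp add: vimage_def)
  also have "\<dots> = measure (measure_pmf (ascent_pmf n t)) {p. \<not> all_good G t0 p}" unfolding map_tl_ascent_pmf ..
  also have "\<dots> + measure ?Q (if t0 \<le> Suc t then {p. \<not> G p} else {}) \<le> (\<Sum>s\<in>{t0..t}. b s) + (if t0 \<le> Suc t then b (Suc t) else 0)"
    using Suc b(1)[of "Suc t"] by (intro add_mono) auto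
  also have "\<dots> = (\<Sum>s\<in>{t0..Suc t}. b s)" by (auto simp: add.commute)
  finally show ?case by simp
qed

locale walk = coordinates e n
  for e :: "nat \<Rightarrow> real ^ 'n" and n +
  fixes M :: "'w measure" and X :: "nat \<Rightarrow> 'w \<Rightarrow> (real ^ 'n) set"
  assumes walk: "reduced_random_walk e dual_kac_label M X"
begin

sublocale prob_space M using walk unfolding reduced_random_walk_def by blast

lemma X_measurable: "X t \<in> measurable M (count_space (alcoves e))"
  using walk unfolding reduced_random_walk_def by blast

lemma X_in_alcoves: "\<omega> \<in> space M \<Longrightarrow> X t \<omega> \<in> alcoves e"
  using measurable_space[OF X_measurable] by simp

lemma event_sets: "{\<omega> \<in> space M. Q (X t \<omega>)} \<in> sets M"
proof -
  have "{\<omega> \<in> space M. Q (X t \<omega>)} = X t -` {A \<in> alcoves e. Q A} \<inter> space M" using X_in_alcoves by auto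
  also have "\<dots> \<in> sets M" by (rule measurable_sets[OF X_measurable]) simp
  finally show ?thesis .
qed

definition path :: "nat list \<Rightarrow> nat \<Rightarrow> (real ^ 'n) set" where
  "path p s = alcove_of (drop (length p - s) p)"

text \<open>
  The event that the walk visits the alcoves prescribed by a history.
\<close>

definition follows :: "nat list \<Rightarrow> 'w set" where
  "follows p = {\<omega> \<in> space M. \<forall>s\<le>length p. X s \<omega> = path p s}"

lemma path_Cons: "s \<le> length p \<Longrightarrow> path (i # p) s = path p s"
  by (simp add: path_def Suc_diff_le)

lemma path_end: "path p (length p) = alcove_of p"
  by (simp add: path_def)

lemma follows_Cons: "follows (i # p) = {\<omega> \<in> space M. (\<forall>s\<le>length p. X s \<omega> = path p s) \<and> X (Suc (length p)) \<omega> = alcove_of (i # p)}"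
  unfolding follows_def using path_Cons[of _ p i] path_end[of "i # p"] by (auto simp: le_Suc_eq)

lemma follows_sets: "follows p \<in> sets M"
proof -
  have "follows p = (\<Inter>s\<in>{..length p}. {\<omega> \<in> space M. X s \<omega> = path p s})" by (auto simp: follows_def)
  also have "\<dots> \<in> sets M" by (intro sets.finite_INT event_sets) auto
  finally show ?thesis .
qed

lemma measure_follows_Nil: "measure M (follows []) = 1"
proof -
  have "AE \<omega> in M. X 0 \<omega> = A\<^sub>0" using walk unfolding reduced_random_walk_def by blast
  moreover have "follows [] = {\<omega> \<in> space M. X 0 \<omega> = A\<^sub>0}" by (simp add: follows_def path_def alcove_of_Nil)
  ultimately show ?thesis using prob_Collect_eq_1[OF event_sets[of "\<lambda>A. A = A\<^sub>0" 0]] by simp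
qed

lemma markov: "measure M {\<omega> \<in> space M. (\<forall>s\<le>t. X s \<omega> = A s) \<and> X (Suc t) \<omega> = B} =
        measure M {\<omega> \<in> space M. \<forall>s\<le>t. X s \<omega> = A s} * transition_prob e dual_kac_label (A t) B"
  using walk unfolding reduced_random_walk_def by blast

lemma measure_follows_Cons:
  assumes "valid n p" "i \<in> moves (word n p)"
  shows "measure M (follows (i # p)) = measure M (follows p) / card (options p)"
  unfolding follows_Cons markov path_end transition_valid[OF assms] by (simp add: follows_def)

text \<open>
  The walk has at least as many admissible types as there are moves, since it may also leave the
  chamber. So a history that stays in the chamber is at most as likely for the walk as for the
  uniform choice among moves.
\<close>

lemma measure_follows_le: "valid n p \<Longrightarrow> measure M (follows p) \<le> pmf (ascent_pmf n (length p)) p"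
proof (induction p)
  case Nil
  show ?case by (simp add: measure_follows_Nil)
next
  case (Cons i p)
  then have v: "valid n p" "i \<in> moves (word n p)" by auto
  have "card (moves (word n p)) \<le> card (options p)" using options_bounds[OF v(1)] card_mono by blast
  moreover have "0 < card (moves (word n p))" using card_moves_word[OF n_pos] by blast
  ultimately have "measure M (follows p) / card (options p) \<le> pmf (ascent_pmf n (length p)) p / card (moves (word n p))"
    using Cons.IH[OF v(1)] by (intro frac_le) auto
  then show ?case using measure_follows_Cons[OF v] pmf_ascent_pmf_Cons[OF n_pos v(2) HOL.refl] by simp
qed

text \<open>
  The number of times at which the walk could have left the chamber.
\<close>

fun exposed :: "nat list \<Rightarrow> nat" where
  "exposed [] = 0"
| "exposed (i # p) = exposed p + of_bool (\<not> interior_history p)"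

text \<open>
  Conversely the loss is at most a factor \<open>n + 1\<close> at each exposed time, and nothing at the others.
\<close>

lemma measure_follows_ge:
  "valid n p \<Longrightarrow> pmf (ascent_pmf n (length p)) p \<le> measure M (follows p) * real (Suc n) ^ exposed p"
proof (induction p)
  case Nil
  show ?case by (simp add: measure_follows_Nil)
next
  case (Cons i p)
  then have v: "valid n p" "i \<in> moves (word n p)" by auto
  let ?m = "real (card (moves (word n p)))" and ?q = "real (card (options p))"
  have m: "1 \<le> ?m" using card_moves_word[OF n_pos, of p] by simp
  have q: "0 < ?q" "?q \<le> Suc n" using options_bounds[OF v(1)] by auto
  have IH: "pmf (ascent_pmf n (length p)) p / ?m \<le> measure M (follows p) * real (Suc n) ^ exposed p / ?m"
    using Cons.IH[OF v(1)] m by (intro divide_right_mono) auto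
  also have "\<dots> \<le> measure M (follows p) / ?q * real (Suc n) ^ exposed (i # p)"
  proof (cases "interior_history p")
    case True
    then show ?thesis using options_interior[OF v(1)] by simp
  next
    case False
    have "1 / ?m \<le> 1" using m by simp
    also have "1 \<le> real (Suc n) / ?q" using q by simp
    finally have "(measure M (follows p) * real (Suc n) ^ exposed p) * (1 / ?m)
        \<le> (measure M (follows p) * real (Suc n) ^ exposed p) * (real (Suc n) / ?q)"
      by (intro mult_left_mono) auto
    then show ?thesis using False by (simp add: mult_ac)
  qed
  finally show ?case using measure_follows_Cons[OF v] pmf_ascent_pmf_Cons[OF n_pos v(2) HOL.refl] by simp
qed

lemma follows_disjoint:
  assumes "valid n p" "valid n q" "length p = length q" "follows p \<inter> follows q \<noteq> {}"
  shows "p = q"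
  using assms
proof (induction p arbitrary: q)
  case (Cons i p)
  then obtain j q' where q: "q = j # q'" "length p = length q'" by (cases q) auto
  obtain \<omega> where w: "\<omega> \<in> follows (i # p)" "\<omega> \<in> follows (j # q')" using Cons.prems q by auto
  then have "\<omega> \<in> follows p" "\<omega> \<in> follows q'" unfolding follows_Cons by (auto simp: follows_def)
  then have eq: "p = q'" using Cons.IH[of q'] Cons.prems q by auto
  moreover have "alcove_of (i # p) = alcove_of (j # q')" using w q(2) unfolding follows_Cons by auto
  ultimately have "i = j" using alcove_of_Cons_inj[of i j p] moves_le[of i p] moves_le[of j p] Cons.prems q by auto
  then show ?case using eq q by simp
qed simp

text \<open>
  There are only countably many alcoves, so almost surely no transition of probability \<open>0\<close> occurs.
\<close>

lemma AE_allowed: "AE \<omega> in M. \<forall>t. \<exists>i\<le>n. allowed_step e i (X t \<omega>) (X (Suc t) \<omega>)"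
proof (subst AE_all_countable, intro allI)
  fix t
  let ?P = "{(L, B). L \<in> lists (alcoves e) \<and> B \<in> alcoves e \<and> transition_prob e dual_kac_label (L ! t) B = 0}"
  have "countable ?P"
    by (rule countable_subset[of _ "lists (alcoves e) \<times> alcoves e"]) (auto intro: countable_lists countable_alcoves)
  moreover have "AE \<omega> in M. \<not> ((\<forall>s\<le>t. X s \<omega> = fst LB ! s) \<and> X (Suc t) \<omega> = snd LB)" if "LB \<in> ?P" for LB
  proof -
    let ?S = "{\<omega> \<in> space M. (\<forall>s\<le>t. X s \<omega> = fst LB ! s) \<and> X (Suc t) \<omega> = snd LB}"
    have "?S = (\<Inter>s\<in>{..t}. {\<omega> \<in> space M. X s \<omega> = fst LB ! s}) \<inter> {\<omega> \<in> space M. X (Suc t) \<omega> = snd LB}" by auto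
    also have "\<dots> \<in> sets M" by (intro sets.Int sets.finite_INT event_sets) auto
    finally have S: "?S \<in> sets M" .
    have tp: "transition_prob e dual_kac_label (fst LB ! t) (snd LB) = 0" using that by auto
    have "measure M ?S = 0" unfolding markov tp by simp
    then have "emeasure M ?S = 0" by (simp only: emeasure_eq_measure ennreal_0)
    then have "?S \<in> null_sets M" using S by (rule null_setsI)
    from AE_not_in[OF this] AE_space show ?thesis by eventually_elim blast
  qed
  ultimately have "AE \<omega> in M. \<forall>LB\<in>?P. \<not> ((\<forall>s\<le>t. X s \<omega> = fst LB ! s) \<and> X (Suc t) \<omega> = snd LB)"
    by (subst AE_ball_countable) blast+
  then show "AE \<omega> in M. \<exists>i\<le>n. allowed_step e i (X t \<omega>) (X (Suc t) \<omega>)"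
    using AE_space
  proof eventually_elim
    case (elim \<omega>)
    let ?L = "map (\<lambda>s. X s \<omega>) [0..<Suc t]"
    have L: "?L ! s = X s \<omega>" if "s \<le> t" for s using that by (simp del: upt_Suc)
    have "?L \<in> lists (alcoves e)" using X_in_alcoves[OF elim(2)] by (auto simp del: upt_Suc)
    moreover have "X (Suc t) \<omega> \<in> alcoves e" by (rule X_in_alcoves[OF elim(2)])
    moreover have "(?L, X (Suc t) \<omega>) \<notin> ?P"
    proof
      assume "(?L, X (Suc t) \<omega>) \<in> ?P"
      with elim(1) have "\<not> ((\<forall>s\<le>t. X s \<omega> = ?L ! s) \<and> X (Suc t) \<omega> = X (Suc t) \<omega>)"
        unfolding fst_conv snd_conv by (metis (no_types, lifting) fst_conv snd_conv)
      then show False using L by metis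
    qed
    ultimately have "transition_prob e dual_kac_label (?L ! t) (X (Suc t) \<omega>) \<noteq> 0" by blast
    then have ne: "transition_prob e dual_kac_label (X t \<omega>) (X (Suc t) \<omega>) \<noteq> 0" unfolding L[OF order_refl] .
    show ?case
    proof (rule ccontr)
      assume "\<not> ?case"
      then have none: "{i. i \<le> CARD('n) \<and> allowed_step e i (X t \<omega>) (X (Suc t) \<omega>)} = {}" by (auto simp: n_eq[symmetric])
      have "transition_prob e dual_kac_label (X t \<omega>) (X (Suc t) \<omega>) = 0" unfolding transition_prob_def none by simp
      then show False using ne by simp
    qed
  qed
qed

text \<open>
  As the walk cannot return to the chamber, being confined eventually means being
  confined always, and the walk follows a history of moves.
\<close>

lemma confined_history:
  assumes \<omega>: "\<omega> \<in> space M" "X 0 \<omega> = A\<^sub>0" and allowed: "\<forall>t. \<exists>i\<le>n. allowed_step e i (X t \<omega>) (X (Suc t) \<omega>)"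
    and conf: "eventually_confined (\<lambda>t. X t \<omega>) C\<^sub>0"
  shows "\<exists>p. valid n p \<and> length p = t \<and> \<omega> \<in> follows p"
proof (induction t)
  case 0
  show ?case using \<omega> by (auto simp: follows_def path_def alcove_of_Nil)
next
  case (Suc t)
  then obtain p where p: "valid n p" "length p = t" "\<omega> \<in> follows p" by blast
  obtain T where T: "\<And>s. T \<le> s \<Longrightarrow> X s \<omega> \<subseteq> C\<^sub>0" using conf unfolding eventually_confined_def eventually_sequentially by blast
  have "X s \<omega> \<subseteq> C\<^sub>0" if "s \<le> T + Suc t" for s
    using that
  proof (induction rule: inc_induct)
    case base
    show ?case by (rule T) simp
  next
    case (step m)
    then show ?case using allowed no_return by blast
  qed
  then have in_C: "X (Suc t) \<omega> \<subseteq> C\<^sub>0" by simp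
  obtain i where i: "i \<le> n" "allowed_step e i (X t \<omega>) (X (Suc t) \<omega>)" using allowed by blast
  have Xt: "X t \<omega> = alcove_of p" using p path_end[of p] by (auto simp: follows_def)
  have "i \<in> moves (word n p)" using allowed_valid[OF i(1) _ in_C] i(2) Xt by simp
  moreover have "X (Suc t) \<omega> = alcove_of (i # p)" using allowed_target[OF i(1)] i(2) Xt by simp
  ultimately show ?case using p by (intro exI[of _ "i # p"]) (auto simp: follows_Cons, auto simp: follows_def)
qed

lemma measure_follows_set_le:
  assumes "\<And>p. p \<in> S \<Longrightarrow> valid n p \<and> length p = t"
  shows "measure M (\<Union>p\<in>S. follows p) \<le> measure (measure_pmf (ascent_pmf n t)) S"
proof -
  have fin: "finite S"
    by (rule finite_subset[OF _ finite_set_ascent_pmf[OF n_pos, of t]]) (use assms set_ascent_pmf[OF n_pos] in auto)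
  have "measure M (\<Union>p\<in>S. follows p) \<le> (\<Sum>p\<in>S. measure M (follows p))"
    by (rule finite_measure_subadditive_finite[OF fin]) (auto simp: follows_sets)
  also have "\<dots> \<le> (\<Sum>p\<in>S. pmf (ascent_pmf n t) p)"
    using assms measure_follows_le by (intro sum_mono) auto
  also have "\<dots> = measure (measure_pmf (ascent_pmf n t)) S" by (simp add: measure_measure_pmf_finite[OF fin])
  finally show ?thesis .
qed

definition deviant :: "(int list \<Rightarrow> nat \<Rightarrow> real) \<Rightarrow> real \<Rightarrow> nat \<Rightarrow> nat list set" where
  "deviant \<xi> \<epsilon> t = {p. valid n p \<and> length p = t \<and> \<epsilon> * real t \<le> \<bar>mart n \<xi> p\<bar>}"

text \<open>
  Borel and Cantelli, with the probabilities of the walk dominated by those of the moves.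
\<close>

lemma AE_not_deviant:
  assumes \<xi>: "\<xi> \<in> observables n" and \<epsilon>: "0 < \<epsilon>"
  shows "AE \<omega> in M. \<forall>\<^sub>F t in sequentially. \<forall>p. valid n p \<longrightarrow> length p = t \<longrightarrow> \<omega> \<in> follows p \<longrightarrow> \<bar>mart n \<xi> p\<bar> < \<epsilon> * real t"
proof -
  define D where "D t = (\<Union>p\<in>deviant \<xi> \<epsilon> t. follows p)" for t
  have fin: "finite (deviant \<xi> \<epsilon> t)" for t
    by (rule finite_subset[OF _ finite_set_ascent_pmf[OF n_pos, of t]]) (use set_ascent_pmf[OF n_pos] in \<open>auto simp: deviant_def\<close>)
  have D: "D t \<in> sets M" for t unfolding D_def using fin by (intro sets.finite_UN follows_sets) auto
  have le: "measure M (D t) \<le> 176 / \<epsilon> ^ 4 * (1 / (real t)\<^sup>2)" if "0 < t" for t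
  proof -
    have "measure M (D t) \<le> measure (measure_pmf (ascent_pmf n t)) (deviant \<xi> \<epsilon> t)"
      unfolding D_def by (rule measure_follows_set_le) (simp add: deviant_def)
    also have "\<dots> \<le> measure (measure_pmf (ascent_pmf n t)) {p. \<epsilon> * real t \<le> \<bar>mart n \<xi> p\<bar>}"
      by (rule measure_pmf.finite_measure_mono) (auto simp: deviant_def)
    also have "\<dots> \<le> 176 / \<epsilon> ^ 4 * (1 / (real t)\<^sup>2)"
      by (rule mart_tail[OF n_pos observables_bounded[OF \<xi>] \<epsilon> that])
    finally show ?thesis .
  qed
  have "summable (\<lambda>t. 176 / \<epsilon> ^ 4 * (1 / (real t)\<^sup>2))"
    using inverse_power_summable[of 2, where 'a = real] by (intro summable_mult) (simp add: inverse_eq_divide)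
  then have "summable (\<lambda>t. measure M (D t))"
  proof (rule summable_comparison_test_ev[rotated])
    show "\<forall>\<^sub>F t in sequentially. norm (measure M (D t)) \<le> 176 / \<epsilon> ^ 4 * (1 / (real t)\<^sup>2)"
      using eventually_gt_at_top[of 0] by eventually_elim (use le in simp)
  qed
  then have "AE \<omega> in M. \<forall>\<^sub>F t in sequentially. \<omega> \<in> space M - D t"
    by (intro borel_cantelli_AE1 D) (simp_all add: emeasure_eq_measure)
  then show ?thesis
  proof eventually_elim
    case (elim \<omega>)
    then show ?case
      by eventually_elim (force simp: D_def deviant_def)
  qed
qed

lemma AE_direction:
  "AE \<omega> in M. eventually_confined (\<lambda>t. X t \<omega>) C\<^sub>0 \<longrightarrow>
     (\<forall>x. (\<forall>t. x t \<in> X t \<omega>) \<longrightarrow> (\<lambda>t. x t /\<^sub>R norm (x t)) \<longlonglongrightarrow> direction /\<^sub>R norm direction)"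
proof -
  have "AE \<omega> in M. \<forall>\<xi>\<in>observables n. \<forall>m. \<forall>\<^sub>F t in sequentially. \<forall>p. valid n p \<longrightarrow> length p = t \<longrightarrow> \<omega> \<in> follows p
      \<longrightarrow> \<bar>mart n \<xi> p\<bar> < 1 / real (Suc m) * real t"
  proof (subst AE_ball_countable[OF countable_finite[OF finite_observables]], intro ballI, subst AE_all_countable, intro allI)
    fix \<xi> m assume "\<xi> \<in> observables n"
    then show "AE \<omega> in M. \<forall>\<^sub>F t in sequentially. \<forall>p. valid n p \<longrightarrow> length p = t \<longrightarrow> \<omega> \<in> follows p
      \<longrightarrow> \<bar>mart n \<xi> p\<bar> < 1 / real (Suc m) * real t"
      by (rule AE_not_deviant) simp
  qed
  moreover have "AE \<omega> in M. X 0 \<omega> = A\<^sub>0" using walk unfolding reduced_random_walk_def by blast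
  ultimately show ?thesis
    using AE_allowed AE_space
  proof eventually_elim
    case (elim \<omega>)
    show ?case
    proof (intro impI allI)
      fix x assume conf: "eventually_confined (\<lambda>t. X t \<omega>) C\<^sub>0" and x: "\<forall>t. x t \<in> X t \<omega>"
      obtain p where p: "\<And>t. valid n (p t) \<and> length (p t) = t \<and> \<omega> \<in> follows (p t)"
        using confined_history[OF elim(4,2,3) conf] by metis
      have "(\<lambda>t. x (Suc t) /\<^sub>R norm (x (Suc t))) \<longlonglongrightarrow> direction /\<^sub>R norm direction"
      proof (rule direction_tendsto[of "\<lambda>t. p (Suc t)"])
        show "0 < length (p (Suc t))" for t using p by simp
        show "filterlim (\<lambda>t. length (p (Suc t))) at_top sequentially" using p filterlim_Suc by simp
        show "x (Suc t) \<in> alcove_of (p (Suc t))" for t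
        proof -
          have "X (Suc t) \<omega> = path (p (Suc t)) (length (p (Suc t)))"
            using p[of "Suc t"] by (simp add: follows_def)
          then show ?thesis using x path_end by metis
        qed
        fix \<xi> assume \<xi>: "\<xi> \<in> observables n"
        have "(\<lambda>t. mart n \<xi> (p t) / real t) \<longlonglongrightarrow> 0"
        proof (rule LIMSEQ_I)
          fix r :: real assume "0 < r"
          then obtain m where m: "1 / real (Suc m) < r" using nat_approx_posE by metis
          have "\<forall>\<^sub>F t in sequentially. norm (mart n \<xi> (p t) / real t - 0) < r"
            using elim(1)[rule_format, OF \<xi>, of m] eventually_gt_at_top[of 0]
          proof eventually_elim
            case (elim t)
            then have "\<bar>mart n \<xi> (p t)\<bar> < 1 / real (Suc m) * real t" using p by blast
            then have "\<bar>mart n \<xi> (p t)\<bar> / real t < 1 / real (Suc m)" using elim(2) by (simp add: pos_divide_less_eq)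
            then show ?case using m by (simp add: abs_divide)
          qed
          then show "\<exists>no. \<forall>t\<ge>no. norm (mart n \<xi> (p t) / real t - 0) < r" by (simp add: eventually_sequentially)
        qed
        then show "(\<lambda>t. mart n \<xi> (p (Suc t)) / real (length (p (Suc t)))) \<longlonglongrightarrow> 0"
          using p by (subst (asm) filterlim_sequentially_Suc[symmetric]) simp
      qed
      then show "(\<lambda>t. x t /\<^sub>R norm (x t)) \<longlonglongrightarrow> direction /\<^sub>R norm direction"
        by (rule LIMSEQ_imp_Suc)
    qed
  qed
qed

text \<open>
  Under the uniform choice among moves, with probability at least \<open>1 / 2\<close> the observables are well
  behaved at all times from some \<open>t0\<close> on, and such histories are exposed at most \<open>t0\<close> times. So the
  walk follows them with a probability that is bounded below independently of the length.
\<close>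

lemma confined_lower_bound:
  obtains \<delta> where "0 < \<delta>" "\<forall>t. \<delta> \<le> measure M {\<omega> \<in> space M. \<forall>s\<le>t. X s \<omega> \<subseteq> C\<^sub>0}"
proof -
  obtain \<epsilon> :: real and t1 :: nat where \<epsilon>: "0 < \<epsilon>" "0 < t1" and int:
    "\<forall>p. t1 \<le> length p \<longrightarrow> (\<forall>\<xi>\<in>observables n. \<bar>mart n \<xi> p\<bar> < \<epsilon> * real (length p)) \<longrightarrow> interior_history p"
    by (rule eventually_interior)
  define G where "G p \<longleftrightarrow> (\<forall>\<xi>\<in>observables n. \<bar>mart n \<xi> p\<bar> < \<epsilon> * real (length p))" for p
  \<comment> \<open>A union bound over the observables; the resulting tails are summable in \<open>t\<close>.\<close>
  define K where "K = real (card (observables n)) * (176 / \<epsilon> ^ 4)"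
  define b where "b t = K * (1 / (real t)\<^sup>2)" for t
  have K: "0 \<le> K" by (simp add: K_def)
  have b: "0 \<le> b t" for t using K by (simp add: b_def)
  have G: "measure (measure_pmf (ascent_pmf n t)) {p. \<not> G p} \<le> b t" if "0 < t" for t
  proof -
    let ?Q = "measure_pmf (ascent_pmf n t)"
    have "measure ?Q {p. \<not> G p} \<le> measure ?Q (\<Union>\<xi>\<in>observables n. {p. \<epsilon> * real t \<le> \<bar>mart n \<xi> p\<bar>})"
    proof (rule measure_pmf.finite_measure_mono_AE)
      show "AE p in ?Q. p \<in> {p. \<not> G p} \<longrightarrow> p \<in> (\<Union>\<xi>\<in>observables n. {p. \<epsilon> * real t \<le> \<bar>mart n \<xi> p\<bar>})"
        by (rule AE_pmfI) (auto simp: G_def set_ascent_pmf[OF n_pos] not_less[symmetric])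
    qed auto
    also have "\<dots> \<le> (\<Sum>\<xi>\<in>observables n. measure ?Q {p. \<epsilon> * real t \<le> \<bar>mart n \<xi> p\<bar>})"
      by (rule measure_pmf.finite_measure_subadditive_finite[OF finite_observables]) auto
    also have "\<dots> \<le> (\<Sum>\<xi>\<in>observables n. 176 / \<epsilon> ^ 4 * (1 / (real t)\<^sup>2))"
      by (intro sum_mono mart_tail[OF n_pos observables_bounded \<epsilon>(1) that])
    also have "\<dots> = b t" by (simp add: b_def K_def)
    finally show ?thesis .
  qed
  have "summable b"
    unfolding b_def using inverse_power_summable[of 2, where 'a = real] by (intro summable_mult) (simp add: inverse_eq_divide)
  then obtain t2 where t2: "\<And>m k. t2 \<le> m \<Longrightarrow> norm (\<Sum>s\<in>{m..<k}. b s) < 1 / 2"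
    unfolding summable_Cauchy by (metis half_gt_zero_iff zero_less_one)
  define t0 where "t0 = max t1 t2"
  have t0: "0 < t0" "t1 \<le> t0" "t2 \<le> t0" using \<epsilon> by (auto simp: t0_def)
  have half: "1 / 2 \<le> measure (measure_pmf (ascent_pmf n t)) {p. all_good G t0 p}" for t
  proof -
    have "measure (measure_pmf (ascent_pmf n t)) {p. \<not> all_good G t0 p} \<le> (\<Sum>s\<in>{t0..t}. b s)"
      by (rule all_good_prob[OF n_pos t0(1) G b])
    also have "\<dots> \<le> 1 / 2" using t2[OF t0(3), of "Suc t"] by (simp add: atLeastLessThanSuc_atLeastAtMost)
    finally have "measure (measure_pmf (ascent_pmf n t)) {p. \<not> all_good G t0 p} \<le> 1 / 2" .
    moreover have "measure (measure_pmf (ascent_pmf n t)) {p. \<not> all_good G t0 p} = 1 - measure (measure_pmf (ascent_pmf n t)) {p. all_good G t0 p}"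
      using measure_pmf.prob_compl[of "{p. all_good G t0 p}" "ascent_pmf n t"] by (simp add: Compl_eq_Diff_UNIV[symmetric] Collect_neg_eq)
    ultimately show ?thesis by simp
  qed
  have exposed: "exposed p \<le> min (length p) t0" if "all_good G t0 p" for p
    using that
  proof (induction p)
    case (Cons i p)
    then have ag: "all_good G t0 p" by (simp add: all_good_Cons)
    show ?case
    proof (cases "t0 \<le> length p")
      case True
      then have "G p" using ag unfolding all_good_def by (metis diff_self_eq_0 drop_0 order_refl)
      then have "interior_history p" using True t0 int unfolding G_def by (meson order_trans)
      then show ?thesis using Cons.IH[OF ag] by simp
    next
      case False
      then show ?thesis using Cons.IH[OF ag] by simp
    qed
  qed simp
  define \<delta> where "\<delta> = 1 / (2 * real (Suc n) ^ t0)"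
  have "\<delta> \<le> measure M {\<omega> \<in> space M. \<forall>s\<le>t. X s \<omega> \<subseteq> C\<^sub>0}" for t
  proof -
    define S where "S = {p. valid n p \<and> length p = t \<and> all_good G t0 p}"
    have fin: "finite S"
      by (rule finite_subset[OF _ finite_set_ascent_pmf[OF n_pos, of t]]) (use set_ascent_pmf[OF n_pos] in \<open>auto simp: S_def\<close>)
    have "1 / 2 \<le> measure (measure_pmf (ascent_pmf n t)) {p. all_good G t0 p}" by (rule half)
    also have "\<dots> = measure (measure_pmf (ascent_pmf n t)) S"
      by (rule measure_pmf.finite_measure_eq_AE) (auto intro!: AE_pmfI simp: S_def set_ascent_pmf[OF n_pos])
    also have "\<dots> = (\<Sum>p\<in>S. pmf (ascent_pmf n t) p)" by (rule measure_measure_pmf_finite[OF fin])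
    also have "\<dots> \<le> (\<Sum>p\<in>S. measure M (follows p) * real (Suc n) ^ t0)"
    proof (intro sum_mono)
      fix p assume p: "p \<in> S"
      have "pmf (ascent_pmf n t) p \<le> measure M (follows p) * real (Suc n) ^ exposed p"
        using measure_follows_ge[of p] p by (auto simp: S_def)
      also have "\<dots> \<le> measure M (follows p) * real (Suc n) ^ t0"
        using exposed[of p] p by (intro mult_left_mono power_increasing) (auto simp: S_def)
      finally show "pmf (ascent_pmf n t) p \<le> measure M (follows p) * real (Suc n) ^ t0" .
    qed
    also have "\<dots> = (\<Sum>p\<in>S. measure M (follows p)) * real (Suc n) ^ t0" by (simp add: sum_distrib_right)
    also have "(\<Sum>p\<in>S. measure M (follows p)) = measure M (\<Union>p\<in>S. follows p)"
    proof (rule finite_measure_finite_Union[symmetric, OF fin])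
      show "follows ` S \<subseteq> sets M" by (auto simp: follows_sets)
      show "disjoint_family_on follows S"
        unfolding disjoint_family_on_def using follows_disjoint by (auto simp: S_def)
    qed
    also have "measure M (\<Union>p\<in>S. follows p) \<le> measure M {\<omega> \<in> space M. \<forall>s\<le>t. X s \<omega> \<subseteq> C\<^sub>0}"
    proof (rule finite_measure_mono)
      have "{\<omega> \<in> space M. \<forall>s\<le>t. X s \<omega> \<subseteq> C\<^sub>0} = (\<Inter>s\<in>{..t}. {\<omega> \<in> space M. X s \<omega> \<subseteq> C\<^sub>0})" by auto
      also have "\<dots> \<in> sets M" by (intro sets.finite_INT event_sets) auto
      finally show "{\<omega> \<in> space M. \<forall>s\<le>t. X s \<omega> \<subseteq> C\<^sub>0} \<in> sets M" .
      have valid_drop: "valid n (drop k p)" if "valid n p" for k p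
        using that by (induction p arbitrary: k) (auto simp: drop_Cons split: nat.split)
      show "(\<Union>p\<in>S. follows p) \<subseteq> {\<omega> \<in> space M. \<forall>s\<le>t. X s \<omega> \<subseteq> C\<^sub>0}"
      proof clarify
        fix p \<omega> assume p: "p \<in> S" "\<omega> \<in> follows p"
        have "X s \<omega> \<subseteq> C\<^sub>0" if "s \<le> t" for s
        proof -
          have "X s \<omega> = alcove_of (drop (t - s) p)" using p that by (simp add: follows_def S_def path_def)
          then show ?thesis using valid_in_chamber[OF valid_drop] p(1) by (simp add: S_def)
        qed
        then show "\<omega> \<in> space M \<and> (\<forall>s\<le>t. X s \<omega> \<subseteq> C\<^sub>0)" using p(2) by (simp add: follows_def)
      qed
    qed
    finally have "1 / 2 \<le> measure M {\<omega> \<in> space M. \<forall>s\<le>t. X s \<omega> \<subseteq> C\<^sub>0} * real (Suc n) ^ t0"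
      by (simp add: mult_right_mono)
    then show ?thesis by (simp add: \<delta>_def divide_le_eq mult.commute)
  qed
  moreover have "0 < \<delta>" by (simp add: \<delta>_def)
  ultimately show ?thesis using that by blast
qed

lemma confined_positive: "0 < measure M {\<omega> \<in> space M. eventually_confined (\<lambda>t. X t \<omega>) C\<^sub>0}"
proof -
  obtain \<delta> where \<delta>: "0 < \<delta>" "\<forall>t. \<delta> \<le> measure M {\<omega> \<in> space M. \<forall>s\<le>t. X s \<omega> \<subseteq> C\<^sub>0}"
    by (rule confined_lower_bound)
  define D where "D t = {\<omega> \<in> space M. \<forall>s\<le>t. X s \<omega> \<subseteq> C\<^sub>0}" for t
  have D: "D t \<in> sets M" for t
  proof -
    have "D t = (\<Inter>s\<in>{..t}. {\<omega> \<in> space M. X s \<omega> \<subseteq> C\<^sub>0})" by (auto simp: D_def)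
    also have "\<dots> \<in> sets M" by (intro sets.finite_INT event_sets) auto
    finally show ?thesis .
  qed
  have "decseq D" unfolding decseq_def D_def by (blast intro: le_trans)
  then have "(\<lambda>t. measure M (D t)) \<longlonglongrightarrow> measure M (\<Inter>t. D t)"
    using D by (intro finite_Lim_measure_decseq) auto
  then have "\<delta> \<le> measure M (\<Inter>t. D t)"
    by (rule LIMSEQ_le_const) (use \<delta>(2) in \<open>auto simp: D_def\<close>)
  also have "\<dots> \<le> measure M {\<omega> \<in> space M. eventually_confined (\<lambda>t. X t \<omega>) C\<^sub>0}"
  proof (rule finite_measure_mono)
    show "(\<Inter>t. D t) \<subseteq> {\<omega> \<in> space M. eventually_confined (\<lambda>t. X t \<omega>) C\<^sub>0}"
      by (auto simp: D_def eventually_confined_def intro!: always_eventually)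
    have "{\<omega> \<in> space M. eventually_confined (\<lambda>t. X t \<omega>) C\<^sub>0} = (\<Union>N. \<Inter>t\<in>{N..}. {\<omega> \<in> space M. X t \<omega> \<subseteq> C\<^sub>0})"
      by (auto simp: eventually_confined_def eventually_sequentially)
    also have "\<dots> \<in> sets M"
    proof (rule sets.countable_UN, clarify)
      show "(\<Inter>t\<in>{N..}. {\<omega> \<in> space M. X t \<omega> \<subseteq> C\<^sub>0}) \<in> sets M" for N
        by (rule sets.countable_INT') (auto intro: event_sets)
    qed
    finally show "{\<omega> \<in> space M. eventually_confined (\<lambda>t. X t \<omega>) C\<^sub>0} \<in> sets M" .
  qed
  finally show ?thesis using \<delta>(1) by simp
qed

lemma limiting_direction_direction: "limiting_direction e M X (direction /\<^sub>R norm direction)"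
  unfolding limiting_direction_def using confined_positive AE_direction by blast

end

theorem theorem3p1:
  fixes e :: "nat \<Rightarrow> real ^ 'n"
    and M :: "'w measure"
    and X :: "nat \<Rightarrow> 'w \<Rightarrow> (real ^ 'n) set"
  assumes "bij_betw e {1..CARD('n)} Basis"
    and "reduced_random_walk e dual_kac_label M X"
  shows "\<exists>c>0. limiting_direction e M X
                  (c *\<^sub>R (\<Sum>i = 1..CARD('n). (2 * real i + 1) *\<^sub>R e i))"
proof -
  interpret walk e "CARD('n)" M X
    by unfold_locales (use assms in auto)
  show ?thesis
    using limiting_direction_direction direction_nonzero unfolding direction_def by (intro exI[of _ "inverse (norm direction)"]) (auto simp: direction_def)
qed

end
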